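(* Let $\Gamma$ be a groupoid and let $R$ be a $\Gamma$-graded gr-semiprimary ring. The following assertions hold for every $\Gamma$-graded right (or left) $R$-module $M$: (1) $M$ is gr-noetherian $\Leftrightarrow$ $M$ is gr-artinian $\Leftrightarrow$ $M$ has finite gr-length. (2) $M$ is $\Gamma_0$-noetherian $\Leftrightarrow$ $M$ is $\Gamma_0$-artinian $\Leftrightarrow$ $M$ has $\Gamma_0$-finite gr-length. (3) $M$ is strongly $\Gamma_0$-noetherian $\Leftrightarrow$ $M$ is strongly $\Gamma_0$-artinian $\Leftrightarrow$ $M$ has strongly $\Gamma_0$-finite gr-length.
   Context: A groupoid $\Gamma$ is the set of morphisms of a small category in which all morphisms are invertible; $\Gamma_0\subseteq\Gamma$ is the set of identity morphisms; $d(\gamma)=\gamma^{-1}\gamma$, $r(\gamma)=\gamma\gamma^{-1}$; the product $\gamma\delta$ is defined iff $d(\gamma)=r(\delta)$. Rings are associative, not necessarily unital. A $\Gamma$-graded ring is a ring $R=\bigoplus_{\gamma\in\Gamma}R_\gamma$ (additive subgroups) with $R_\gamma R_\delta\subseteq R_{\gamma\delta}$ if $d(\gamma)=r(\delta)$ and $R_\gamma R_\delta=0$ otherwise; it is always assumed object unital: for each $e\in\Gamma_0$ the ring $R_e$ has an identity $1_e$ (possibly $0$) with $1_{r(\gamma)}a=a=a1_{d(\gamma)}$ for all $a\in R_\gamma$, $\gamma\in\Gamma$. A $\Gamma$-graded right $R$-module is a right $R$-module $M=\bigoplus_{\gamma}M_\gamma$ with $M_\sigma R_\tau\subseteq M_{\sigma\tau}$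 if $d(\sigma)=r(\tau)$, $M_\sigma R_\tau=0$ otherwise, and $m1_{d(\sigma)}=m$ for $m\in M_\sigma$. A submodule (or one- or two-sided ideal) $N$ is graded if $N=\bigoplus_\gamma (N\cap M_\gamma)$. For $e\in\Gamma_0$, $M(e):=\bigoplus_{r(\gamma)=e}M_\gamma$, a graded submodule; $M=\bigoplus_{e\in\Gamma_0}M(e)$. Graded left modules and all notions for them are defined symmetrically, with $M(e)$ replaced by $(e)M:=\bigoplus_{d(\gamma)=e}M_\gamma$. A graded module is gr-artinian (gr-noetherian) if it has no infinite strictly decreasing (increasing) chain of graded submodules. A nonzero graded module is gr-simple if its only graded submodules are $0$ and itself. $M$ has finite gr-length $n$ if there is a chain $0=M_0\subseteq M_1\subseteq\cdots\subseteq M_n=M$ of graded submodules with each $M_j/M_{j-1}$ gr-simple. $M$ is $\Gamma_0$-artinian / $\Gamma_0$-noetherian / of $\Gamma_0$-finite gr-length if $M(e)$ is gr-artinian / gr-noetherian / of finite gr-length for every $e\in\Gamma_0$. $M$ has strongly $\Gamma_0$-finite gr-length if there is $n\in\mathbb N$ such that every $M(e)$ has finite gr-length less than $n$. $M$ is strongly $\Gamma_0$-artinian (resp. strongly $\Gamma_0$-noetherian) if there is no infinite strictly decreasing (resp. increasing) chain $\{M_i\}_{i\ge1}$ of graded submodules of $M$ such that for all $e\in\Gamma_0$ and $i\ge 1$: $M_i(e)=M_{i+1}(e)$ implies $M_i(e)=M_{i+l}(e)$ for all $l\ge1$. $\mathrm{rad}^{\mathrm{gr}}(R)$, the graded Jacobson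 radical, is the intersection of all gr-maximal graded right ideals (those maximal among proper graded right ideals); it is a graded two-sided ideal. A graded module is gr-semisimple if it is a sum of gr-simple graded submodules; a graded ring is gr-semisimple if it is so as a right module over itself. A graded ideal $U$ is objectwise nilpotent if for each $e\in\Gamma_0$ there are positive integers $n_e,m_e$ with $1_eU^{n_e}=0$ and $U^{m_e}1_e=0$. $R$ is gr-semiprimary if $R/\mathrm{rad}^{\mathrm{gr}}(R)$ is a gr-semisimple ring and $\mathrm{rad}^{\mathrm{gr}}(R)$ is objectwise nilpotent. *)

theory Defs
  imports "HOL-Algebra.Module" "HOL-Algebra.QuotRing" "HOL-Algebra.Ideal_Product"
begin

section \<open>Groupoids\<close>

text \<open>
  A small category is given by its set of morphisms only; objects are identified with their
  identity morphisms, so \<open>src\<close> and \<open>tgt\<close> (the maps d and r) take values in the set of identities.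
  The value of \<open>cmp \<Gamma> g h\<close> is meaningful only when \<open>src \<Gamma> g = tgt \<Gamma> h\<close>.
\<close>

record 'g gpd =
  arr :: "'g set"
  cmp :: "'g \<Rightarrow> 'g \<Rightarrow> 'g"
  src :: "'g \<Rightarrow> 'g"
  tgt :: "'g \<Rightarrow> 'g"

definition ids :: "('g, 'x) gpd_scheme \<Rightarrow> 'g set" where
  "ids \<Gamma> = {e \<in> arr \<Gamma>. src \<Gamma> e = e}"

locale small_category =
  fixes \<Gamma> :: "('g, 'x) gpd_scheme"
  assumes src_closed: "g \<in> arr \<Gamma> \<Longrightarrow> src \<Gamma> g \<in> arr \<Gamma>"
    and tgt_closed: "g \<in> arr \<Gamma> \<Longrightarrow> tgt \<Gamma> g \<in> arr \<Gamma>"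
    and src_src: "g \<in> arr \<Gamma> \<Longrightarrow> src \<Gamma> (src \<Gamma> g) = src \<Gamma> g"
    and tgt_src: "g \<in> arr \<Gamma> \<Longrightarrow> tgt \<Gamma> (src \<Gamma> g) = src \<Gamma> g"
    and src_tgt: "g \<in> arr \<Gamma> \<Longrightarrow> src \<Gamma> (tgt \<Gamma> g) = tgt \<Gamma> g"
    and tgt_tgt: "g \<in> arr \<Gamma> \<Longrightarrow> tgt \<Gamma> (tgt \<Gamma> g) = tgt \<Gamma> g"
    and cmp_closed:
      "\<lbrakk>g \<in> arr \<Gamma>; h \<in> arr \<Gamma>; src \<Gamma> g = tgt \<Gamma> h\<rbrakk> \<Longrightarrow> cmp \<Gamma> g h \<in> arr \<Gamma>"
    and src_cmp:
      "\<lbrakk>g \<in> arr \<Gamma>; h \<in> arr \<Gamma>; src \<Gamma> g = tgt \<Gamma> h\<rbrakk> \<Longrightarrow> src \<Gamma> (cmp \<Gamma> g h) = src \<Gamma> h"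
    and tgt_cmp:
      "\<lbrakk>g \<in> arr \<Gamma>; h \<in> arr \<Gamma>; src \<Gamma> g = tgt \<Gamma> h\<rbrakk> \<Longrightarrow> tgt \<Gamma> (cmp \<Gamma> g h) = tgt \<Gamma> g"
    and cmp_assoc:
      "\<lbrakk>g \<in> arr \<Gamma>; h \<in> arr \<Gamma>; k \<in> arr \<Gamma>; src \<Gamma> g = tgt \<Gamma> h; src \<Gamma> h = tgt \<Gamma> k\<rbrakk>
        \<Longrightarrow> cmp \<Gamma> (cmp \<Gamma> g h) k = cmp \<Gamma> g (cmp \<Gamma> h k)"
    and cmp_src: "g \<in> arr \<Gamma> \<Longrightarrow> cmp \<Gamma> g (src \<Gamma> g) = g"
    and tgt_cmp_self: "g \<in> arr \<Gamma> \<Longrightarrow> cmp \<Gamma> (tgt \<Gamma> g) g = g"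

locale groupoid = small_category \<Gamma> for \<Gamma> :: "('g, 'x) gpd_scheme" +
  assumes invertible:
    "g \<in> arr \<Gamma> \<Longrightarrow> \<exists>h\<in>arr \<Gamma>. src \<Gamma> h = tgt \<Gamma> g \<and> tgt \<Gamma> h = src \<Gamma> g
        \<and> cmp \<Gamma> h g = src \<Gamma> g \<and> cmp \<Gamma> g h = tgt \<Gamma> g"


section \<open>Sums of additive subgroups\<close>

definition internal_sum :: "('m, 'x) ring_scheme \<Rightarrow> 'i set \<Rightarrow> ('i \<Rightarrow> 'm set) \<Rightarrow> 'm set" where
  "internal_sum M I B = {finsum M f F | f F. finite F \<and> F \<subseteq> I \<and> (\<forall>i\<in>F. f i \<in> B i)}"

definition internal_direct_sum ::
    "('m, 'x) ring_scheme \<Rightarrow> 'i set \<Rightarrow> ('i \<Rightarrow> 'm set) \<Rightarrow> 'm set \<Rightarrow> bool" where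
  "internal_direct_sum M I B N \<longleftrightarrow>
     (\<forall>i\<in>I. additive_subgroup (B i) M) \<and>
     N = internal_sum M I B \<and>
     (\<forall>F f. finite F \<and> F \<subseteq> I \<and> (\<forall>i\<in>F. f i \<in> B i) \<and> finsum M f F = \<zero>\<^bsub>M\<^esub>
        \<longrightarrow> (\<forall>i\<in>F. f i = \<zero>\<^bsub>M\<^esub>))"


section \<open>Graded rings\<close>

text \<open>
  The record type of \<open>HOL-Algebra\<close> is used for rings without identity; its field \<open>one\<close> is unconstrained
  and never used.
\<close>

locale nonunital_ring = abelian_group R for R :: "('a, 'x) ring_scheme" (structure) +
  assumes mult_closed: "\<lbrakk>a \<in> carrier R; b \<in> carrier R\<rbrakk> \<Longrightarrow> a \<otimes> b \<in> carrier R"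
    and mult_assoc: "\<lbrakk>a \<in> carrier R; b \<in> carrier R; c \<in> carrier R\<rbrakk>
        \<Longrightarrow> (a \<otimes> b) \<otimes> c = a \<otimes> (b \<otimes> c)"
    and distr_right: "\<lbrakk>a \<in> carrier R; b \<in> carrier R; c \<in> carrier R\<rbrakk>
        \<Longrightarrow> (a \<oplus> b) \<otimes> c = a \<otimes> c \<oplus> b \<otimes> c"
    and distr_left: "\<lbrakk>a \<in> carrier R; b \<in> carrier R; c \<in> carrier R\<rbrakk>
        \<Longrightarrow> a \<otimes> (b \<oplus> c) = a \<otimes> b \<oplus> a \<otimes> c"

definition is_identity_of :: "('a, 'x) ring_scheme \<Rightarrow> 'a set \<Rightarrow> 'a \<Rightarrow> bool" where
  "is_identity_of R S u \<longleftrightarrow> u \<in> S \<and> (\<forall>a\<in>S. u \<otimes>\<^bsub>R\<^esub> a = a \<and> a \<otimes>\<^bsub>R\<^esub> u = a)"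

definition obj_one :: "('a, 'x) ring_scheme \<Rightarrow> ('g \<Rightarrow> 'a set) \<Rightarrow> 'g \<Rightarrow> 'a" where
  "obj_one R A e = (THE u. is_identity_of R (A e) u)"

locale graded_ring = groupoid \<Gamma> + nonunital_ring R
  for \<Gamma> :: "('g, 'x) gpd_scheme" and R :: "('a, 'y) ring_scheme" and A :: "'g \<Rightarrow> 'a set" +
  assumes ring_decomp: "internal_direct_sum R (arr \<Gamma>) A (carrier R)"
    and ring_graded:
      "\<lbrakk>g \<in> arr \<Gamma>; h \<in> arr \<Gamma>; src \<Gamma> g = tgt \<Gamma> h; a \<in> A g; b \<in> A h\<rbrakk>
        \<Longrightarrow> a \<otimes>\<^bsub>R\<^esub> b \<in> A (cmp \<Gamma> g h)"
    and ring_graded_zero: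
      "\<lbrakk>g \<in> arr \<Gamma>; h \<in> arr \<Gamma>; src \<Gamma> g \<noteq> tgt \<Gamma> h; a \<in> A g; b \<in> A h\<rbrakk>
        \<Longrightarrow> a \<otimes>\<^bsub>R\<^esub> b = \<zero>\<^bsub>R\<^esub>"
    and obj_unital: "e \<in> ids \<Gamma> \<Longrightarrow> \<exists>u. is_identity_of R (A e) u"
    and obj_one_left:
      "\<lbrakk>g \<in> arr \<Gamma>; a \<in> A g\<rbrakk> \<Longrightarrow> obj_one R A (tgt \<Gamma> g) \<otimes>\<^bsub>R\<^esub> a = a"
    and obj_one_right:
      "\<lbrakk>g \<in> arr \<Gamma>; a \<in> A g\<rbrakk> \<Longrightarrow> a \<otimes>\<^bsub>R\<^esub> obj_one R A (src \<Gamma> g) = a"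


section \<open>Graded modules\<close>

text \<open>
  The \<open>module\<close> record of \<open>HOL-Algebra\<close> carries both left and right modules; its ring fields
  \<open>mult\<close> and \<open>one\<close> are unused. For a right module, \<open>a \<odot>\<^bsub>M\<^esub> m\<close> stands for the product of
  \<open>m\<close> by \<open>a\<close> from the right, which is why the associativity law of right modules reads
  \<open>(a \<otimes> b) \<odot> m = b \<odot> (a \<odot> m)\<close>. Notions that do not depend on the side (submodules, quotients,
  chain conditions, length) are then shared by left and right modules.
\<close>

locale graded_module_base = graded_ring \<Gamma> R A + M: abelian_group M
  for \<Gamma> :: "('g, 'x) gpd_scheme" and R :: "('a, 'y) ring_scheme" and A :: "'g \<Rightarrow> 'a set"
    and M :: "('a, 'm, 'z) module_scheme" and B :: "'g \<Rightarrow> 'm set" +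
  assumes act_closed:
      "\<lbrakk>a \<in> carrier R; m \<in> carrier M\<rbrakk> \<Longrightarrow> a \<odot>\<^bsub>M\<^esub> m \<in> carrier M"
    and act_add_ring:
      "\<lbrakk>a \<in> carrier R; b \<in> carrier R; m \<in> carrier M\<rbrakk>
        \<Longrightarrow> (a \<oplus>\<^bsub>R\<^esub> b) \<odot>\<^bsub>M\<^esub> m = a \<odot>\<^bsub>M\<^esub> m \<oplus>\<^bsub>M\<^esub> b \<odot>\<^bsub>M\<^esub> m"
    and act_add_module:
      "\<lbrakk>a \<in> carrier R; m \<in> carrier M; n \<in> carrier M\<rbrakk>
        \<Longrightarrow> a \<odot>\<^bsub>M\<^esub> (m \<oplus>\<^bsub>M\<^esub> n) = a \<odot>\<^bsub>M\<^esub> m \<oplus>\<^bsub>M\<^esub> a \<odot>\<^bsub>M\<^esub> n"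
    and module_decomp: "internal_direct_sum M (arr \<Gamma>) B (carrier M)"

locale graded_right_module = graded_module_base +
  assumes right_act_assoc:
      "\<lbrakk>a \<in> carrier R; b \<in> carrier R; m \<in> carrier M\<rbrakk>
        \<Longrightarrow> (a \<otimes>\<^bsub>R\<^esub> b) \<odot>\<^bsub>M\<^esub> m = b \<odot>\<^bsub>M\<^esub> (a \<odot>\<^bsub>M\<^esub> m)"
    and right_graded:
      "\<lbrakk>s \<in> arr \<Gamma>; t \<in> arr \<Gamma>; src \<Gamma> s = tgt \<Gamma> t; m \<in> B s; a \<in> A t\<rbrakk>
        \<Longrightarrow> a \<odot>\<^bsub>M\<^esub> m \<in> B (cmp \<Gamma> s t)"
    and right_graded_zero:
      "\<lbrakk>s \<in> arr \<Gamma>; t \<in> arr \<Gamma>; src \<Gamma> s \<noteq> tgt \<Gamma> t; m \<in> B s; a \<in> A t\<rbrakk>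
        \<Longrightarrow> a \<odot>\<^bsub>M\<^esub> m = \<zero>\<^bsub>M\<^esub>"
    and right_unital:
      "\<lbrakk>s \<in> arr \<Gamma>; m \<in> B s\<rbrakk> \<Longrightarrow> obj_one R A (src \<Gamma> s) \<odot>\<^bsub>M\<^esub> m = m"

locale graded_left_module = graded_module_base +
  assumes left_act_assoc:
      "\<lbrakk>a \<in> carrier R; b \<in> carrier R; m \<in> carrier M\<rbrakk>
        \<Longrightarrow> (a \<otimes>\<^bsub>R\<^esub> b) \<odot>\<^bsub>M\<^esub> m = a \<odot>\<^bsub>M\<^esub> (b \<odot>\<^bsub>M\<^esub> m)"
    and left_graded:
      "\<lbrakk>s \<in> arr \<Gamma>; t \<in> arr \<Gamma>; src \<Gamma> t = tgt \<Gamma> s; m \<in> B s; a \<in> A t\<rbrakk>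
        \<Longrightarrow> a \<odot>\<^bsub>M\<^esub> m \<in> B (cmp \<Gamma> t s)"
    and left_graded_zero:
      "\<lbrakk>s \<in> arr \<Gamma>; t \<in> arr \<Gamma>; src \<Gamma> t \<noteq> tgt \<Gamma> s; m \<in> B s; a \<in> A t\<rbrakk>
        \<Longrightarrow> a \<odot>\<^bsub>M\<^esub> m = \<zero>\<^bsub>M\<^esub>"
    and left_unital:
      "\<lbrakk>s \<in> arr \<Gamma>; m \<in> B s\<rbrakk> \<Longrightarrow> obj_one R A (tgt \<Gamma> s) \<odot>\<^bsub>M\<^esub> m = m"

definition graded_submodule ::
    "('g, 'x) gpd_scheme \<Rightarrow> ('a, 'y) ring_scheme \<Rightarrow> ('a, 'm, 'z) module_scheme
      \<Rightarrow> ('g \<Rightarrow> 'm set) \<Rightarrow> 'm set \<Rightarrow> bool" where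
  "graded_submodule \<Gamma> R M B N \<longleftrightarrow>
     submodule N R M \<and> internal_direct_sum M (arr \<Gamma>) (\<lambda>g. N \<inter> B g) N"

text \<open>
  A graded submodule \<open>N\<close> of \<open>M\<close>, regarded as a graded module, is \<open>M\<lparr>carrier := N\<rparr>\<close> with
  the grading \<open>sub_grading N B\<close>.
\<close>

definition sub_grading :: "'m set \<Rightarrow> ('g \<Rightarrow> 'm set) \<Rightarrow> 'g \<Rightarrow> 'm set" where
  "sub_grading N B = (\<lambda>g. N \<inter> B g)"

definition quot_module ::
    "('a, 'm, 'z) module_scheme \<Rightarrow> 'm set \<Rightarrow> ('a, 'm set) module" where
  "quot_module M N =
     \<lparr>carrier = a_rcosets\<^bsub>M\<^esub> N, mult = undefined, one = undefined, zero = N, add = set_add M,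
      smult = (\<lambda>a K. \<Union>x\<in>K. N +>\<^bsub>M\<^esub> (a \<odot>\<^bsub>M\<^esub> x))\<rparr>"

definition quot_grading ::
    "('m, 'z) ring_scheme \<Rightarrow> 'm set \<Rightarrow> ('g \<Rightarrow> 'm set) \<Rightarrow> 'g \<Rightarrow> 'm set set" where
  "quot_grading M N B = (\<lambda>g. (\<lambda>x. N +>\<^bsub>M\<^esub> x) ` B g)"

definition gr_simple ::
    "('g, 'x) gpd_scheme \<Rightarrow> ('a, 'y) ring_scheme \<Rightarrow> ('a, 'm, 'z) module_scheme
      \<Rightarrow> ('g \<Rightarrow> 'm set) \<Rightarrow> bool" where
  "gr_simple \<Gamma> R M B \<longleftrightarrow>
     carrier M \<noteq> {\<zero>\<^bsub>M\<^esub>} \<and>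
     (\<forall>N. graded_submodule \<Gamma> R M B N \<longrightarrow> N = {\<zero>\<^bsub>M\<^esub>} \<or> N = carrier M)"

definition gr_semisimple ::
    "('g, 'x) gpd_scheme \<Rightarrow> ('a, 'y) ring_scheme \<Rightarrow> ('a, 'm, 'z) module_scheme
      \<Rightarrow> ('g \<Rightarrow> 'm set) \<Rightarrow> bool" where
  "gr_semisimple \<Gamma> R M B \<longleftrightarrow>
     (\<exists>\<S>. (\<forall>N\<in>\<S>. graded_submodule \<Gamma> R M B N
              \<and> gr_simple \<Gamma> R (M\<lparr>carrier := N\<rparr>) (sub_grading N B))
          \<and> carrier M = internal_sum M \<S> (\<lambda>N. N))"

definition gr_artinian ::
    "('g, 'x) gpd_scheme \<Rightarrow> ('a, 'y) ring_scheme \<Rightarrow> ('a, 'm, 'z) module_scheme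
      \<Rightarrow> ('g \<Rightarrow> 'm set) \<Rightarrow> bool" where
  "gr_artinian \<Gamma> R M B \<longleftrightarrow>
     \<not> (\<exists>C :: nat \<Rightarrow> 'm set. \<forall>i. graded_submodule \<Gamma> R M B (C i) \<and> C (Suc i) \<subset> C i)"

definition gr_noetherian ::
    "('g, 'x) gpd_scheme \<Rightarrow> ('a, 'y) ring_scheme \<Rightarrow> ('a, 'm, 'z) module_scheme
      \<Rightarrow> ('g \<Rightarrow> 'm set) \<Rightarrow> bool" where
  "gr_noetherian \<Gamma> R M B \<longleftrightarrow>
     \<not> (\<exists>C :: nat \<Rightarrow> 'm set. \<forall>i. graded_submodule \<Gamma> R M B (C i) \<and> C i \<subset> C (Suc i))"

definition has_gr_length ::
    "('g, 'x) gpd_scheme \<Rightarrow> ('a, 'y) ring_scheme \<Rightarrow> ('a, 'm, 'z) module_scheme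
      \<Rightarrow> ('g \<Rightarrow> 'm set) \<Rightarrow> nat \<Rightarrow> bool" where
  "has_gr_length \<Gamma> R M B n \<longleftrightarrow>
     (\<exists>C :: nat \<Rightarrow> 'm set. C 0 = {\<zero>\<^bsub>M\<^esub>} \<and> C n = carrier M
        \<and> (\<forall>j\<le>n. graded_submodule \<Gamma> R M B (C j))
        \<and> (\<forall>j<n. C j \<subseteq> C (Suc j)
             \<and> gr_simple \<Gamma> R (quot_module (M\<lparr>carrier := C (Suc j)\<rparr>) (C j))
                 (quot_grading (M\<lparr>carrier := C (Suc j)\<rparr>) (C j) (sub_grading (C (Suc j)) B))))"

definition finite_gr_length ::
    "('g, 'x) gpd_scheme \<Rightarrow> ('a, 'y) ring_scheme \<Rightarrow> ('a, 'm, 'z) module_scheme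
      \<Rightarrow> ('g \<Rightarrow> 'm set) \<Rightarrow> bool" where
  "finite_gr_length \<Gamma> R M B \<longleftrightarrow> (\<exists>n. has_gr_length \<Gamma> R M B n)"


section \<open>Conditions relative to the objects\<close>

text \<open>
  In the following definitions \<open>p\<close> is \<open>tgt \<Gamma>\<close> for right modules, giving \<open>M(e)\<close>, and
  \<open>src \<Gamma>\<close> for left modules, giving \<open>(e)M\<close>.
\<close>

definition obj_part ::
    "('g, 'x) gpd_scheme \<Rightarrow> ('g \<Rightarrow> 'g) \<Rightarrow> ('m, 'z) ring_scheme \<Rightarrow> ('g \<Rightarrow> 'm set)
      \<Rightarrow> 'g \<Rightarrow> 'm set" where
  "obj_part \<Gamma> p M B e = internal_sum M {g \<in> arr \<Gamma>. p g = e} B"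

definition Gamma0_artinian where
  "Gamma0_artinian \<Gamma> p R M B \<longleftrightarrow>
     (\<forall>e\<in>ids \<Gamma>. gr_artinian \<Gamma> R (M\<lparr>carrier := obj_part \<Gamma> p M B e\<rparr>)
                   (sub_grading (obj_part \<Gamma> p M B e) B))"

definition Gamma0_noetherian where
  "Gamma0_noetherian \<Gamma> p R M B \<longleftrightarrow>
     (\<forall>e\<in>ids \<Gamma>. gr_noetherian \<Gamma> R (M\<lparr>carrier := obj_part \<Gamma> p M B e\<rparr>)
                   (sub_grading (obj_part \<Gamma> p M B e) B))"

definition Gamma0_finite_gr_length where
  "Gamma0_finite_gr_length \<Gamma> p R M B \<longleftrightarrow>
     (\<forall>e\<in>ids \<Gamma>. finite_gr_length \<Gamma> R (M\<lparr>carrier := obj_part \<Gamma> p M B e\<rparr>)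
                   (sub_grading (obj_part \<Gamma> p M B e) B))"

definition strongly_Gamma0_finite_gr_length where
  "strongly_Gamma0_finite_gr_length \<Gamma> p R M B \<longleftrightarrow>
     (\<exists>n. \<forall>e\<in>ids \<Gamma>. \<exists>l<n. has_gr_length \<Gamma> R (M\<lparr>carrier := obj_part \<Gamma> p M B e\<rparr>)
                               (sub_grading (obj_part \<Gamma> p M B e) B) l)"

definition obj_stable ::
    "('g, 'x) gpd_scheme \<Rightarrow> ('g \<Rightarrow> 'g) \<Rightarrow> ('m, 'z) ring_scheme \<Rightarrow> ('g \<Rightarrow> 'm set)
      \<Rightarrow> (nat \<Rightarrow> 'm set) \<Rightarrow> bool" where
  "obj_stable \<Gamma> p M B C \<longleftrightarrow>
     (\<forall>e\<in>ids \<Gamma>. \<forall>i.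
        obj_part \<Gamma> p M (sub_grading (C i) B) e = obj_part \<Gamma> p M (sub_grading (C (Suc i)) B) e \<longrightarrow>
        (\<forall>l\<ge>1. obj_part \<Gamma> p M (sub_grading (C i) B) e
                 = obj_part \<Gamma> p M (sub_grading (C (i + l)) B) e))"

definition strongly_Gamma0_artinian ::
    "('g, 'x) gpd_scheme \<Rightarrow> ('g \<Rightarrow> 'g) \<Rightarrow> ('a, 'y) ring_scheme \<Rightarrow> ('a, 'm, 'z) module_scheme
      \<Rightarrow> ('g \<Rightarrow> 'm set) \<Rightarrow> bool" where
  "strongly_Gamma0_artinian \<Gamma> p R M B \<longleftrightarrow>
     \<not> (\<exists>C :: nat \<Rightarrow> 'm set. (\<forall>i. graded_submodule \<Gamma> R M B (C i) \<and> C (Suc i) \<subset> C i)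
          \<and> obj_stable \<Gamma> p M B C)"

definition strongly_Gamma0_noetherian ::
    "('g, 'x) gpd_scheme \<Rightarrow> ('g \<Rightarrow> 'g) \<Rightarrow> ('a, 'y) ring_scheme \<Rightarrow> ('a, 'm, 'z) module_scheme
      \<Rightarrow> ('g \<Rightarrow> 'm set) \<Rightarrow> bool" where
  "strongly_Gamma0_noetherian \<Gamma> p R M B \<longleftrightarrow>
     \<not> (\<exists>C :: nat \<Rightarrow> 'm set. (\<forall>i. graded_submodule \<Gamma> R M B (C i) \<and> C i \<subset> C (Suc i))
          \<and> obj_stable \<Gamma> p M B C)"


section \<open>The graded Jacobson radical and gr-semiprimary rings\<close>

definition right_regular :: "('a, 'y) ring_scheme \<Rightarrow> ('a, 'a) module" where
  "right_regular R =
     \<lparr>carrier = carrier R, mult = mult R, one = one R, zero = zero R, add = add R,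
      smult = (\<lambda>a x. x \<otimes>\<^bsub>R\<^esub> a)\<rparr>"

definition graded_right_ideal ::
    "('g, 'x) gpd_scheme \<Rightarrow> ('a, 'y) ring_scheme \<Rightarrow> ('g \<Rightarrow> 'a set) \<Rightarrow> 'a set \<Rightarrow> bool" where
  "graded_right_ideal \<Gamma> R A I \<longleftrightarrow> graded_submodule \<Gamma> R (right_regular R) A I"

definition gr_maximal_right_ideal ::
    "('g, 'x) gpd_scheme \<Rightarrow> ('a, 'y) ring_scheme \<Rightarrow> ('g \<Rightarrow> 'a set) \<Rightarrow> 'a set \<Rightarrow> bool" where
  "gr_maximal_right_ideal \<Gamma> R A I \<longleftrightarrow>
     graded_right_ideal \<Gamma> R A I \<and> I \<noteq> carrier R \<and>
     (\<forall>J. graded_right_ideal \<Gamma> R A J \<and> I \<subseteq> J \<and> J \<noteq> carrier R \<longrightarrow> J = I)"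

text \<open>The empty intersection is \<open>R\<close> itself, so that the zero ring has radical \<open>R\<close>.\<close>

definition gr_rad :: "('g, 'x) gpd_scheme \<Rightarrow> ('a, 'y) ring_scheme \<Rightarrow> ('g \<Rightarrow> 'a set) \<Rightarrow> 'a set" where
  "gr_rad \<Gamma> R A = {x \<in> carrier R. \<forall>I. gr_maximal_right_ideal \<Gamma> R A I \<longrightarrow> x \<in> I}"

definition gr_semisimple_ring ::
    "('g, 'x) gpd_scheme \<Rightarrow> ('a, 'y) ring_scheme \<Rightarrow> ('g \<Rightarrow> 'a set) \<Rightarrow> bool" where
  "gr_semisimple_ring \<Gamma> R A \<longleftrightarrow> gr_semisimple \<Gamma> R (right_regular R) A"

text \<open>Only positive exponents are meaningful, as \<open>R\<close> need not have an identity.\<close>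

primrec ideal_pow :: "('a, 'y) ring_scheme \<Rightarrow> 'a set \<Rightarrow> nat \<Rightarrow> 'a set" where
  "ideal_pow R U 0 = carrier R"
| "ideal_pow R U (Suc n) = (if n = 0 then U else ideal_prod R (ideal_pow R U n) U)"

definition objectwise_nilpotent ::
    "('g, 'x) gpd_scheme \<Rightarrow> ('a, 'y) ring_scheme \<Rightarrow> ('g \<Rightarrow> 'a set) \<Rightarrow> 'a set \<Rightarrow> bool" where
  "objectwise_nilpotent \<Gamma> R A U \<longleftrightarrow>
     (\<forall>e\<in>ids \<Gamma>. \<exists>n m. n > 0 \<and> m > 0
        \<and> (\<forall>x\<in>ideal_pow R U n. obj_one R A e \<otimes>\<^bsub>R\<^esub> x = \<zero>\<^bsub>R\<^esub>)
        \<and> (\<forall>x\<in>ideal_pow R U m. x \<otimes>\<^bsub>R\<^esub> obj_one R A e = \<zero>\<^bsub>R\<^esub>))"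

definition gr_semiprimary ::
    "('g, 'x) gpd_scheme \<Rightarrow> ('a, 'y) ring_scheme \<Rightarrow> ('g \<Rightarrow> 'a set) \<Rightarrow> bool" where
  "gr_semiprimary \<Gamma> R A \<longleftrightarrow>
     gr_semisimple_ring \<Gamma> (R Quot gr_rad \<Gamma> R A) (quot_grading R (gr_rad \<Gamma> R A) A) \<and>
     objectwise_nilpotent \<Gamma> R A (gr_rad \<Gamma> R A)"

end

theory Submission
  imports Defs
begin

text \<open>
  Let \<open>J\<close> be the graded radical. Semisimplicity of \<open>R/J\<close> as a right module writes every \<open>1\<^sub>e\<close>, modulo
  \<open>J\<close>, as a sum of elements \<open>u\<close> of degree \<open>e\<close> that generate gr-simple right ideals modulo \<open>J\<close>; such \<open>u\<close>
  also generate gr-simple left ideals modulo \<open>J\<close>, so the situation is left-right symmetric and left modules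
  are right modules over the opposite ring. If \<open>q\<close> is homogeneous, \<open>qJ \<subseteq> N\<close> and \<open>qu \<notin> N\<close>, then \<open>N + quR\<close>
  covers \<open>N\<close> in the lattice of graded submodules. Two consequences hold without any chain condition:
  from \<open>1\<^sub>e J\<^sup>n = 0\<close> every \<open>N \<subset> D\<close> has a cover inside \<open>D\<close>, and from \<open>J\<^sup>m 1\<^sub>e = 0\<close> (which gives \<open>QJ \<noteq> Q\<close>)
  every \<open>Q \<noteq> 0\<close> has a maximal graded submodule. Hence an ascending or a descending chain condition makes
  a composition series terminate, and a composition series bounds all chains. For the strong conditions,
  if the lengths of the \<open>M(e)\<close> are unbounded, truncating composition series of all \<open>M(e)\<close> simultaneously
  at height \<open>i\<close>, respectively \<open>i\<close> steps below the top, gives an infinite chain of the forbidden kind.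
\<close>

section \<open>Graded abelian groups\<close>

text \<open>The obstacle is that \<open>R\<close> has no global identity and \<open>J\<close> is
  nilpotent only object by object, so the filtration of \<open>M\<close> by the submodules
  \<open>M J^i\<close> may be infinite and cannot simply be refined to a composition series. Covers
  are therefore produced one at a time, at a single homogeneous element. With
  \<open>e = src s\<close>, an element \<open>q\<close> of degree \<open>s\<close> satisfies
  \<open>q = q 1_e\<close>. Thus \<open>1_e J^n = 0\<close> gives \<open>q J^n = 0\<close>, and
  repeated multiplication of a homogeneous element of \<open>D\<close> outside \<open>N\<close> by
  elements of \<open>J\<close> must pass through some \<open>q \<notin> N\<close> with
  \<open>q J \<subseteq> N\<close>. Dually, \<open>Q J = Q\<close> would put every such
  \<open>q \<in> Q\<close> into \<open>Q J^m 1_e = 0\<close>. The radical and semisimplicity are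
  defined through right modules, but left modules are treated as well. The element condition
  \<open>minimal_mod\<close>, symmetric in the two sides, carries semisimplicity across. The set
  \<open>J\<close> stays fixed under passage to the opposite ring, so the radical of that ring never
  has to be computed.\<close>

lemma (in abelian_group) additive_subgroup_iff:
  "additive_subgroup H G \<longleftrightarrow>
     H \<subseteq> carrier G \<and> \<zero> \<in> H \<and> (\<forall>x\<in>H. \<forall>y\<in>H. x \<oplus> y \<in> H) \<and> (\<forall>x\<in>H. \<ominus> x \<in> H)"
  by (auto simp: additive_subgroup_def subgroup_def a_inv_def)

lemma (in abelian_group) additive_subgroupD:
  assumes "additive_subgroup H G"
  shows "H \<subseteq> carrier G" "\<zero> \<in> H" "\<And>x y. \<lbrakk>x \<in> H; y \<in> H\<rbrakk> \<Longrightarrow> x \<oplus> y \<in> H"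
    "\<And>x. x \<in> H \<Longrightarrow> \<ominus> x \<in> H" "\<And>x y. \<lbrakk>x \<in> H; y \<in> H\<rbrakk> \<Longrightarrow> x \<ominus> y \<in> H"
  using assms unfolding additive_subgroup_iff by (auto simp: a_minus_def)

lemma (in abelian_group) finsum_in_subgroup:
  assumes "additive_subgroup H G" "finite F" "\<forall>i\<in>F. f i \<in> H"
  shows "finsum G f F \<in> H"
  using assms(2,3)
proof (induction F)
  case empty
  then show ?case using additive_subgroupD[OF assms(1)] by simp
next
  case (insert i F)
  have "f \<in> insert i F \<rightarrow> carrier G"
    using insert additive_subgroupD(1)[OF assms(1)] by auto
  then show ?case
    using insert additive_subgroupD[OF assms(1)] by (auto simp: Pi_def)
qed

lemma (in abelian_group) abelian_group_restrict:
  assumes "additive_subgroup H G"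
  shows "abelian_group (G\<lparr>carrier := H\<rparr>)"
proof (rule abelian_groupI)
  fix x assume x: "x \<in> carrier (G\<lparr>carrier := H\<rparr>)"
  then show "\<exists>y\<in>carrier (G\<lparr>carrier := H\<rparr>). y \<oplus>\<^bsub>G\<lparr>carrier := H\<rparr>\<^esub> x = \<zero>\<^bsub>G\<lparr>carrier := H\<rparr>\<^esub>"
    using additive_subgroupD[OF assms] by (intro bexI[of _ "\<ominus> x"]) (auto simp: l_neg)
qed (use additive_subgroupD[OF assms] in \<open>auto simp: a_ac subset_iff\<close>)

lemma (in abelian_group) a_inv_restrict:
  assumes "additive_subgroup H G" "x \<in> H"
  shows "\<ominus>\<^bsub>G\<lparr>carrier := H\<rparr>\<^esub> x = \<ominus> x"
proof -
  interpret H: abelian_group "G\<lparr>carrier := H\<rparr>"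
    by (rule abelian_group_restrict[OF assms(1)])
  note H = additive_subgroupD[OF assms(1)]
  have "\<ominus> x \<oplus>\<^bsub>G\<lparr>carrier := H\<rparr>\<^esub> x = \<zero>\<^bsub>G\<lparr>carrier := H\<rparr>\<^esub>"
    using assms(2) H by (auto simp: l_neg)
  then show ?thesis
    using H.minus_equality[of "\<ominus> x" x] assms(2) H by auto
qed

lemma (in abelian_group) finsum_restrict:
  assumes "additive_subgroup H G" "finite F" "\<forall>i\<in>F. f i \<in> H"
  shows "finsum (G\<lparr>carrier := H\<rparr>) f F = finsum G f F"
  using assms(2,3)
proof (induction F)
  case (insert i F)
  interpret H: abelian_group "G\<lparr>carrier := H\<rparr>"
    by (rule abelian_group_restrict[OF assms(1)])
  have "f \<in> F \<rightarrow> carrier G" "f i \<in> carrier G"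
    using insert additive_subgroupD(1)[OF assms(1)] by auto
  moreover have "f \<in> F \<rightarrow> carrier (G\<lparr>carrier := H\<rparr>)" "f i \<in> carrier (G\<lparr>carrier := H\<rparr>)"
    using insert by auto
  ultimately show ?case using insert by simp
next
  case empty
  interpret H: abelian_group "G\<lparr>carrier := H\<rparr>"
    by (rule abelian_group_restrict[OF assms(1)])
  show ?case by simp
qed

lemma (in abelian_group) additive_subgroup_restrict_iff:
  assumes "additive_subgroup H G"
  shows "additive_subgroup K (G\<lparr>carrier := H\<rparr>) \<longleftrightarrow> additive_subgroup K G \<and> K \<subseteq> H"
proof -
  interpret H: abelian_group "G\<lparr>carrier := H\<rparr>"
    by (rule abelian_group_restrict[OF assms(1)])
  show ?thesis
    using additive_subgroupD[OF assms] a_inv_restrict[OF assms]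
    by (auto simp: H.additive_subgroup_iff additive_subgroup_iff subset_iff)
qed

lemma internal_direct_sumD:
  assumes "internal_direct_sum M I B N"
  shows "\<And>i. i \<in> I \<Longrightarrow> additive_subgroup (B i) M"
    and "N = internal_sum M I B"
    and "\<And>F f i. \<lbrakk>finite F; F \<subseteq> I; \<forall>i\<in>F. f i \<in> B i; finsum M f F = \<zero>\<^bsub>M\<^esub>; i \<in> F\<rbrakk>
      \<Longrightarrow> f i = \<zero>\<^bsub>M\<^esub>"
  using assms unfolding internal_direct_sum_def by blast+

section \<open>Homogeneous components and graded subgroups\<close>

definition component ::
    "('m, 'x) ring_scheme \<Rightarrow> 'i set \<Rightarrow> ('i \<Rightarrow> 'm set) \<Rightarrow> 'i \<Rightarrow> 'm \<Rightarrow> 'm" where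
  "component M I B i m = (THE b. \<exists>F f. finite F \<and> F \<subseteq> I \<and> (\<forall>j\<in>F. f j \<in> B j) \<and>
     m = finsum M f F \<and> b = (if i \<in> F then f i else \<zero>\<^bsub>M\<^esub>))"

text \<open>Closure under the projections is the working form of gradedness: it passes at once to
  intersections, sums, preimages and unions of chains. \<open>internal_direct_sum_iff\<close>
  identifies it with the direct sum condition.\<close>

definition graded_subgroup ::
    "('m, 'x) ring_scheme \<Rightarrow> 'i set \<Rightarrow> ('i \<Rightarrow> 'm set) \<Rightarrow> 'm set \<Rightarrow> bool" where
  "graded_subgroup M I B N \<longleftrightarrow>
     additive_subgroup N M \<and> (\<forall>x\<in>N. \<forall>i\<in>I. component M I B i x \<in> N)"

locale graded_group = abelian_group M for M :: "('m, 'x) ring_scheme" (structure) +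
  fixes I :: "'i set" and B :: "'i \<Rightarrow> 'm set"
  assumes decomposition: "internal_direct_sum M I B (carrier M)"
begin

abbreviation "pr \<equiv> component M I B"

lemmas part_subgroup = internal_direct_sumD(1)[OF decomposition]
lemmas parts_independent = internal_direct_sumD(3)[OF decomposition]

lemma part_closed: "\<lbrakk>i \<in> I; b \<in> B i\<rbrakk> \<Longrightarrow> b \<in> carrier M"
  using additive_subgroupD(1)[OF part_subgroup] by auto

lemma zero_in_part: "i \<in> I \<Longrightarrow> \<zero> \<in> B i"
  using additive_subgroupD(2)[OF part_subgroup] by auto

lemma finsum_extend:
  assumes "finite G" "F \<subseteq> G" "G \<subseteq> I" "\<forall>j\<in>F. f j \<in> B j"
  shows "finsum M f F = finsum M (\<lambda>j. if j \<in> F then f j else \<zero>) G"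
  using assms part_closed
  by (intro add.finprod_mono_neutral_cong_left) (auto simp: subset_iff)

text \<open>Two expressions of the same element are extended by zero to the union of their supports.
  Their difference is a vanishing sum of homogeneous elements, so independence makes them agree term
  by term. This makes the description in \<open>component\<close> well defined.\<close>

lemma component_finsum:
  assumes "finite F" "F \<subseteq> I" "\<forall>j\<in>F. f j \<in> B j"
  shows "pr i (finsum M f F) = (if i \<in> F then f i else \<zero>)"
  unfolding component_def
proof (rule the_equality)
  fix b assume "\<exists>F' f'. finite F' \<and> F' \<subseteq> I \<and> (\<forall>j\<in>F'. f' j \<in> B j) \<and>
     finsum M f F = finsum M f' F' \<and> b = (if i \<in> F' then f' i else \<zero>)"
  then obtain F' f' where F': "finite F'" "F' \<subseteq> I" "\<forall>j\<in>F'. f' j \<in> B j"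
    "finsum M f F = finsum M f' F'" and b: "b = (if i \<in> F' then f' i else \<zero>)"
    by blast
  define g where "g = (\<lambda>j. if j \<in> F then f j else \<zero>)"
  define g' where "g' = (\<lambda>j. if j \<in> F' then f' j else \<zero>)"
  have g: "g j \<in> B j" "g' j \<in> B j" if "j \<in> F \<union> F'" for j
    using that assms F' zero_in_part unfolding g_def g'_def by (auto simp: subset_iff)
  have gc: "g j \<in> carrier M" "g' j \<in> carrier M" if "j \<in> F \<union> F'" for j
    using g[OF that] that assms(2) F'(2) part_closed by blast+
  have "finsum M f F = finsum M g (F \<union> F')" "finsum M f' F' = finsum M g' (F \<union> F')"
    unfolding g_def g'_def by (intro finsum_extend; use assms F' in auto)+
  then have eq: "finsum M g (F \<union> F') = finsum M g' (F \<union> F')"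
    using F'(4) by simp
  have neg: "finsum M (\<lambda>j. \<ominus> g' j) (F \<union> F') = \<ominus> finsum M g' (F \<union> F')"
  proof -
    have "finsum M (\<lambda>j. \<ominus> g' j) (F \<union> F') \<oplus> finsum M g' (F \<union> F')
        = finsum M (\<lambda>j. \<ominus> g' j \<oplus> g' j) (F \<union> F')"
      using gc by (subst finsum_addf) auto
    also have "\<dots> = finsum M (\<lambda>j. \<zero>) (F \<union> F')"
      using gc by (intro finsum_cong') (auto simp: l_neg)
    finally have z: "finsum M (\<lambda>j. \<ominus> g' j) (F \<union> F') \<oplus> finsum M g' (F \<union> F') = \<zero>"
      by simp
    show ?thesis
      by (rule minus_equality[OF z, symmetric]; use gc in \<open>auto intro!: finsum_closed\<close>)
  qed
  have "finsum M (\<lambda>j. g j \<oplus> \<ominus> g' j) (F \<union> F') = finsum M g (F \<union> F') \<oplus> finsum M (\<lambda>j. \<ominus> g' j) (F \<union> F')"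
    using gc by (intro finsum_addf) auto
  also have "\<dots> = \<zero>"
    unfolding neg eq using gc by (intro r_neg finsum_closed) auto
  finally have z: "finsum M (\<lambda>j. g j \<oplus> \<ominus> g' j) (F \<union> F') = \<zero>" .
  have "g i = g' i"
  proof (cases "i \<in> F \<union> F'")
    case True
    have "\<forall>j\<in>F \<union> F'. g j \<oplus> \<ominus> g' j \<in> B j"
      using g additive_subgroupD(3,4)[OF part_subgroup] assms(2) F'(2) by blast
    then have "g i \<oplus> \<ominus> g' i = \<zero>"
      using parts_independent[OF _ _ _ z True] assms F' by auto
    then show ?thesis
      using gc[OF True] minus_equality[of "g i" "\<ominus> g' i"] by simp
  next
    case False
    then show ?thesis by (simp add: g_def g'_def)
  qed
  then show "b = (if i \<in> F then f i else \<zero>)"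
    unfolding b g_def g'_def by simp
qed (use assms in blast)

lemma obtain_decomposition:
  assumes "m \<in> carrier M"
  obtains F f where "finite F" "F \<subseteq> I" "\<forall>j\<in>F. f j \<in> B j" "m = finsum M f F"
    "\<And>j. pr j m = (if j \<in> F then f j else \<zero>)"
proof -
  have "m \<in> internal_sum M I B"
    using assms internal_direct_sumD(2)[OF decomposition] by simp
  then obtain F f where "finite F" "F \<subseteq> I" "\<forall>j\<in>F. f j \<in> B j" "m = finsum M f F"
    unfolding internal_sum_def by blast
  with component_finsum that show thesis by metis
qed

lemma component_in: "\<lbrakk>i \<in> I; m \<in> carrier M\<rbrakk> \<Longrightarrow> pr i m \<in> B i"
  by (rule obtain_decomposition, assumption) (auto intro: zero_in_part)

lemma component_closed: "m \<in> carrier M \<Longrightarrow> pr i m \<in> carrier M"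
  by (rule obtain_decomposition, assumption) (auto intro: part_closed)

lemma component_add:
  assumes "m \<in> carrier M" "n \<in> carrier M"
  shows "pr i (m \<oplus> n) = pr i m \<oplus> pr i n"
proof -
  obtain F f where F: "finite F" "F \<subseteq> I" "\<forall>j\<in>F. f j \<in> B j" "m = finsum M f F"
    "\<And>j. pr j m = (if j \<in> F then f j else \<zero>)"
    using obtain_decomposition[OF assms(1)] by blast
  obtain F' f' where F': "finite F'" "F' \<subseteq> I" "\<forall>j\<in>F'. f' j \<in> B j" "n = finsum M f' F'"
    "\<And>j. pr j n = (if j \<in> F' then f' j else \<zero>)"
    using obtain_decomposition[OF assms(2)] by blast
  define g where "g = (\<lambda>j. if j \<in> F then f j else \<zero>)"
  define g' where "g' = (\<lambda>j. if j \<in> F' then f' j else \<zero>)"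
  have g: "g j \<in> B j" "g' j \<in> B j" if "j \<in> F \<union> F'" for j
    using that F F' zero_in_part unfolding g_def g'_def by (auto simp: subset_iff)
  have gc: "g j \<in> carrier M" "g' j \<in> carrier M" if "j \<in> F \<union> F'" for j
    using g[OF that] that F(2) F'(2) part_closed by blast+
  have e: "finsum M f F = finsum M g (F \<union> F')" "finsum M f' F' = finsum M g' (F \<union> F')"
    unfolding g_def g'_def by (intro finsum_extend; use F F' in auto)+
  have "m \<oplus> n = finsum M (\<lambda>j. g j \<oplus> g' j) (F \<union> F')"
    unfolding F F' e using gc by (subst finsum_addf) auto
  moreover have "\<forall>j\<in>F \<union> F'. g j \<oplus> g' j \<in> B j"
    using g additive_subgroupD(3)[OF part_subgroup] F(2) F'(2) by blast
  ultimately have "pr i (m \<oplus> n) = (if i \<in> F \<union> F' then g i \<oplus> g' i else \<zero>)"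
    using component_finsum[of "F \<union> F'" "\<lambda>j. g j \<oplus> g' j" i] F F' by simp
  then show ?thesis
    using F(5) F'(5) by (auto simp: g_def g'_def)
qed

lemma component_part:
  assumes "j \<in> I" "b \<in> B j"
  shows "pr i b = (if i = j then b else \<zero>)"
proof -
  have "b = finsum M (\<lambda>_. b) {j}"
    using assms part_closed by simp
  then show ?thesis
    using component_finsum[of "{j}" "\<lambda>_. b" i] assms by auto
qed

lemma component_zero: "pr i \<zero> = \<zero>"
  using component_finsum[of "{}" "\<lambda>_. \<zero>" i] by simp

lemma component_idem: "\<lbrakk>i \<in> I; m \<in> carrier M\<rbrakk> \<Longrightarrow> pr j (pr i m) = (if j = i then pr i m else \<zero>)"
  using component_part component_in by blast

lemma component_minus:
  assumes "m \<in> carrier M"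
  shows "pr i (\<ominus> m) = \<ominus> pr i m"
proof -
  have "pr i (\<ominus> m) \<oplus> pr i m = \<zero>"
    using assms component_add[of "\<ominus> m" m i] by (simp add: l_neg component_zero)
  then show ?thesis
    using assms component_closed minus_equality by auto
qed

text \<open>An element is the sum of its finitely many components. Read contrapositively, an element
  outside \<open>H\<close> has a component outside \<open>H\<close>; this is how homogeneous
  witnesses are found.\<close>

lemma mem_subgroupI:
  assumes "additive_subgroup H M" "m \<in> carrier M" "\<And>i. i \<in> I \<Longrightarrow> pr i m \<in> H"
  shows "m \<in> H"
proof -
  obtain F f where F: "finite F" "F \<subseteq> I" "\<forall>j\<in>F. f j \<in> B j" "m = finsum M f F"
    "\<And>j. pr j m = (if j \<in> F then f j else \<zero>)"
    using obtain_decomposition[OF assms(2)] by blast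
  have "\<forall>j\<in>F. f j \<in> H"
    using F(2,5) assms(3) by (metis subsetD)
  then show ?thesis
    unfolding F(4) using F(1) assms(1) finsum_in_subgroup by blast
qed

abbreviation "gr_subgroup \<equiv> graded_subgroup M I B"

lemma graded_subgroupD:
  assumes "gr_subgroup N"
  shows "additive_subgroup N M" "\<And>x i. \<lbrakk>x \<in> N; i \<in> I\<rbrakk> \<Longrightarrow> pr i x \<in> N"
  using assms by (auto simp: graded_subgroup_def)

lemma graded_subgroup_carrier: "gr_subgroup (carrier M)"
  unfolding graded_subgroup_def additive_subgroup_iff using component_closed by blast

lemma graded_subgroup_zero: "gr_subgroup {\<zero>}"
  unfolding graded_subgroup_def additive_subgroup_iff using component_zero by simp

text \<open>An additive property is checked on homogeneous elements only, and these may be taken in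
  \<open>N\<close> because \<open>N\<close> contains the components of its elements. Products are
  expanded with this rule one factor at a time.\<close>

lemma graded_induct [consumes 2, case_names zero part add]:
  assumes N: "gr_subgroup N" and x: "x \<in> N"
    and zero: "P \<zero>"
    and part: "\<And>i b. \<lbrakk>i \<in> I; b \<in> B i; b \<in> N\<rbrakk> \<Longrightarrow> P b"
    and add: "\<And>x y. \<lbrakk>x \<in> N; y \<in> N; P x; P y\<rbrakk> \<Longrightarrow> P (x \<oplus> y)"
  shows "P x"
proof -
  note N' = additive_subgroupD[OF graded_subgroupD(1)[OF N]]
  have xM: "x \<in> carrier M" using x N' by auto
  obtain F f where F: "finite F" "F \<subseteq> I" "\<forall>j\<in>F. f j \<in> B j" "x = finsum M f F"
    "\<And>j. pr j x = (if j \<in> F then f j else \<zero>)"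
    using obtain_decomposition[OF xM] by blast
  have fN: "f j \<in> N" if "j \<in> F" for j
    using F(2,5) graded_subgroupD(2)[OF N x] that by (metis subsetD)
  have "finsum M f F' \<in> N \<and> P (finsum M f F')" if "F' \<subseteq> F" for F'
    using finite_subset[OF that F(1)] that
  proof (induction F')
    case empty
    then show ?case using zero N' by simp
  next
    case (insert i F')
    have 1: "f i \<in> N" "f i \<in> B i" "i \<in> I"
      using insert fN F by auto
    have "f \<in> F' \<rightarrow> carrier M"
      using insert F part_closed by (auto simp: subset_iff)
    then have "finsum M f (insert i F') = f i \<oplus> finsum M f F'"
      using insert 1 N' by (intro finsum_insert) auto
    then show ?case
      using insert 1 N' part add by auto
  qed
  then show ?thesis using F(4) by auto
qed

text \<open>A decomposition inside \<open>N\<close> is also one inside \<open>M\<close>, so by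
  uniqueness its terms are the components; conversely, components lying in \<open>N\<close> form
  such a decomposition.\<close>

lemma internal_direct_sum_iff:
  assumes N: "additive_subgroup N M"
  shows "internal_direct_sum M I (\<lambda>i. N \<inter> B i) N \<longleftrightarrow> gr_subgroup N"
proof
  assume L: "internal_direct_sum M I (\<lambda>i. N \<inter> B i) N"
  show "gr_subgroup N"
    unfolding graded_subgroup_def
  proof (intro conjI N ballI)
    fix x i assume x: "x \<in> N" "i \<in> I"
    have "x \<in> internal_sum M I (\<lambda>i. N \<inter> B i)"
      using equalityD1[OF internal_direct_sumD(2)[OF L]] x(1) by (rule subsetD)
    then obtain F f where F: "finite F" "F \<subseteq> I" "\<forall>j\<in>F. f j \<in> N \<inter> B j" "x = finsum M f F"
      unfolding internal_sum_def by blast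
    have "\<forall>j\<in>F. f j \<in> B j"
      using F(3) by blast
    then have "pr i x = (if i \<in> F then f i else \<zero>)"
      unfolding F(4) by (rule component_finsum[OF F(1,2)])
    then show "pr i x \<in> N"
      using F(3) additive_subgroupD(2)[OF N] by auto
  qed
next
  assume R: "gr_subgroup N"
  show "internal_direct_sum M I (\<lambda>i. N \<inter> B i) N"
    unfolding internal_direct_sum_def
  proof (intro conjI ballI allI impI)
    fix i assume "i \<in> I"
    then show "additive_subgroup (N \<inter> B i) M"
      using N part_subgroup unfolding additive_subgroup_iff by blast
  next
    show "N = internal_sum M I (\<lambda>i. N \<inter> B i)"
    proof
      show "internal_sum M I (\<lambda>i. N \<inter> B i) \<subseteq> N"
        using finsum_in_subgroup[OF N] by (auto simp: internal_sum_def)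
      show "N \<subseteq> internal_sum M I (\<lambda>i. N \<inter> B i)"
      proof
        fix x assume x: "x \<in> N"
        then have "x \<in> carrier M" using additive_subgroupD(1)[OF N] by auto
        then obtain F f where F: "finite F" "F \<subseteq> I" "\<forall>j\<in>F. f j \<in> B j" "x = finsum M f F"
            "\<And>j. pr j x = (if j \<in> F then f j else \<zero>)"
          using obtain_decomposition by blast
        then have "\<forall>j\<in>F. f j \<in> N \<inter> B j"
          using graded_subgroupD(2)[OF R x] by (metis IntI subsetD)
        then show "x \<in> internal_sum M I (\<lambda>i. N \<inter> B i)"
          using F unfolding internal_sum_def by blast
      qed
    qed
  next
    fix F f i
    assume "finite F \<and> F \<subseteq> I \<and> (\<forall>i\<in>F. f i \<in> N \<inter> B i) \<and> finsum M f F = \<zero>" "i \<in> F"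
    then show "f i = \<zero>" using parts_independent[of F f i] by auto
  qed
qed

end

lemma (in abelian_group) internal_direct_sum_restrict:
  assumes D: "additive_subgroup D G" and B: "\<And>i. i \<in> I \<Longrightarrow> B i \<subseteq> D"
  shows "internal_direct_sum (G\<lparr>carrier := D\<rparr>) I B N \<longleftrightarrow> internal_direct_sum G I B N"
proof -
  have fs: "finsum (G\<lparr>carrier := D\<rparr>) f F = finsum G f F"
    if "finite F" "F \<subseteq> I" "\<forall>i\<in>F. f i \<in> B i" for f F
  proof -
    have "\<forall>i\<in>F. f i \<in> D" using that B by blast
    with that(1) show ?thesis by (rule finsum_restrict[OF D])
  qed
  have "internal_sum (G\<lparr>carrier := D\<rparr>) I B = internal_sum G I B"
    unfolding internal_sum_def using fs by (intro Collect_cong) metis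
  moreover have "(\<forall>i\<in>I. additive_subgroup (B i) (G\<lparr>carrier := D\<rparr>)) \<longleftrightarrow>
      (\<forall>i\<in>I. additive_subgroup (B i) G)"
    using additive_subgroup_restrict_iff[OF D] B by blast
  moreover have "(finite F \<and> F \<subseteq> I \<and> (\<forall>i\<in>F. f i \<in> B i) \<and>
        finsum (G\<lparr>carrier := D\<rparr>) f F = \<zero>\<^bsub>G\<lparr>carrier := D\<rparr>\<^esub>) \<longleftrightarrow>
      (finite F \<and> F \<subseteq> I \<and> (\<forall>i\<in>F. f i \<in> B i) \<and> finsum G f F = \<zero>)" for F f
    using fs by auto
  ultimately show ?thesis
    unfolding internal_direct_sum_def by simp
qed

section \<open>Quotients\<close>

text \<open>Only the additive fields of \<open>Q\<close> are prescribed, so the graded group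
  structure of the quotient is available whatever its scalar multiplication is.\<close>

locale graded_quotient = graded_group M I B
  for M :: "('m, 'x) ring_scheme" (structure) and I :: "'i set" and B :: "'i \<Rightarrow> 'm set" +
  fixes C :: "'m set" and Q :: "('m set, 'y) ring_scheme"
  assumes gr_C: "gr_subgroup C"
    and carrier_Q: "carrier Q = a_rcosets C"
    and zero_Q: "\<zero>\<^bsub>Q\<^esub> = C"
    and add_Q: "add Q = set_add M"
begin

sublocale C: abelian_subgroup C M
  by (rule abelian_subgroupI3[OF graded_subgroupD(1)[OF gr_C]]) (rule abelian_group_axioms)

lemma carrier_quot: "carrier Q = (\<lambda>x. C +> x) ` carrier M"
  unfolding carrier_Q A_RCOSETS_def' by auto

lemma add_cosets: "\<lbrakk>x \<in> carrier M; y \<in> carrier M\<rbrakk> \<Longrightarrow> (C +> x) \<oplus>\<^bsub>Q\<^esub> (C +> y) = C +> (x \<oplus> y)"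
  unfolding add_Q by (rule C.a_rcos_sum)

lemma coset_zero: "C +> \<zero> = \<zero>\<^bsub>Q\<^esub>"
  using a_coset_add_zero[OF C.a_subset] zero_Q by simp

lemma coset_eq_zero_iff: "x \<in> carrier M \<Longrightarrow> C +> x = \<zero>\<^bsub>Q\<^esub> \<longleftrightarrow> x \<in> C"
  using a_coset_join1[OF _ _ C.a_subgroup] a_coset_join2[OF _ C.a_subgroup] zero_Q by auto

lemma abelian_group_quot: "abelian_group Q"
proof (rule abelian_groupI)
  fix x assume "x \<in> carrier Q"
  then obtain y where y: "y \<in> carrier M" "x = C +> y" by (auto simp: carrier_quot)
  then show "\<exists>y\<in>carrier Q. y \<oplus>\<^bsub>Q\<^esub> x = \<zero>\<^bsub>Q\<^esub>"
    by (intro bexI[of _ "C +> \<ominus> y"]) (auto simp: carrier_quot add_cosets l_neg coset_zero)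
qed (auto simp: carrier_quot add_cosets a_ac simp flip: coset_zero)

sublocale quot: abelian_group Q
  by (rule abelian_group_quot)

lemma minus_coset:
  assumes "x \<in> carrier M"
  shows "\<ominus>\<^bsub>Q\<^esub> (C +> x) = C +> \<ominus> x"
  using assms by (intro quot.minus_equality)
    (auto simp: carrier_quot add_cosets l_neg coset_zero)

lemma coset_eq_iff:
  assumes "x \<in> carrier M" "y \<in> carrier M"
  shows "C +> x = C +> y \<longleftrightarrow> x \<ominus> y \<in> C"
proof -
  have "C +> x = C +> y \<longleftrightarrow> (C +> x) \<oplus>\<^bsub>Q\<^esub> (C +> \<ominus> y) = \<zero>\<^bsub>Q\<^esub>"
  proof
    assume "C +> x = C +> y"
    then show "(C +> x) \<oplus>\<^bsub>Q\<^esub> (C +> \<ominus> y) = \<zero>\<^bsub>Q\<^esub>"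
      using assms by (simp add: add_cosets r_neg coset_zero)
  next
    assume "(C +> x) \<oplus>\<^bsub>Q\<^esub> (C +> \<ominus> y) = \<zero>\<^bsub>Q\<^esub>"
    then have "\<ominus>\<^bsub>Q\<^esub> (C +> \<ominus> y) = C +> x"
      using assms by (intro quot.minus_equality) (auto simp: carrier_quot)
    then show "C +> x = C +> y"
      using assms by (simp add: minus_coset)
  qed
  then show ?thesis
    using assms by (simp add: add_cosets coset_eq_zero_iff a_minus_def)
qed

lemma finsum_cosets:
  assumes "finite F" "f \<in> F \<rightarrow> carrier M"
  shows "finsum Q (\<lambda>i. C +> f i) F = C +> finsum M f F"
  using assms
proof (induction F)
  case (insert i F)
  then have "(\<lambda>i. C +> f i) \<in> F \<rightarrow> carrier Q" "C +> f i \<in> carrier Q"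
    by (auto simp: carrier_quot)
  with insert show ?case
    by (simp add: add_cosets Pi_def)
qed (simp add: coset_zero)

abbreviation "qB \<equiv> \<lambda>i. (\<lambda>x. C +> x) ` B i"

lemma additive_subgroup_image:
  assumes "additive_subgroup X M"
  shows "additive_subgroup ((\<lambda>x. C +> x) ` X) Q"
proof -
  note X = additive_subgroupD[OF assms]
  have 1: "\<zero>\<^bsub>Q\<^esub> \<in> (\<lambda>x. C +> x) ` X"
    using X(2) coset_zero by (metis imageI)
  have 2: "(C +> x) \<oplus>\<^bsub>Q\<^esub> (C +> y) \<in> (\<lambda>x. C +> x) ` X" if "x \<in> X" "y \<in> X" for x y
    using that X(1,3) add_cosets[of x y] by (metis imageI subsetD)
  have 3: "\<ominus>\<^bsub>Q\<^esub> (C +> x) \<in> (\<lambda>x. C +> x) ` X" if "x \<in> X" for x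
    using that X(1,4) minus_coset[of x] by (metis imageI subsetD)
  show ?thesis
    unfolding quot.additive_subgroup_iff using 1 2 3 X(1) by (auto simp: carrier_quot)
qed

sublocale graded_quot: graded_group Q I qB
proof (unfold_locales, unfold internal_direct_sum_def, intro conjI ballI allI impI)
  fix i assume "i \<in> I"
  then show "additive_subgroup (qB i) Q"
    using additive_subgroup_image part_subgroup by blast
next
  show "carrier Q = internal_sum Q I qB"
  proof
    show "carrier Q \<subseteq> internal_sum Q I qB"
    proof
      fix K assume "K \<in> carrier Q"
      then obtain x where x: "x \<in> carrier M" "K = C +> x"
        by (auto simp: carrier_quot)
      obtain F f where F: "finite F" "F \<subseteq> I" "\<forall>j\<in>F. f j \<in> B j" "x = finsum M f F"
        using obtain_decomposition[OF x(1)] by metis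
      have "f \<in> F \<rightarrow> carrier M" using F part_closed by auto
      then have "K = finsum Q (\<lambda>i. C +> f i) F"
        unfolding x F(4) by (rule finsum_cosets[OF F(1), symmetric])
      then show "K \<in> internal_sum Q I qB"
        unfolding internal_sum_def using F by blast
    qed
    show "internal_sum Q I qB \<subseteq> carrier Q"
    proof
      fix K assume "K \<in> internal_sum Q I qB"
      then obtain F f where F: "finite F" "F \<subseteq> I" "\<forall>j\<in>F. f j \<in> qB j" "K = finsum Q f F"
        unfolding internal_sum_def by blast
      then have "f \<in> F \<rightarrow> carrier Q" using part_closed by (fastforce simp: carrier_quot)
      then show "K \<in> carrier Q" unfolding F by (rule quot.finsum_closed)
    qed
  qed
next
  fix F f i
  assume "finite F \<and> F \<subseteq> I \<and> (\<forall>i\<in>F. f i \<in> qB i) \<and> finsum Q f F = \<zero>\<^bsub>Q\<^esub>" and i: "i \<in> F"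
  then have F: "finite F" "F \<subseteq> I" "\<forall>i\<in>F. \<exists>b\<in>B i. f i = C +> b" and z: "finsum Q f F = \<zero>\<^bsub>Q\<^esub>"
    unfolding image_iff by blast+
  from F(3) obtain b where b: "\<forall>i\<in>F. b i \<in> B i" "\<forall>i\<in>F. f i = C +> b i" by metis
  have bc: "b \<in> F \<rightarrow> carrier M" using b F part_closed by auto
  have "finsum Q f F = finsum Q (\<lambda>i. C +> b i) F"
    using b bc by (intro quot.finsum_cong') (auto simp: carrier_quot)
  then have "C +> finsum M b F = \<zero>\<^bsub>Q\<^esub>"
    using z finsum_cosets[OF F(1) bc] by simp
  then have "finsum M b F \<in> C"
    using coset_eq_zero_iff finsum_closed[OF bc] by blast
  \<comment> \<open>A vanishing sum of homogeneous cosets lifts to an element of \<open>C\<close>;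
    as \<open>C\<close> is graded, each lifted summand lies in \<open>C\<close> by itself.\<close>
  then have "pr i (finsum M b F) \<in> C"
    using graded_subgroupD(2)[OF gr_C] i F(2) by blast
  then have "b i \<in> C"
    using component_finsum[OF F(1,2) b(1)] i by simp
  then show "f i = \<zero>\<^bsub>Q\<^esub>"
    using b(2) bc i coset_eq_zero_iff by auto
qed

lemma component_coset:
  assumes "x \<in> carrier M"
  shows "component Q I qB i (C +> x) = C +> pr i x"
proof -
  obtain F f where F: "finite F" "F \<subseteq> I" "\<forall>j\<in>F. f j \<in> B j" "x = finsum M f F"
      "\<And>j. pr j x = (if j \<in> F then f j else \<zero>)"
    using obtain_decomposition[OF assms] by metis
  have fc: "f \<in> F \<rightarrow> carrier M" using F part_closed by auto
  show ?thesis
    using graded_quot.component_finsum[OF F(1,2), of "\<lambda>i. C +> f i" i] F(3,5)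
    by (simp add: finsum_cosets[OF F(1) fc] coset_zero flip: F(4))
qed

lemma graded_subgroup_image:
  assumes "gr_subgroup X"
  shows "graded_subgroup Q I qB ((\<lambda>x. C +> x) ` X)"
  using assms additive_subgroupD(1)[OF graded_subgroupD(1)[OF assms]]
  by (auto simp: graded_subgroup_def additive_subgroup_image component_coset subset_iff)

text \<open>Elements of \<open>Q\<close> are cosets, hence sets, and \<open>\<Union>Y\<close> is the
  preimage of \<open>Y\<close> under the canonical map. Preimages appear in this form
  throughout.\<close>

lemma coset_subset_iff:
  assumes "additive_subgroup Y Q"
  shows "x \<in> \<Union>Y \<longleftrightarrow> x \<in> carrier M \<and> C +> x \<in> Y"
proof
  assume "x \<in> \<Union>Y"
  then obtain K where K: "K \<in> Y" "x \<in> K" by auto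
  then obtain y where y: "y \<in> carrier M" "K = C +> y"
    using quot.additive_subgroupD(1)[OF assms] by (auto simp: carrier_quot)
  then show "x \<in> carrier M \<and> C +> x \<in> Y"
    using K a_repr_independence[OF _ _ C.a_subgroup, of x y] C.a_subset
    by (metis C.a_elemrcos_carrier)
next
  assume "x \<in> carrier M \<and> C +> x \<in> Y"
  then show "x \<in> \<Union>Y" using C.a_rcos_self by blast
qed

lemma image_Union:
  assumes "additive_subgroup Y Q"
  shows "(\<lambda>x. C +> x) ` \<Union>Y = Y"
proof
  show "(\<lambda>x. C +> x) ` \<Union>Y \<subseteq> Y"
    using coset_subset_iff[OF assms] by blast
  show "Y \<subseteq> (\<lambda>x. C +> x) ` \<Union>Y"
  proof
    fix K assume K: "K \<in> Y"
    then obtain y where y: "y \<in> carrier M" "K = C +> y"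
      using quot.additive_subgroupD(1)[OF assms] by (auto simp: carrier_quot)
    then have "y \<in> \<Union>Y"
      using coset_subset_iff[OF assms] K by blast
    then show "K \<in> (\<lambda>x. C +> x) ` \<Union>Y" using y(2) by blast
  qed
qed

lemma graded_subgroup_Union:
  assumes "graded_subgroup Q I qB Y"
  shows "gr_subgroup (\<Union>Y)" "C \<subseteq> \<Union>Y"
proof -
  note Y = graded_quot.graded_subgroupD[OF assms]
  note Y' = quot.additive_subgroupD[OF Y(1)]
  note iff = coset_subset_iff[OF Y(1)]
  have "additive_subgroup (\<Union>Y) M"
    unfolding additive_subgroup_iff
  proof (intro conjI ballI subsetI)
    show "\<zero> \<in> \<Union>Y" using iff Y'(2) coset_zero by simp
  next
    fix x y assume "x \<in> \<Union>Y" "y \<in> \<Union>Y"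
    then show "x \<oplus> y \<in> \<Union>Y" using iff Y'(3) by (metis add_cosets a_closed)
  next
    fix x assume "x \<in> \<Union>Y"
    then show "\<ominus> x \<in> \<Union>Y" using iff Y'(4) by (metis minus_coset a_inv_closed)
  qed (use iff in blast)
  moreover have "pr i x \<in> \<Union>Y" if "x \<in> \<Union>Y" "i \<in> I" for x i
    using that iff[of x] iff[of "pr i x"] component_coset component_closed Y(2) by metis
  ultimately show "gr_subgroup (\<Union>Y)" by (simp add: graded_subgroup_def)
  show "C \<subseteq> \<Union>Y" using Y'(2) zero_Q by blast
qed

end

section \<open>Graded submodules\<close>

text \<open>\<open>R\<close> acts only through its carrier, as a set of additive operators. The
  lattice of graded submodules depends on nothing more, so one theory covers submodules, quotients
  and modules over \<open>R Quot J\<close>.\<close>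

locale graded_action = graded_group M "arr \<Gamma>" B
  for \<Gamma> :: "('g, 'x) gpd_scheme" and R :: "('a, 'y) ring_scheme"
    and M :: "('a, 'm, 'z) module_scheme" (structure) and B :: "'g \<Rightarrow> 'm set" +
  assumes action_closed: "\<lbrakk>a \<in> carrier R; m \<in> carrier M\<rbrakk> \<Longrightarrow> a \<odot> m \<in> carrier M"
    and action_add: "\<lbrakk>a \<in> carrier R; m \<in> carrier M; n \<in> carrier M\<rbrakk>
        \<Longrightarrow> a \<odot> (m \<oplus> n) = a \<odot> m \<oplus> a \<odot> n"
begin

abbreviation "gsub \<equiv> graded_submodule \<Gamma> R M B"

lemma graded_submodule_iff:
  "gsub N \<longleftrightarrow> gr_subgroup N \<and> (\<forall>a\<in>carrier R. \<forall>x\<in>N. a \<odot> x \<in> N)"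
proof -
  have "submodule N R M \<longleftrightarrow> additive_subgroup N M \<and> (\<forall>a\<in>carrier R. \<forall>x\<in>N. a \<odot> x \<in> N)"
    by (auto simp: submodule_def submodule_axioms_def additive_subgroup_def)
  then show ?thesis
    unfolding graded_submodule_def
    using internal_direct_sum_iff graded_subgroupD(1) by blast
qed

lemma gsubD:
  assumes "gsub N"
  shows "gr_subgroup N" "additive_subgroup N M" "N \<subseteq> carrier M" "\<zero> \<in> N"
    "\<And>x y. \<lbrakk>x \<in> N; y \<in> N\<rbrakk> \<Longrightarrow> x \<oplus> y \<in> N" "\<And>x. x \<in> N \<Longrightarrow> \<ominus> x \<in> N"
    "\<And>x y. \<lbrakk>x \<in> N; y \<in> N\<rbrakk> \<Longrightarrow> x \<ominus> y \<in> N"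
    "\<And>x g. \<lbrakk>x \<in> N; g \<in> arr \<Gamma>\<rbrakk> \<Longrightarrow> pr g x \<in> N"
    "\<And>a x. \<lbrakk>a \<in> carrier R; x \<in> N\<rbrakk> \<Longrightarrow> a \<odot> x \<in> N"
proof -
  have 1: "gr_subgroup N" "\<forall>a\<in>carrier R. \<forall>x\<in>N. a \<odot> x \<in> N"
    using assms graded_submodule_iff by auto
  show "gr_subgroup N" "\<And>a x. \<lbrakk>a \<in> carrier R; x \<in> N\<rbrakk> \<Longrightarrow> a \<odot> x \<in> N"
    using 1 by auto
  show 2: "additive_subgroup N M" "\<And>x g. \<lbrakk>x \<in> N; g \<in> arr \<Gamma>\<rbrakk> \<Longrightarrow> pr g x \<in> N"
    using graded_subgroupD[OF 1(1)] by auto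
  show "N \<subseteq> carrier M" "\<zero> \<in> N"
    "\<And>x y. \<lbrakk>x \<in> N; y \<in> N\<rbrakk> \<Longrightarrow> x \<oplus> y \<in> N" "\<And>x. x \<in> N \<Longrightarrow> \<ominus> x \<in> N"
    "\<And>x y. \<lbrakk>x \<in> N; y \<in> N\<rbrakk> \<Longrightarrow> x \<ominus> y \<in> N"
    using additive_subgroupD[OF 2(1)] by auto
qed

lemma action_zero: "a \<in> carrier R \<Longrightarrow> a \<odot> \<zero> = \<zero>"
  using action_add[of a \<zero> \<zero>] action_closed[of a \<zero>]
  by (metis add.l_cancel_one' l_zero zero_closed)

lemma gsub_carrier: "gsub (carrier M)"
  unfolding graded_submodule_iff using graded_subgroup_carrier action_closed by auto

lemma gsub_zero: "gsub {\<zero>}"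
  unfolding graded_submodule_iff using graded_subgroup_zero action_zero by auto

text \<open>Statements about the module \<open>D\<close> become statements about the interval below
  \<open>D\<close> in the lattice of graded submodules of \<open>M\<close>, where the later
  arguments take place.\<close>

lemma graded_submodule_restrict:
  assumes D: "gsub D"
  shows "graded_submodule \<Gamma> R (M\<lparr>carrier := D\<rparr>) (sub_grading D B) X \<longleftrightarrow> gsub X \<and> X \<subseteq> D"
proof -
  note D' = gsubD[OF D]
  have "submodule X R (M\<lparr>carrier := D\<rparr>) \<longleftrightarrow> submodule X R M \<and> X \<subseteq> D"
    using additive_subgroup_restrict_iff[OF D'(2), of X]
    by (auto simp: submodule_def submodule_axioms_def additive_subgroup_def)
  moreover have "internal_direct_sum (M\<lparr>carrier := D\<rparr>) (arr \<Gamma>) (\<lambda>g. X \<inter> (D \<inter> B g)) X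
      \<longleftrightarrow> internal_direct_sum M (arr \<Gamma>) (\<lambda>g. X \<inter> B g) X" if "X \<subseteq> D"
  proof -
    have "(\<lambda>g. X \<inter> (D \<inter> B g)) = (\<lambda>g. X \<inter> B g)" using that by blast
    then show ?thesis
      using internal_direct_sum_restrict[OF D'(2), of "arr \<Gamma>" "\<lambda>g. X \<inter> B g" X] that by auto
  qed
  ultimately show ?thesis
    unfolding graded_submodule_def sub_grading_def by blast
qed

lemma graded_action_restrict:
  assumes D: "gsub D"
  shows "graded_action \<Gamma> R (M\<lparr>carrier := D\<rparr>) (sub_grading D B)"
proof -
  note D' = gsubD[OF D]
  interpret D: abelian_group "M\<lparr>carrier := D\<rparr>"
    by (rule abelian_group_restrict[OF D'(2)])
  show ?thesis
  proof unfold_locales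
    have "internal_direct_sum M (arr \<Gamma>) (\<lambda>g. D \<inter> B g) D"
      using D by (simp add: graded_submodule_def)
    then show "internal_direct_sum (M\<lparr>carrier := D\<rparr>) (arr \<Gamma>) (sub_grading D B)
        (carrier (M\<lparr>carrier := D\<rparr>))"
      unfolding sub_grading_def
      using internal_direct_sum_restrict[OF D'(2), of "arr \<Gamma>" "\<lambda>g. D \<inter> B g" D] by simp
  qed (use D' action_add in \<open>auto simp: subset_iff\<close>)
qed

section \<open>Covers and gr-simple factors\<close>

definition covers :: "'m set \<Rightarrow> 'm set \<Rightarrow> bool" where
  "covers C D \<longleftrightarrow> gsub C \<and> gsub D \<and> C \<subset> D \<and>
     (\<forall>X. gsub X \<longrightarrow> C \<subseteq> X \<longrightarrow> X \<subseteq> D \<longrightarrow> X = C \<or> X = D)"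

lemma quotient_graded:
  assumes "gsub C"
  shows "graded_quotient M (arr \<Gamma>) B C (quot_module M C)"
  using gsubD(1)[OF assms] by unfold_locales (auto simp: quot_module_def)

text \<open>The scalar multiple of a coset is a union over all its representatives. They differ by
  elements \<open>c\<close> of \<open>C\<close>, and \<open>a \<odot> c\<close> stays in
  \<open>C\<close>, so all of them contribute the same coset.\<close>

lemma quotient_action:
  assumes C: "gsub C" and a: "a \<in> carrier R" "x \<in> carrier M"
  shows "a \<odot>\<^bsub>quot_module M C\<^esub> (C +> x) = C +> (a \<odot> x)"
proof -
  interpret q: graded_quotient M "arr \<Gamma>" B C "quot_module M C"
    by (rule quotient_graded[OF C])
  have "C +> (a \<odot> y) = C +> (a \<odot> x)" if "y \<in> C +> x" for y
  proof -
    have "y \<in> (\<Union>c\<in>C. {c \<oplus> x})"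
      using that unfolding a_r_coset_def' .
    then obtain c where c: "c \<in> C" "y = c \<oplus> x" by (elim UN_E singletonE)
    then have cM: "c \<in> carrier M" using gsubD(3)[OF C] by auto
    then have "a \<odot> y = a \<odot> c \<oplus> a \<odot> x" using action_add a c by simp
    then have "a \<odot> y \<ominus> a \<odot> x = a \<odot> c"
      using a cM action_closed by (simp add: a_minus_def a_assoc r_neg)
    then show ?thesis
      using gsubD(9)[OF C a(1) c(1)] a c cM q.coset_eq_iff action_closed by simp
  qed
  then have "(\<Union>y\<in>C +> x. C +> (a \<odot> y)) = (\<Union>y\<in>C +> x. C +> (a \<odot> x))"
    by (intro SUP_cong refl)
  also have "\<dots> = C +> (a \<odot> x)"
    using q.C.a_rcos_self[OF a(2)] by (intro cSUP_const) blast
  finally show ?thesis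
    by (simp add: quot_module_def)
qed

lemma quotient_graded_action:
  assumes C: "gsub C"
  shows "graded_action \<Gamma> R (quot_module M C) (quot_grading M C B)"
proof -
  interpret q: graded_quotient M "arr \<Gamma>" B C "quot_module M C"
    by (rule quotient_graded[OF C])
  show ?thesis
    unfolding quot_grading_def
  proof unfold_locales
    fix a K assume "a \<in> carrier R" "K \<in> carrier (quot_module M C)"
    then show "a \<odot>\<^bsub>quot_module M C\<^esub> K \<in> carrier (quot_module M C)"
      by (auto simp: q.carrier_quot quotient_action[OF C] action_closed)
  next
    fix a K L assume "a \<in> carrier R" "K \<in> carrier (quot_module M C)" "L \<in> carrier (quot_module M C)"
    then show "a \<odot>\<^bsub>quot_module M C\<^esub> (K \<oplus>\<^bsub>quot_module M C\<^esub> L) =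
        a \<odot>\<^bsub>quot_module M C\<^esub> K \<oplus>\<^bsub>quot_module M C\<^esub> a \<odot>\<^bsub>quot_module M C\<^esub> L"
      by (auto simp: q.carrier_quot quotient_action[OF C] action_closed q.add_cosets action_add)
  qed
qed

lemma quotient_submodule_image:
  assumes C: "gsub C" and X: "gsub X"
  shows "graded_submodule \<Gamma> R (quot_module M C) (quot_grading M C B) ((\<lambda>x. C +> x) ` X)"
proof -
  interpret q: graded_quotient M "arr \<Gamma>" B C "quot_module M C"
    by (rule quotient_graded[OF C])
  interpret qa: graded_action \<Gamma> R "quot_module M C" "quot_grading M C B"
    by (rule quotient_graded_action[OF C])
  have "a \<odot>\<^bsub>quot_module M C\<^esub> (C +> x) \<in> (\<lambda>x. C +> x) ` X" if "a \<in> carrier R" "x \<in> X" for a x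
    using that gsubD(3,9)[OF X] quotient_action[OF C] by auto
  then show ?thesis
    unfolding qa.graded_submodule_iff
    using q.graded_subgroup_image[OF gsubD(1)[OF X]] by (auto simp: quot_grading_def)
qed

lemma quotient_submodule_Union:
  assumes C: "gsub C"
    and Y: "graded_submodule \<Gamma> R (quot_module M C) (quot_grading M C B) Y"
  shows "gsub (\<Union>Y)" "C \<subseteq> \<Union>Y" "(\<lambda>x. C +> x) ` \<Union>Y = Y"
    "\<And>x. x \<in> \<Union>Y \<longleftrightarrow> x \<in> carrier M \<and> C +> x \<in> Y"
proof -
  interpret q: graded_quotient M "arr \<Gamma>" B C "quot_module M C"
    by (rule quotient_graded[OF C])
  interpret qa: graded_action \<Gamma> R "quot_module M C" "quot_grading M C B"
    by (rule quotient_graded_action[OF C])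
  have Y': "graded_subgroup (quot_module M C) (arr \<Gamma>) q.qB Y"
    using qa.gsubD(1)[OF Y] unfolding quot_grading_def .
  show iff: "\<And>x. x \<in> \<Union>Y \<longleftrightarrow> x \<in> carrier M \<and> C +> x \<in> Y"
    by (rule q.coset_subset_iff[OF qa.gsubD(2)[OF Y]])
  show "C \<subseteq> \<Union>Y" by (rule q.graded_subgroup_Union(2)[OF Y'])
  show "(\<lambda>x. C +> x) ` \<Union>Y = Y" by (rule q.image_Union[OF qa.gsubD(2)[OF Y]])
  have "a \<odot> x \<in> \<Union>Y" if "a \<in> carrier R" "x \<in> \<Union>Y" for a x
    using that iff qa.gsubD(9)[OF Y] quotient_action[OF C] action_closed by metis
  then show "gsub (\<Union>Y)"
    unfolding graded_submodule_iff using q.graded_subgroup_Union(1)[OF Y'] by blast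
qed

lemma quotient_image_zero:
  assumes C: "gsub C"
  shows "(\<lambda>x. C +> x) ` C = {\<zero>\<^bsub>quot_module M C\<^esub>}"
proof -
  interpret q: graded_quotient M "arr \<Gamma>" B C "quot_module M C"
    by (rule quotient_graded[OF C])
  have "(\<lambda>x. C +> x) ` C = (\<lambda>_. \<zero>\<^bsub>quot_module M C\<^esub>) ` C"
    using gsubD(3)[OF C] q.coset_eq_zero_iff by (intro image_cong) (auto simp: subset_iff)
  then show ?thesis using image_constant[OF gsubD(4)[OF C]] by metis
qed

lemma Union_quotient_image:
  assumes C: "gsub C" and X: "gsub X" "C \<subseteq> X"
  shows "\<Union>((\<lambda>x. C +> x) ` X) = X"
proof -
  interpret q: graded_quotient M "arr \<Gamma>" B C "quot_module M C"
    by (rule quotient_graded[OF C])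
  note Y = quotient_submodule_Union[OF C quotient_submodule_image[OF C X(1)]]
  have "x \<in> X" if "x \<in> \<Union>((\<lambda>x. C +> x) ` X)" for x
  proof -
    have "x \<in> carrier M" "C +> x \<in> (\<lambda>x. C +> x) ` X"
      using iffD1[OF Y(4) that] by (rule conjunct1, rule conjunct2)
    then obtain y where y: "y \<in> X" "C +> x = C +> y" "x \<in> carrier M" by (elim imageE)
    then have yM: "y \<in> carrier M" using gsubD(3)[OF X(1)] by auto
    then have "x \<ominus> y \<in> X" using y q.coset_eq_iff X(2) by auto
    then have "(x \<ominus> y) \<oplus> y \<in> X" using y gsubD(5)[OF X(1)] by auto
    then show ?thesis using y yM by (simp add: a_minus_def a_assoc l_neg)
  qed
  moreover have "x \<in> \<Union>((\<lambda>x. C +> x) ` X)" if "x \<in> X" for x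
    using Y(4)[of x] that gsubD(3)[OF X(1)] by blast
  ultimately show ?thesis by blast
qed

lemma quotient_image_inj:
  assumes "gsub C" "gsub X" "C \<subseteq> X" "gsub X'" "C \<subseteq> X'" "(\<lambda>x. C +> x) ` X = (\<lambda>x. C +> x) ` X'"
  shows "X = X'"
  using Union_quotient_image[OF assms(1-3)] Union_quotient_image[OF assms(1,4,5)] assms(6) by metis

text \<open>This is the correspondence theorem: images under the canonical map and unions of cosets
  are inverse to each other between the graded submodules containing \<open>C\<close> and those of
  the quotient.\<close>

lemma gr_simple_quotient_iff:
  assumes C: "gsub C"
  shows "gr_simple \<Gamma> R (quot_module M C) (quot_grading M C B) \<longleftrightarrow> covers C (carrier M)"
proof -
  interpret q: graded_quotient M "arr \<Gamma>" B C "quot_module M C"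
    by (rule quotient_graded[OF C])
  let ?im = "\<lambda>X. (\<lambda>x. C +> x) ` X"
  note im_zero = quotient_image_zero[OF C]
  note im_inj = quotient_image_inj[OF C]
  have C_sub: "C \<subseteq> carrier M" by (rule gsubD(3)[OF C])
  show ?thesis
  proof
    assume L: "gr_simple \<Gamma> R (quot_module M C) (quot_grading M C B)"
    have "C \<noteq> carrier M"
      using L im_zero unfolding gr_simple_def q.carrier_quot by blast
    moreover have "X = C \<or> X = carrier M" if X: "gsub X" "C \<subseteq> X" for X
    proof -
      have "?im X = ?im C \<or> ?im X = ?im (carrier M)"
        using L quotient_submodule_image[OF C X(1)]
        unfolding gr_simple_def q.carrier_quot im_zero by blast
      then show ?thesis
        using im_inj[OF X C order_refl] im_inj[OF X gsub_carrier C_sub] by blast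
    qed
    ultimately show "covers C (carrier M)"
      unfolding covers_def using C gsub_carrier C_sub by blast
  next
    assume R: "covers C (carrier M)"
    show "gr_simple \<Gamma> R (quot_module M C) (quot_grading M C B)"
      unfolding gr_simple_def
    proof (intro conjI allI impI)
      show "carrier (quot_module M C) \<noteq> {\<zero>\<^bsub>quot_module M C\<^esub>}"
        using R im_inj[OF C order_refl gsub_carrier C_sub]
        unfolding covers_def q.carrier_quot im_zero[symmetric] by blast
    next
      fix Y assume Y: "graded_submodule \<Gamma> R (quot_module M C) (quot_grading M C B) Y"
      note Y' = quotient_submodule_Union[OF C Y]
      have "\<Union>Y = C \<or> \<Union>Y = carrier M"
        using R Y' gsubD(3)[OF Y'(1)] unfolding covers_def by blast
      then show "Y = {\<zero>\<^bsub>quot_module M C\<^esub>} \<or> Y = carrier (quot_module M C)"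
        using Y'(3) im_zero q.carrier_quot by metis
    qed
  qed
qed

lemma gr_simple_factor_iff:
  assumes C: "gsub C" and D: "gsub D" and CD: "C \<subseteq> D"
  shows "gr_simple \<Gamma> R (quot_module (M\<lparr>carrier := D\<rparr>) C)
      (quot_grading (M\<lparr>carrier := D\<rparr>) C (sub_grading D B)) \<longleftrightarrow> covers C D"
proof -
  interpret D: graded_action \<Gamma> R "M\<lparr>carrier := D\<rparr>" "sub_grading D B"
    by (rule graded_action_restrict[OF D])
  have "D.covers C (carrier (M\<lparr>carrier := D\<rparr>)) \<longleftrightarrow> covers C D"
    unfolding D.covers_def covers_def graded_submodule_restrict[OF D] using C D CD by auto
  then show ?thesis
    using D.gr_simple_quotient_iff[of C] C CD graded_submodule_restrict[OF D] by simp
qed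

section \<open>Composition series as chains of covers\<close>

definition length_is :: "'m set \<Rightarrow> nat \<Rightarrow> bool" where
  "length_is D n \<longleftrightarrow> (\<exists>C. C 0 = {\<zero>} \<and> C n = D \<and> (\<forall>j<n. covers (C j) (C (Suc j))))"

lemma chain_gsub:
  assumes "gsub (C 0)" "\<forall>j<n. covers (C j) (C (Suc j))" "j \<le> n"
  shows "gsub (C j)"
  using assms by (cases j) (auto simp: covers_def)

lemma chain_mono:
  assumes "\<forall>j<n. covers (C j) (C (Suc j))" "i \<le> j" "j \<le> n"
  shows "C i \<subseteq> C j"
  using assms(2,3)
proof (induction j rule: dec_induct)
  case (step j)
  then have "C i \<subseteq> C j" "covers (C j) (C (Suc j))" using assms(1) by auto
  then show ?case by (auto simp: covers_def)
qed simp

text \<open>The nested gradings collapse, since restricting to \<open>D\<close> and then to some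
  \<open>C' \<subseteq> D\<close> is restricting to \<open>C'\<close>. Each gr-simple factor then
  becomes a cover in the lattice of \<open>M\<close>.\<close>

lemma has_gr_length_restrict:
  assumes D: "gsub D"
  shows "has_gr_length \<Gamma> R (M\<lparr>carrier := D\<rparr>) (sub_grading D B) n \<longleftrightarrow> length_is D n"
proof -
  have *: "sub_grading C (sub_grading D B) = sub_grading C B" if "C \<subseteq> D" for C
    using that by (auto simp: sub_grading_def)
  have **: "gr_simple \<Gamma> R (quot_module (M\<lparr>carrier := D, carrier := C'\<rparr>) C)
      (quot_grading (M\<lparr>carrier := D, carrier := C'\<rparr>) C (sub_grading C' (sub_grading D B)))
      \<longleftrightarrow> covers C C'" if "gsub C" "gsub C'" "C \<subseteq> C'" "C' \<subseteq> D" for C C'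
    using gr_simple_factor_iff[OF that(1-3)] *[OF that(4)] by simp
  show ?thesis
  proof
    assume "has_gr_length \<Gamma> R (M\<lparr>carrier := D\<rparr>) (sub_grading D B) n"
    then obtain C where C: "C 0 = {\<zero>}" "C n = D"
        "\<forall>j\<le>n. gsub (C j) \<and> C j \<subseteq> D" "\<forall>j<n. C j \<subseteq> C (Suc j)"
        "\<forall>j<n. gr_simple \<Gamma> R (quot_module (M\<lparr>carrier := D, carrier := C (Suc j)\<rparr>) (C j))
          (quot_grading (M\<lparr>carrier := D, carrier := C (Suc j)\<rparr>) (C j)
            (sub_grading (C (Suc j)) (sub_grading D B)))"
      unfolding has_gr_length_def graded_submodule_restrict[OF D] by auto
    then have "\<forall>j<n. covers (C j) (C (Suc j))"
      using ** by (metis Suc_leI less_imp_le)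
    then show "length_is D n"
      unfolding length_is_def using C by blast
  next
    assume "length_is D n"
    then obtain C where C: "C 0 = {\<zero>}" "C n = D" "\<forall>j<n. covers (C j) (C (Suc j))"
      unfolding length_is_def by blast
    have 1: "gsub (C j) \<and> C j \<subseteq> D" if "j \<le> n" for j
      using chain_gsub[OF _ C(3) that] chain_mono[OF C(3) that] C(1,2) gsub_zero by auto
    have 2: "C j \<subseteq> C (Suc j)" if "j < n" for j
      using C(3) that by (auto simp: covers_def)
    have 3: "gr_simple \<Gamma> R (quot_module (M\<lparr>carrier := D, carrier := C (Suc j)\<rparr>) (C j))
          (quot_grading (M\<lparr>carrier := D, carrier := C (Suc j)\<rparr>) (C j)
            (sub_grading (C (Suc j)) (sub_grading D B)))" if "j < n" for j
      using **[of "C j" "C (Suc j)"] 1[of j] 1[of "Suc j"] 2[OF that] C(3) that by auto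
    show "has_gr_length \<Gamma> R (M\<lparr>carrier := D\<rparr>) (sub_grading D B) n"
      unfolding has_gr_length_def graded_submodule_restrict[OF D]
      using C(1,2) 1 2 3 by (intro exI[of _ C]) auto
  qed
qed

end

section \<open>Length and chain conditions\<close>

context graded_action
begin

lemma gsubI:
  assumes N: "gr_subgroup N"
    and hom: "\<And>a s b. \<lbrakk>a \<in> carrier R; s \<in> arr \<Gamma>; b \<in> B s; b \<in> N\<rbrakk> \<Longrightarrow> a \<odot> b \<in> N"
  shows "gsub N"
proof -
  note N' = additive_subgroupD[OF graded_subgroupD(1)[OF N]]
  have "a \<odot> x \<in> N" if a: "a \<in> carrier R" and x: "x \<in> N" for a x
    using N x
  proof (induction rule: graded_induct)
    case (add x y)
    have "x \<in> carrier M" "y \<in> carrier M" using add N'(1) by auto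
    then show ?case using add N'(3) action_add[OF a] by metis
  qed (use a hom N' action_zero in auto)
  then show ?thesis using N graded_submodule_iff by blast
qed

lemma gsub_inter: "\<lbrakk>gsub N; gsub N'\<rbrakk> \<Longrightarrow> gsub (N \<inter> N')"
  unfolding graded_submodule_iff graded_subgroup_def additive_subgroup_iff by blast

lemma set_add_iff: "z \<in> set_add M N N' \<longleftrightarrow> (\<exists>x\<in>N. \<exists>y\<in>N'. z = x \<oplus> y)"
  unfolding set_add_def' by blast

lemma gsub_sum:
  assumes N: "gsub N" and N': "gsub N'"
  shows "gsub (set_add M N N')" "N \<subseteq> set_add M N N'" "N' \<subseteq> set_add M N N'"
proof -
  note D = gsubD[OF N] and D' = gsubD[OF N']
  have add: "additive_subgroup (set_add M N N') M"
    by (rule add_additive_subgroups[OF D(2) D'(2)])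
  have "pr g z \<in> set_add M N N'" if "z \<in> set_add M N N'" "g \<in> arr \<Gamma>" for z g
  proof -
    obtain x y where xy: "x \<in> N" "y \<in> N'" "z = x \<oplus> y"
      using \<open>z \<in> set_add M N N'\<close> unfolding set_add_iff by blast
    then have "pr g z = pr g x \<oplus> pr g y"
      using D(3) D'(3) component_add by blast
    then show ?thesis
      unfolding set_add_iff using D(8) D'(8) xy that(2) by blast
  qed
  moreover have "a \<odot> z \<in> set_add M N N'" if "z \<in> set_add M N N'" "a \<in> carrier R" for z a
  proof -
    obtain x y where xy: "x \<in> N" "y \<in> N'" "z = x \<oplus> y"
      using \<open>z \<in> set_add M N N'\<close> unfolding set_add_iff by blast
    then have "a \<odot> z = a \<odot> x \<oplus> a \<odot> y"
      using D(3) D'(3) action_add that(2) by blast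
    then show ?thesis
      unfolding set_add_iff using D(9) D'(9) xy that(2) by blast
  qed
  ultimately show "gsub (set_add M N N')"
    using add unfolding graded_submodule_iff graded_subgroup_def by blast
  have "\<exists>y\<in>N'. x = x \<oplus> y" if "x \<in> N" for x
    using D(3) D'(4) that by (intro bexI[of _ \<zero>]) auto
  then show "N \<subseteq> set_add M N N'" unfolding subset_iff set_add_iff by blast
  have "\<exists>x\<in>N. y = x \<oplus> y" if "y \<in> N'" for y
    using D'(3) D(4) that by (intro bexI[of _ \<zero>]) auto
  then show "N' \<subseteq> set_add M N N'" unfolding subset_iff set_add_iff by blast
qed

lemma gsub_sum_least: "\<lbrakk>gsub Q; N \<subseteq> Q; N' \<subseteq> Q\<rbrakk> \<Longrightarrow> set_add M N N' \<subseteq> Q"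
  unfolding subset_iff set_add_iff using gsubD(5) by blast

text \<open>Count the factors of a composition series \<open>C\<close> met by \<open>X\<close>, that is, the \<open>j\<close> with
  \<open>\<not> X \<inter> C (j + 1) \<subseteq> C j\<close>: by the modular law this count is strictly monotone in \<open>X\<close>.\<close>

lemma length_bound:
  assumes D: "length_is D n"
    and E: "\<And>i. i \<le> k \<Longrightarrow> gsub (E i)" "\<And>i. i \<le> k \<Longrightarrow> E i \<subseteq> D" "\<And>i. i < k \<Longrightarrow> E i \<subset> E (Suc i)"
  shows "k \<le> n"
proof -
  obtain C where C: "C 0 = {\<zero>}" "C n = D" "\<forall>j<n. covers (C j) (C (Suc j))"
    using D unfolding length_is_def by blast
  define S where "S X = {j. j < n \<and> \<not> X \<inter> C (Suc j) \<subseteq> C j}" for X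
  have S_fin: "finite (S X)" "card (S X) \<le> n" for X
  proof -
    have "S X \<subseteq> {..<n}" by (auto simp: S_def)
    then show "finite (S X)" "card (S X) \<le> n"
      using finite_subset card_mono[of "{..<n}"] by auto
  qed
  have S_strict: "S X \<subset> S X'" if X: "gsub X" "gsub X'" "X \<subset> X'" "X' \<subseteq> D" for X X'
  proof (rule psubsetI)
    show "S X \<subseteq> S X'" using X(3) by (auto simp: S_def)
    show "S X \<noteq> S X'"
    proof
      assume eq: "S X = S X'"
      \<comment> \<open>If \<open>X\<close> and \<open>X'\<close> meet the same factors,
        \<open>X'\<close> is absorbed into \<open>X\<close> level by level, up to
        \<open>C n = D\<close>.\<close>
      have "X' \<inter> C j \<subseteq> X" if "j \<le> n" for j
        using that
      proof (induction j)
        case 0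
        then show ?case using C(1) gsubD(4)[OF X(1)] by auto
      next
        case (Suc j)
        then have cov: "covers (C j) (C (Suc j))" using C(3) by simp
        then have gC: "gsub (C j)" "gsub (C (Suc j))" by (auto simp: covers_def)
        show ?case
        proof (cases "j \<in> S X")
          case False
          then have "X' \<inter> C (Suc j) \<subseteq> C j" using eq Suc.prems by (auto simp: S_def)
          then show ?thesis using Suc by auto
        next
          case True
          \<comment> \<open>A factor met by \<open>X\<close> is filled by it: \<open>?T\<close> lies
            strictly above \<open>C j\<close>, so it is all of \<open>C (Suc j)\<close>. An
            \<open>x\<close> in \<open>X'\<close> is then \<open>c\<close> plus an element of
            \<open>X\<close>, which puts \<open>c\<close> into \<open>X' \<inter> C j\<close>, where
            the induction hypothesis applies.\<close>
          let ?T = "set_add M (C j) (X \<inter> C (Suc j))"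
          note T = gsub_sum[OF gC(1) gsub_inter[OF X(1) gC(2)]]
          have "?T \<noteq> C j" using True T(3) by (auto simp: S_def)
          moreover have "?T \<subseteq> C (Suc j)"
            using cov by (intro gsub_sum_least[OF gC(2)]) (auto simp: covers_def)
          ultimately have eqT: "?T = C (Suc j)"
            using cov T(1,2) unfolding covers_def by blast
          show ?thesis
          proof
            fix x assume x: "x \<in> X' \<inter> C (Suc j)"
            then have "x \<in> ?T" using eqT by auto
            then obtain c d where cd: "c \<in> C j" "d \<in> X \<inter> C (Suc j)" "x = c \<oplus> d"
              unfolding set_add_iff by blast
            then have M: "c \<in> carrier M" "d \<in> carrier M"
              using gsubD(3)[OF gC(1)] gsubD(3)[OF gC(2)] by auto
            have "x \<ominus> d \<in> X'" using x cd X(3) gsubD(7)[OF X(2)] by auto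
            then have "c \<in> X'" using M by (simp add: cd(3) a_minus_def a_assoc r_neg)
            then have "c \<in> X" using Suc cd(1) by auto
            then show "x \<in> X" using cd gsubD(5)[OF X(1)] by auto
          qed
        qed
      qed
      from this[of n] have "X' \<subseteq> X" using C(2) X(4) by auto
      then show False using X(3) by auto
    qed
  qed
  have "i \<le> card (S (E i))" if "i \<le> k" for i
    using that
  proof (induction i)
    case (Suc i)
    then have "S (E i) \<subset> S (E (Suc i))"
      using E by (intro S_strict) auto
    then have "card (S (E i)) < card (S (E (Suc i)))"
      using S_fin psubset_card_mono by blast
    then show ?case using Suc by auto
  qed simp
  from this[of k] show ?thesis using S_fin(2)[of "E k"] by simp
qed

lemma length_bound_decreasing:
  assumes D: "length_is D n"
    and E: "\<And>i. i \<le> k \<Longrightarrow> gsub (E i)" "\<And>i. i \<le> k \<Longrightarrow> E i \<subseteq> D" "\<And>i. i < k \<Longrightarrow> E (Suc i) \<subset> E i"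
  shows "k \<le> n"
proof (rule length_bound[OF D])
  fix i assume i: "i < k"
  then have "Suc (k - Suc i) = k - i" by simp
  then show "E (k - i) \<subset> E (k - Suc i)" using E(3)[of "k - Suc i"] i by simp
qed (use E in auto)

definition artinian_on :: "'m set \<Rightarrow> bool" where
  "artinian_on D \<longleftrightarrow> \<not> (\<exists>C :: nat \<Rightarrow> 'm set. \<forall>i. gsub (C i) \<and> C i \<subseteq> D \<and> C (Suc i) \<subset> C i)"

definition noetherian_on :: "'m set \<Rightarrow> bool" where
  "noetherian_on D \<longleftrightarrow> \<not> (\<exists>C :: nat \<Rightarrow> 'm set. \<forall>i. gsub (C i) \<and> C i \<subseteq> D \<and> C i \<subset> C (Suc i))"

lemma gr_artinian_restrict:
  "gsub D \<Longrightarrow> gr_artinian \<Gamma> R (M\<lparr>carrier := D\<rparr>) (sub_grading D B) \<longleftrightarrow> artinian_on D"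
  unfolding gr_artinian_def artinian_on_def by (simp add: graded_submodule_restrict conj_assoc)

lemma gr_noetherian_restrict:
  "gsub D \<Longrightarrow> gr_noetherian \<Gamma> R (M\<lparr>carrier := D\<rparr>) (sub_grading D B) \<longleftrightarrow> noetherian_on D"
  unfolding gr_noetherian_def noetherian_on_def by (simp add: graded_submodule_restrict conj_assoc)

lemma gr_artinian_iff: "gr_artinian \<Gamma> R M B \<longleftrightarrow> artinian_on (carrier M)"
  unfolding gr_artinian_def artinian_on_def by (simp add: gsubD(3) cong: conj_cong)

lemma gr_noetherian_iff: "gr_noetherian \<Gamma> R M B \<longleftrightarrow> noetherian_on (carrier M)"
  unfolding gr_noetherian_def noetherian_on_def by (simp add: gsubD(3) cong: conj_cong)

lemma has_gr_length_iff: "has_gr_length \<Gamma> R M B n \<longleftrightarrow> length_is (carrier M) n"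
proof -
  have 1: "graded_submodule \<Gamma> R M (sub_grading (carrier M) B) X \<longleftrightarrow> gsub X" for X
    using graded_submodule_restrict[OF gsub_carrier, of X] gsubD(3)[of X] by auto
  have 2: "sub_grading X (sub_grading (carrier M) B) = sub_grading X B" if "gsub X" for X
    using gsubD(3)[OF that] by (auto simp: sub_grading_def)
  have "has_gr_length \<Gamma> R M (sub_grading (carrier M) B) n \<longleftrightarrow> has_gr_length \<Gamma> R M B n"
    unfolding has_gr_length_def 1 by (rule ex_cong1) (use 2 Suc_leI in auto)
  then show ?thesis
    using has_gr_length_restrict[OF gsub_carrier, of n] by simp
qed

lemma length_is_imp_artinian:
  assumes "length_is D n"
  shows "artinian_on D"
  unfolding artinian_on_def
proof
  assume "\<exists>C :: nat \<Rightarrow> 'm set. \<forall>i. gsub (C i) \<and> C i \<subseteq> D \<and> C (Suc i) \<subset> C i"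
  then obtain C :: "nat \<Rightarrow> 'm set" where "\<forall>i. gsub (C i) \<and> C i \<subseteq> D \<and> C (Suc i) \<subset> C i" ..
  then have "Suc n \<le> n" by (intro length_bound_decreasing[OF assms, of _ C]) auto
  then show False by simp
qed

lemma length_is_imp_noetherian:
  assumes "length_is D n"
  shows "noetherian_on D"
  unfolding noetherian_on_def
proof
  assume "\<exists>C :: nat \<Rightarrow> 'm set. \<forall>i. gsub (C i) \<and> C i \<subseteq> D \<and> C i \<subset> C (Suc i)"
  then obtain C :: "nat \<Rightarrow> 'm set" where "\<forall>i. gsub (C i) \<and> C i \<subseteq> D \<and> C i \<subset> C (Suc i)" ..
  then have "Suc n \<le> n" by (intro length_bound[OF assms, of _ C]) auto
  then show False by simp
qed

lemma length_is_zero: "length_is {\<zero>} 0"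
  unfolding length_is_def by (intro exI[of _ "\<lambda>_. {\<zero>}"]) auto

lemma length_is_Suc:
  assumes "length_is Y n" "covers Y Q"
  shows "length_is Q (Suc n)"
proof -
  obtain C where C: "C 0 = {\<zero>}" "C n = Y" "\<forall>j<n. covers (C j) (C (Suc j))"
    using assms(1) unfolding length_is_def by blast
  show ?thesis
    unfolding length_is_def
  proof (intro exI[of _ "\<lambda>j. if j \<le> n then C j else Q"] conjI allI impI)
    fix j assume "j < Suc n"
    then consider "j < n" | "j = n" by linarith
    then show "covers (if j \<le> n then C j else Q) (if Suc j \<le> n then C (Suc j) else Q)"
      using C assms(2) by cases auto
  qed (use C in auto)
qed

end

text \<open>Isolates what the ring contributes: descending through coatoms builds a composition
  series from the top, climbing through atoms builds one from the bottom.\<close>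

locale semiartinian_action = graded_action \<Gamma> R M B
  for \<Gamma> :: "('g, 'x) gpd_scheme" and R :: "('a, 'y) ring_scheme"
    and M :: "('a, 'm, 'z) module_scheme" (structure) and B :: "'g \<Rightarrow> 'm set" +
  assumes has_coatom: "\<lbrakk>gsub Q; Q \<noteq> {\<zero>}\<rbrakk> \<Longrightarrow> \<exists>Y. covers Y Q"
    and has_atom: "\<lbrakk>gsub N; gsub D; N \<subset> D\<rbrakk> \<Longrightarrow> \<exists>Q. covers N Q \<and> Q \<subseteq> D"
begin

text \<open>A submodule without a composition series is nonzero, hence has a coatom, and the coatom
  has no series either, because one more cover would extend it. Iterating gives an infinite
  descending chain.\<close>

lemma artinian_imp_length:
  assumes D: "gsub D" and art: "artinian_on D"
  shows "\<exists>n. length_is D n"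
proof (rule ccontr)
  assume no: "\<nexists>n. length_is D n"
  define P where "P X \<longleftrightarrow> gsub X \<and> X \<subseteq> D \<and> (\<nexists>n. length_is X n)" for X
  have step: "\<exists>Y. P Y \<and> Y \<subset> X" if X: "P X" for X
  proof -
    have X': "gsub X" "X \<subseteq> D" "\<nexists>n. length_is X n" using X by (auto simp: P_def)
    then have "X \<noteq> {\<zero>}" using length_is_zero by metis
    then obtain Y where Y: "covers Y X" using has_coatom X'(1) by metis
    then have "gsub Y" "Y \<subseteq> D" using X'(2) unfolding covers_def by auto
    moreover have "\<nexists>n. length_is Y n" using length_is_Suc[OF _ Y] X'(3) by metis
    ultimately have "P Y" unfolding P_def by simp
    with Y show ?thesis unfolding covers_def by blast
  qed
  have "\<exists>C :: nat \<Rightarrow> 'm set. \<forall>i. P (C i) \<and> C (Suc i) \<subset> C i"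
  proof (rule dependent_nat_choice)
    show "\<exists>X. P X" using no D unfolding P_def by blast
  qed (rule step)
  then show False
    using art unfolding artinian_on_def P_def by metis
qed

lemma noetherian_imp_length:
  assumes D: "gsub D" and noe: "noetherian_on D"
  shows "\<exists>n. length_is D n"
proof -
  \<comment> \<open>The climb starts at \<open>{\<zero>}\<close>, so what has to be measured is the
    interval from \<open>X\<close> up to \<open>D\<close>.\<close>
  define len where "len X n \<longleftrightarrow> (\<exists>C. C 0 = X \<and> C n = D \<and> (\<forall>j<n. covers (C j) (C (Suc j))))" for X n
  define P where "P X \<longleftrightarrow> gsub X \<and> X \<subseteq> D \<and> (\<nexists>n. len X n)" for X
  have len_D: "len D 0" unfolding len_def by (intro exI[of _ "\<lambda>_. D"]) auto
  have len_Suc: "len X (Suc n)" if "covers X Y" "len Y n" for X Y n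
  proof -
    obtain C where C: "C 0 = Y" "C n = D" "\<forall>j<n. covers (C j) (C (Suc j))"
      using \<open>len Y n\<close> unfolding len_def by blast
    show ?thesis
      unfolding len_def
      by (intro exI[of _ "case_nat X C"]) (use C that(1) in \<open>auto split: nat.split\<close>)
  qed
  have step: "\<exists>Y. P Y \<and> X \<subset> Y" if X: "P X" for X
  proof -
    have X': "gsub X" "X \<subseteq> D" "\<nexists>n. len X n" using X by (auto simp: P_def)
    then have "X \<subset> D" using len_D by (metis psubsetI)
    then obtain Y where Y: "covers X Y" "Y \<subseteq> D" using has_atom X'(1) D by metis
    then have "gsub Y" unfolding covers_def by auto
    moreover have "\<nexists>n. len Y n" using len_Suc[OF Y(1)] X'(3) by metis
    ultimately have "P Y" using Y(2) unfolding P_def by simp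
    with Y show ?thesis unfolding covers_def by blast
  qed
  have "\<not> P {\<zero>}"
  proof
    assume "P {\<zero>}"
    have "\<exists>C :: nat \<Rightarrow> 'm set. \<forall>i. P (C i) \<and> C i \<subset> C (Suc i)"
      by (rule dependent_nat_choice, rule exI, rule \<open>P {\<zero>}\<close>, rule step)
    then show False
      using noe unfolding noetherian_on_def P_def by metis
  qed
  then have "\<exists>n. len {\<zero>} n"
    using gsub_zero gsubD(4)[OF D] unfolding P_def by blast
  then show ?thesis
    unfolding len_def length_is_def by blast
qed

lemma length_iff_artinian: "gsub D \<Longrightarrow> (\<exists>n. length_is D n) \<longleftrightarrow> artinian_on D"
  using artinian_imp_length length_is_imp_artinian by blast

lemma length_iff_noetherian: "gsub D \<Longrightarrow> (\<exists>n. length_is D n) \<longleftrightarrow> noetherian_on D"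
  using noetherian_imp_length length_is_imp_noetherian by blast

lemma chain_conditions_equivalent:
  "gr_noetherian \<Gamma> R M B \<longleftrightarrow> gr_artinian \<Gamma> R M B"
  "gr_artinian \<Gamma> R M B \<longleftrightarrow> finite_gr_length \<Gamma> R M B"
  unfolding gr_noetherian_iff gr_artinian_iff finite_gr_length_def has_gr_length_iff
  using length_iff_artinian[OF gsub_carrier] length_iff_noetherian[OF gsub_carrier] by auto

end

section \<open>Conditions relative to the objects\<close>

text \<open>\<open>p\<close> reads off the end of a degree that multiplication leaves alone: the
  target for right modules and, through the opposite groupoid, the source for left modules. The last
  assumption makes every object part stable under scalars.\<close>

locale object_action = graded_action \<Gamma> R M B
  for \<Gamma> :: "('g, 'x) gpd_scheme" and R :: "('a, 'y) ring_scheme"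
    and M :: "('a, 'm, 'z) module_scheme" (structure) and B :: "'g \<Rightarrow> 'm set" +
  fixes p :: "'g \<Rightarrow> 'g"
  assumes object_id: "g \<in> arr \<Gamma> \<Longrightarrow> p g \<in> ids \<Gamma>"
    and action_object: "\<lbrakk>a \<in> carrier R; s \<in> arr \<Gamma>; b \<in> B s; g \<in> arr \<Gamma>; p g \<noteq> p s\<rbrakk>
        \<Longrightarrow> pr g (a \<odot> b) = \<zero>"
begin

abbreviation "obj \<equiv> obj_part \<Gamma> p M B"

lemma obj_part_mem:
  assumes X: "gsub X"
  shows "x \<in> obj_part \<Gamma> p M (sub_grading X B) e \<longleftrightarrow>
    x \<in> X \<and> (\<forall>g\<in>arr \<Gamma>. p g \<noteq> e \<longrightarrow> pr g x = \<zero>)"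
proof
  assume "x \<in> obj_part \<Gamma> p M (sub_grading X B) e"
  then obtain F f where F: "finite F" "F \<subseteq> {g \<in> arr \<Gamma>. p g = e}" "\<forall>i\<in>F. f i \<in> X \<inter> B i"
    "x = finsum M f F"
    unfolding obj_part_def internal_sum_def sub_grading_def by blast
  have 1: "x \<in> X" unfolding F(4)
    using F by (intro finsum_in_subgroup[OF gsubD(2)[OF X]]) auto
  have "pr g x = (if g \<in> F then f g else \<zero>)" for g
    unfolding F(4) using F by (intro component_finsum) auto
  then show "x \<in> X \<and> (\<forall>g\<in>arr \<Gamma>. p g \<noteq> e \<longrightarrow> pr g x = \<zero>)"
    using 1 F(2) by auto
next
  assume x: "x \<in> X \<and> (\<forall>g\<in>arr \<Gamma>. p g \<noteq> e \<longrightarrow> pr g x = \<zero>)"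
  then have xM: "x \<in> carrier M" using gsubD(3)[OF X] by auto
  obtain F f where F: "finite F" "F \<subseteq> arr \<Gamma>" "\<forall>j\<in>F. f j \<in> B j" "x = finsum M f F"
      "\<And>j. pr j x = (if j \<in> F then f j else \<zero>)"
    using obtain_decomposition[OF xM] by metis
  let ?F = "{g \<in> F. p g = e}"
  have "finsum M f ?F = finsum M f F"
    using F x part_closed
    by (intro add.finprod_mono_neutral_cong_left) (auto simp: subset_iff)
  moreover have "\<forall>g\<in>?F. f g \<in> X \<inter> B g"
    using F(2,3,5) gsubD(8)[OF X] x by (metis (no_types, lifting) IntI mem_Collect_eq subsetD)
  ultimately show "x \<in> obj_part \<Gamma> p M (sub_grading X B) e"
    unfolding obj_part_def internal_sum_def sub_grading_def
    using F by (intro CollectI exI[of _ f] exI[of _ ?F]) auto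
qed

lemma obj_mem: "x \<in> obj e \<longleftrightarrow> x \<in> carrier M \<and> (\<forall>g\<in>arr \<Gamma>. p g \<noteq> e \<longrightarrow> pr g x = \<zero>)"
proof -
  have "internal_sum M {g \<in> arr \<Gamma>. p g = e} (sub_grading (carrier M) B)
      = internal_sum M {g \<in> arr \<Gamma>. p g = e} B"
    unfolding internal_sum_def sub_grading_def
    by (intro Collect_cong ex_cong1) (use part_closed in \<open>auto simp: subset_iff\<close>)
  then show ?thesis
    using obj_part_mem[OF gsub_carrier, of x e] by (simp add: obj_part_def)
qed

lemma obj_part_sub: "gsub X \<Longrightarrow> obj_part \<Gamma> p M (sub_grading X B) e = X \<inter> obj e"
  using obj_part_mem obj_mem gsubD(3) by blast

text \<open>For \<open>Y e \<subseteq> obj e\<close> this is the direct sum of the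
  \<open>Y e\<close> over all objects; testing components avoids sums over a possibly infinite
  family.\<close>

definition glue :: "('g \<Rightarrow> 'm set) \<Rightarrow> 'm set" where
  "glue Y = {m \<in> carrier M. \<forall>g\<in>arr \<Gamma>. pr g m \<in> Y (p g)}"

text \<open>A multiple of a homogeneous \<open>b\<close> of degree \<open>s\<close> has nonzero
  components only in degrees \<open>g\<close> with \<open>p g = p s\<close>, so it is tested only
  against the submodule \<open>Y (p s)\<close>, which contains \<open>b\<close>.\<close>

lemma gsub_glue:
  assumes Y: "\<And>e. e \<in> ids \<Gamma> \<Longrightarrow> gsub (Y e)"
  shows "gsub (glue Y)"
proof (rule gsubI)
  have Y': "gsub (Y (p g))" if "g \<in> arr \<Gamma>" for g
    using Y object_id that by blast
  note Yg = gsubD[OF Y']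
  show "gr_subgroup (glue Y)"
    unfolding graded_subgroup_def additive_subgroup_iff
  proof (intro conjI ballI)
    fix x y assume "x \<in> glue Y" "y \<in> glue Y"
    then show "x \<oplus> y \<in> glue Y" using Yg(5) by (simp add: glue_def component_add)
  next
    fix x i assume "x \<in> glue Y" "i \<in> arr \<Gamma>"
    then show "pr i x \<in> glue Y"
      using Yg(4) component_closed by (auto simp: glue_def component_idem)
  qed (use Yg(4,6) in \<open>auto simp: glue_def component_zero component_minus\<close>)
next
  fix a s b assume *: "a \<in> carrier R" "s \<in> arr \<Gamma>" "b \<in> B s" "b \<in> glue Y"
  have b: "b \<in> Y (p s)" "b \<in> carrier M"
    using * component_part[of s b s] by (auto simp: glue_def)
  have "gsub (Y (p s))" using Y object_id * by blast
  then have "a \<odot> b \<in> Y (p s)" using b * gsubD(9) by blast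
  then have "pr g (a \<odot> b) \<in> Y (p g)" if "g \<in> arr \<Gamma>" for g
  proof (cases "p g = p s")
    case True
    then show ?thesis
      using gsubD(8)[OF \<open>gsub (Y (p s))\<close> \<open>a \<odot> b \<in> Y (p s)\<close> that] by simp
  next
    case False
    then show ?thesis
      using action_object[OF *(1-3) that] gsubD(4)[OF Y[OF object_id[OF that]]] by simp
  qed
  then show "a \<odot> b \<in> glue Y" using * b action_closed by (simp add: glue_def)
qed

lemma gsub_obj: "gsub (obj e)"
proof -
  have "obj e = glue (\<lambda>e'. if e' = e then carrier M else {\<zero>})"
    using component_closed by (auto simp: glue_def obj_mem)
  then show ?thesis using gsub_glue gsub_carrier gsub_zero by simp
qed

lemma glue_obj:
  assumes Y: "\<And>e. e \<in> ids \<Gamma> \<Longrightarrow> gsub (Y e)" "\<And>e. e \<in> ids \<Gamma> \<Longrightarrow> Y e \<subseteq> obj e" and e: "e \<in> ids \<Gamma>"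
  shows "glue Y \<inter> obj e = Y e"
proof
  show "glue Y \<inter> obj e \<subseteq> Y e"
  proof
    fix x assume x: "x \<in> glue Y \<inter> obj e"
    have "pr g x \<in> Y e" if "g \<in> arr \<Gamma>" for g
      using x that gsubD(4)[OF Y(1)[OF e]] by (cases "p g = e") (auto simp: glue_def obj_mem)
    moreover have "x \<in> carrier M" using x by (simp add: glue_def)
    ultimately show "x \<in> Y e" using mem_subgroupI[OF gsubD(2)[OF Y(1)[OF e]]] by blast
  qed
  show "Y e \<subseteq> glue Y \<inter> obj e"
  proof
    fix x assume x: "x \<in> Y e"
    then have xo: "x \<in> obj e" using Y(2)[OF e] by auto
    have "pr g x \<in> Y (p g)" if g: "g \<in> arr \<Gamma>" for g
    proof (cases "p g = e")
      case True
      then show ?thesis using gsubD(8)[OF Y(1)[OF e] x g] by simp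
    next
      case False
      then show ?thesis using xo g gsubD(4)[OF Y(1)[OF object_id[OF g]]] by (simp add: obj_mem)
    qed
    then show "x \<in> glue Y \<inter> obj e" using xo by (simp add: glue_def obj_mem)
  qed
qed

text \<open>Each homogeneous component lies in a single object part, so a graded submodule is
  determined by its intersections with the object parts.\<close>

lemma eq_if_obj_eq:
  assumes X: "gsub X" "gsub X'" and eq: "\<And>e. e \<in> ids \<Gamma> \<Longrightarrow> X \<inter> obj e = X' \<inter> obj e"
  shows "X = X'"
proof -
  have sub: "Z \<subseteq> Z'" if Z: "gsub Z" "gsub Z'" "\<And>e. e \<in> ids \<Gamma> \<Longrightarrow> Z \<inter> obj e = Z' \<inter> obj e" for Z Z'
  proof
    fix x assume x: "x \<in> Z"
    then have xM: "x \<in> carrier M" using gsubD(3)[OF Z(1)] by auto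
    have "pr g x \<in> Z'" if g: "g \<in> arr \<Gamma>" for g
    proof -
      have "pr g x \<in> obj (p g)"
        using xM g component_closed by (auto simp: obj_mem component_idem)
      then show ?thesis
        using gsubD(8)[OF Z(1) x g] Z(3)[OF object_id[OF g]] by blast
    qed
    then show "x \<in> Z'" by (intro mem_subgroupI[OF gsubD(2)[OF Z(2)] xM])
  qed
  show ?thesis using sub[OF X] sub[OF X(2,1)] eq by blast
qed

lemma obj_inter: "e \<noteq> e' \<Longrightarrow> obj e \<inter> obj e' = {\<zero>}"
proof -
  assume "e \<noteq> e'"
  have "x = \<zero>" if "x \<in> obj e" "x \<in> obj e'" for x
  proof -
    have "x \<in> carrier M" using that by (simp add: obj_mem)
    have "pr g x \<in> {\<zero>}" if "g \<in> arr \<Gamma>" for g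
      using \<open>x \<in> obj e\<close> \<open>x \<in> obj e'\<close> \<open>e \<noteq> e'\<close> that by (auto simp: obj_mem)
    then show ?thesis
      using mem_subgroupI[OF gsubD(2)[OF gsub_zero] \<open>x \<in> carrier M\<close>] by auto
  qed
  then show ?thesis using gsubD(4)[OF gsub_obj] by auto
qed

lemma obj_stable_iff:
  assumes "\<And>i. gsub (C i)"
  shows "obj_stable \<Gamma> p M B C \<longleftrightarrow> (\<forall>e\<in>ids \<Gamma>. \<forall>i. C i \<inter> obj e = C (Suc i) \<inter> obj e \<longrightarrow>
    (\<forall>l\<ge>1. C i \<inter> obj e = C (i + l) \<inter> obj e))"
  unfolding obj_stable_def using obj_part_sub[OF assms] by simp

text \<open>At \<open>e\<close> consecutive members always differ, and at every other object all
  parts are zero. Hence the strong chain conditions imply the ordinary ones on each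
  \<open>obj e\<close>.\<close>

lemma obj_stable_within_obj:
  assumes C: "\<And>i. gsub (C i)" "\<And>i. C i \<subseteq> obj e" "\<And>i. C i \<noteq> C (Suc i)"
  shows "obj_stable \<Gamma> p M B C"
  unfolding obj_stable_iff[OF C(1)]
proof (intro ballI allI impI)
  fix e' i and l :: nat assume eq: "C i \<inter> obj e' = C (Suc i) \<inter> obj e'"
  then have "e' \<noteq> e" using C(2)[of i] C(2)[of "Suc i"] C(3)[of i] by auto
  then have "C j \<inter> obj e' = {\<zero>}" for j
    using obj_inter[of e e'] C(2)[of j] gsubD(4)[OF C(1)[of j]] gsubD(4)[OF gsub_obj[of e']] by auto
  then show "C i \<inter> obj e' = C (i + l) \<inter> obj e'" by simp
qed

text \<open>A part that stops never moves again, so a part that still moves at step \<open>n\<close>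
  has moved at every earlier step. It thus goes through \<open>n + 1\<close> strict steps, which is
  compared with its length.\<close>

lemma stable_chain_strict:
  assumes C: "\<And>i. gsub (C i)" "obj_stable \<Gamma> p M B C"
    and e: "e \<in> ids \<Gamma>" and neq: "C n \<inter> obj e \<noteq> C (Suc n) \<inter> obj e" and i: "i \<le> n"
  shows "C i \<inter> obj e \<noteq> C (Suc i) \<inter> obj e"
proof
  assume eq: "C i \<inter> obj e = C (Suc i) \<inter> obj e"
  then have st: "\<forall>l\<ge>1. C i \<inter> obj e = C (i + l) \<inter> obj e"
    using C e unfolding obj_stable_iff[OF C(1)] by blast
  have "C i \<inter> obj e = C (i + (n - i)) \<inter> obj e"
    using st[rule_format, of "n - i"] i by (cases "n = i") auto
  moreover have "C i \<inter> obj e = C (i + (Suc n - i)) \<inter> obj e"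
    using st[rule_format, of "Suc n - i"] i by simp
  ultimately show False using neq i by simp
qed

end

locale semiartinian_object_action =
  semiartinian_action \<Gamma> R M B + object_action \<Gamma> R M B p
  for \<Gamma> :: "('g, 'x) gpd_scheme" and R :: "('a, 'y) ring_scheme"
    and M :: "('a, 'm, 'z) module_scheme" (structure) and B :: "'g \<Rightarrow> 'm set"
    and p :: "'g \<Rightarrow> 'g"
begin

lemma object_chain_conditions_equivalent:
  "Gamma0_noetherian \<Gamma> p R M B \<longleftrightarrow> Gamma0_artinian \<Gamma> p R M B"
  "Gamma0_artinian \<Gamma> p R M B \<longleftrightarrow> Gamma0_finite_gr_length \<Gamma> p R M B"
  unfolding Gamma0_noetherian_def Gamma0_artinian_def Gamma0_finite_gr_length_def
    gr_noetherian_restrict[OF gsub_obj] gr_artinian_restrict[OF gsub_obj]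
    finite_gr_length_def has_gr_length_restrict[OF gsub_obj]
  using length_iff_artinian[OF gsub_obj] length_iff_noetherian[OF gsub_obj] by auto

abbreviation "bounded_length \<equiv> \<exists>n. \<forall>e\<in>ids \<Gamma>. \<exists>l<n. length_is (obj e) l"

lemma bounded_length_imp_strongly_artinian:
  assumes bounded_length
  shows "strongly_Gamma0_artinian \<Gamma> p R M B"
  unfolding strongly_Gamma0_artinian_def
proof
  obtain n where n: "\<forall>e\<in>ids \<Gamma>. \<exists>l<n. length_is (obj e) l" using assms ..
  assume "\<exists>C. (\<forall>i. gsub (C i) \<and> C (Suc i) \<subset> C i) \<and> obj_stable \<Gamma> p M B C"
  then obtain C where C: "\<And>i. gsub (C i)" "\<And>i. C (Suc i) \<subset> C i" "obj_stable \<Gamma> p M B C" by blast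
  \<comment> \<open>A part moving at step \<open>n\<close> would need \<open>n + 1\<close> strict
    steps in a module of length less than \<open>n\<close>. So every part has stopped by step
    \<open>n\<close>, uniformly in \<open>e\<close>, which contradicts strictness of
    \<open>C\<close>.\<close>
  have "C n = C (Suc n)"
  proof (rule eq_if_obj_eq[OF C(1) C(1)], rule ccontr)
    fix e assume e: "e \<in> ids \<Gamma>" and neq: "C n \<inter> obj e \<noteq> C (Suc n) \<inter> obj e"
    obtain l where l: "l < n" "length_is (obj e) l" using n e by blast
    have "Suc n \<le> l"
    proof (rule length_bound_decreasing[OF l(2)])
      fix i assume "i < Suc n"
      then show "C (Suc i) \<inter> obj e \<subset> C i \<inter> obj e"
        using stable_chain_strict[OF C(1,3) e neq, of i] C(2)[of i] by auto
    qed (use gsub_inter C(1) gsub_obj in auto)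
    then show False using l by simp
  qed
  then show False using C(2)[of n] by simp
qed

lemma bounded_length_imp_strongly_noetherian:
  assumes bounded_length
  shows "strongly_Gamma0_noetherian \<Gamma> p R M B"
  unfolding strongly_Gamma0_noetherian_def
proof
  obtain n where n: "\<forall>e\<in>ids \<Gamma>. \<exists>l<n. length_is (obj e) l" using assms ..
  assume "\<exists>C. (\<forall>i. gsub (C i) \<and> C i \<subset> C (Suc i)) \<and> obj_stable \<Gamma> p M B C"
  then obtain C where C: "\<And>i. gsub (C i)" "\<And>i. C i \<subset> C (Suc i)" "obj_stable \<Gamma> p M B C" by blast
  have "C n = C (Suc n)"
  proof (rule eq_if_obj_eq[OF C(1) C(1)], rule ccontr)
    fix e assume e: "e \<in> ids \<Gamma>" and neq: "C n \<inter> obj e \<noteq> C (Suc n) \<inter> obj e"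
    obtain l where l: "l < n" "length_is (obj e) l" using n e by blast
    have "Suc n \<le> l"
    proof (rule length_bound[OF l(2)])
      fix i assume "i < Suc n"
      then show "C i \<inter> obj e \<subset> C (Suc i) \<inter> obj e"
        using stable_chain_strict[OF C(1,3) e neq, of i] C(2)[of i] by auto
    qed (use gsub_inter C(1) gsub_obj in auto)
    then show False using l by simp
  qed
  then show False using C(2)[of n] by simp
qed

text \<open>One length and one series are chosen for all objects at once. A bound on the chosen
  lengths would contradict \<open>nb\<close>, so for every \<open>n\<close> some object leaves room
  for \<open>n\<close> steps.\<close>

lemma unbounded_composition_series:
  assumes fin: "\<And>e. e \<in> ids \<Gamma> \<Longrightarrow> \<exists>n. length_is (obj e) n" and nb: "\<not> bounded_length"
  obtains l C where
    "\<And>e. e \<in> ids \<Gamma> \<Longrightarrow> C e 0 = {\<zero>} \<and> C e (l e) = obj e \<and> (\<forall>j<l e. covers (C e j) (C e (Suc j)))"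
    "\<And>e j. \<lbrakk>e \<in> ids \<Gamma>; j \<le> l e\<rbrakk> \<Longrightarrow> gsub (C e j) \<and> C e j \<subseteq> obj e"
    "\<And>n. \<exists>e\<in>ids \<Gamma>. n \<le> l e"
proof -
  obtain l where l: "\<And>e. e \<in> ids \<Gamma> \<Longrightarrow> length_is (obj e) (l e)" using fin by metis
  then have "\<forall>e\<in>ids \<Gamma>. \<exists>C. C 0 = {\<zero>} \<and> C (l e) = obj e \<and> (\<forall>j<l e. covers (C j) (C (Suc j)))"
    unfolding length_is_def by blast
  then obtain C where C: "\<forall>e\<in>ids \<Gamma>. C e 0 = {\<zero>} \<and> C e (l e) = obj e \<and>
      (\<forall>j<l e. covers (C e j) (C e (Suc j)))"
    by (rule bchoice[THEN exE])
  show thesis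
  proof (rule that[of C l])
    fix n show "\<exists>e\<in>ids \<Gamma>. n \<le> l e" using nb l by (meson not_less)
  next
    fix e j assume e: "e \<in> ids \<Gamma>" and j: "j \<le> l e"
    have cov: "\<forall>j<l e. covers (C e j) (C e (Suc j))" and 0: "gsub (C e 0)" and "C e (l e) = obj e"
      using C e gsub_zero by auto
    then show "gsub (C e j) \<and> C e j \<subseteq> obj e"
      using chain_gsub[OF 0 cov j] chain_mono[OF cov j] by auto
  qed (use C in blast)
qed

lemma strongly_artinian_imp_bounded_length:
  assumes art: "strongly_Gamma0_artinian \<Gamma> p R M B"
  shows bounded_length
proof (rule ccontr)
  have fin: "\<exists>n. length_is (obj e) n" for e
  proof (rule artinian_imp_length[OF gsub_obj], unfold artinian_on_def, rule notI)
    assume "\<exists>C. \<forall>i. gsub (C i) \<and> C i \<subseteq> obj e \<and> C (Suc i) \<subset> C i"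
    then obtain C where C: "\<And>i. gsub (C i)" "\<And>i. C i \<subseteq> obj e" "\<And>i. C (Suc i) \<subset> C i" by blast
    have "C i \<noteq> C (Suc i)" for i using C(3)[of i] by auto
    then have "obj_stable \<Gamma> p M B C" by (rule obj_stable_within_obj[OF C(1,2)])
    then show False using art C(1,3) unfolding strongly_Gamma0_artinian_def by blast
  qed
  assume nb: "\<not> bounded_length"
  obtain l C where
    C: "\<And>e. e \<in> ids \<Gamma> \<Longrightarrow> C e 0 = {\<zero>} \<and> C e (l e) = obj e \<and> (\<forall>j<l e. covers (C e j) (C e (Suc j)))"
    and gC: "\<And>e j. \<lbrakk>e \<in> ids \<Gamma>; j \<le> l e\<rbrakk> \<Longrightarrow> gsub (C e j) \<and> C e j \<subseteq> obj e"
    and ub: "\<And>n. \<exists>e\<in>ids \<Gamma>. n \<le> l e"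
    using unbounded_composition_series[OF fin nb] by metis
  \<comment> \<open>Subtraction of natural numbers stops at 0: the part at \<open>e\<close> loses
    one factor per step and stays \<open>{\<zero>}\<close> from \<open>i = l e\<close> on, which is
    stability. Any object with \<open>l e > i\<close> makes step \<open>i\<close> strict.\<close>
  define X where "X i = glue (\<lambda>e. C e (l e - i))" for i
  have gX: "gsub (X i)" for i
    unfolding X_def using gC by (intro gsub_glue) auto
  have oX: "X i \<inter> obj e = C e (l e - i)" if "e \<in> ids \<Gamma>" for i e
    unfolding X_def using gC that by (intro glue_obj) auto
  have neq: "C e (l e - i) \<noteq> C e (l e - Suc i)" if "e \<in> ids \<Gamma>" "i < l e" for i e
  proof -
    have "covers (C e (l e - Suc i)) (C e (Suc (l e - Suc i)))"
      using C[OF that(1)] that(2) by auto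
    moreover have "Suc (l e - Suc i) = l e - i" using that(2) by simp
    ultimately show ?thesis unfolding covers_def by auto
  qed
  have "X (Suc i) \<subset> X i" for i
  proof
    have "C e (l e - Suc i) \<subseteq> C e (l e - i)" if "e \<in> ids \<Gamma>" for e
      using C[OF that] by (intro chain_mono[of "l e"]) auto
    then show "X (Suc i) \<subseteq> X i"
      using object_id unfolding X_def glue_def by blast
    obtain e where "e \<in> ids \<Gamma>" "Suc i \<le> l e" using ub by blast
    then show "X (Suc i) \<noteq> X i"
      using oX[of e i] oX[of e "Suc i"] neq[of e i] by auto
  qed
  moreover have "obj_stable \<Gamma> p M B X"
    unfolding obj_stable_iff[OF gX]
  proof (intro ballI allI impI)
    fix e i and k :: nat assume e: "e \<in> ids \<Gamma>" and eq: "X i \<inter> obj e = X (Suc i) \<inter> obj e"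
    then have "\<not> i < l e" using oX[OF e, of i] oX[OF e, of "Suc i"] neq[OF e, of i] by metis
    then show "X i \<inter> obj e = X (i + k) \<inter> obj e" using oX[OF e] by simp
  qed
  ultimately show False
    using art gX unfolding strongly_Gamma0_artinian_def by blast
qed

lemma strongly_noetherian_imp_bounded_length:
  assumes noe: "strongly_Gamma0_noetherian \<Gamma> p R M B"
  shows bounded_length
proof (rule ccontr)
  have fin: "\<exists>n. length_is (obj e) n" for e
  proof (rule noetherian_imp_length[OF gsub_obj], unfold noetherian_on_def, rule notI)
    assume "\<exists>C. \<forall>i. gsub (C i) \<and> C i \<subseteq> obj e \<and> C i \<subset> C (Suc i)"
    then obtain C where C: "\<And>i. gsub (C i)" "\<And>i. C i \<subseteq> obj e" "\<And>i. C i \<subset> C (Suc i)" by blast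
    have "C i \<noteq> C (Suc i)" for i using C(3)[of i] by auto
    then have "obj_stable \<Gamma> p M B C" by (rule obj_stable_within_obj[OF C(1,2)])
    then show False using noe C(1,3) unfolding strongly_Gamma0_noetherian_def by blast
  qed
  assume nb: "\<not> bounded_length"
  obtain l C where
    C: "\<And>e. e \<in> ids \<Gamma> \<Longrightarrow> C e 0 = {\<zero>} \<and> C e (l e) = obj e \<and> (\<forall>j<l e. covers (C e j) (C e (Suc j)))"
    and gC: "\<And>e j. \<lbrakk>e \<in> ids \<Gamma>; j \<le> l e\<rbrakk> \<Longrightarrow> gsub (C e j) \<and> C e j \<subseteq> obj e"
    and ub: "\<And>n. \<exists>e\<in>ids \<Gamma>. n \<le> l e"
    using unbounded_composition_series[OF fin nb] by metis
  \<comment> \<open>The minimum lets the part at \<open>e\<close> climb one factor per step and rest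
    at \<open>obj e\<close> once the top is reached.\<close>
  define X where "X i = glue (\<lambda>e. C e (min i (l e)))" for i
  have gX: "gsub (X i)" for i
    unfolding X_def using gC by (intro gsub_glue) auto
  have oX: "X i \<inter> obj e = C e (min i (l e))" if "e \<in> ids \<Gamma>" for i e
    unfolding X_def using gC that by (intro glue_obj) auto
  have neq: "C e (min i (l e)) \<noteq> C e (min (Suc i) (l e))" if "e \<in> ids \<Gamma>" "i < l e" for i e
  proof -
    have "min i (l e) = i" "min (Suc i) (l e) = Suc i" using that(2) by auto
    then show ?thesis using C[OF that(1)] that(2) unfolding covers_def by auto
  qed
  have "X i \<subset> X (Suc i)" for i
  proof
    have "C e (min i (l e)) \<subseteq> C e (min (Suc i) (l e))" if "e \<in> ids \<Gamma>" for e
      using C[OF that] by (intro chain_mono[of "l e"]) auto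
    then show "X i \<subseteq> X (Suc i)"
      using object_id unfolding X_def glue_def by blast
    obtain e where "e \<in> ids \<Gamma>" "Suc i \<le> l e" using ub by blast
    then show "X i \<noteq> X (Suc i)"
      using oX[of e i] oX[of e "Suc i"] neq[of e i] by auto
  qed
  moreover have "obj_stable \<Gamma> p M B X"
    unfolding obj_stable_iff[OF gX]
  proof (intro ballI allI impI)
    fix e i and k :: nat assume e: "e \<in> ids \<Gamma>" and eq: "X i \<inter> obj e = X (Suc i) \<inter> obj e"
    then have "\<not> i < l e" using oX[OF e, of i] oX[OF e, of "Suc i"] neq[OF e, of i] by metis
    then show "X i \<inter> obj e = X (i + k) \<inter> obj e" using oX[OF e] by simp
  qed
  ultimately show False
    using noe gX unfolding strongly_Gamma0_noetherian_def by blast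
qed

lemma strong_chain_conditions_equivalent:
  "strongly_Gamma0_noetherian \<Gamma> p R M B \<longleftrightarrow> strongly_Gamma0_artinian \<Gamma> p R M B"
  "strongly_Gamma0_artinian \<Gamma> p R M B \<longleftrightarrow> strongly_Gamma0_finite_gr_length \<Gamma> p R M B"
proof -
  have "strongly_Gamma0_finite_gr_length \<Gamma> p R M B \<longleftrightarrow> bounded_length"
    unfolding strongly_Gamma0_finite_gr_length_def has_gr_length_restrict[OF gsub_obj] ..
  then show "strongly_Gamma0_noetherian \<Gamma> p R M B \<longleftrightarrow> strongly_Gamma0_artinian \<Gamma> p R M B"
    "strongly_Gamma0_artinian \<Gamma> p R M B \<longleftrightarrow> strongly_Gamma0_finite_gr_length \<Gamma> p R M B"
    using bounded_length_imp_strongly_artinian bounded_length_imp_strongly_noetherian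
      strongly_artinian_imp_bounded_length strongly_noetherian_imp_bounded_length by blast+
qed

end

section \<open>Right modules\<close>

context groupoid
begin

text \<open>With \<open>g\<close> fixed, distinct composable \<open>h\<close> give distinct degrees.
  So the products of a homogeneous element with the different components of a scalar do not
  collide.\<close>

lemma cmp_left_cancel:
  assumes "g \<in> arr \<Gamma>" "h \<in> arr \<Gamma>" "k \<in> arr \<Gamma>" "src \<Gamma> g = tgt \<Gamma> h" "src \<Gamma> g = tgt \<Gamma> k"
    "cmp \<Gamma> g h = cmp \<Gamma> g k"
  shows "h = k"
proof -
  obtain g' where g': "g' \<in> arr \<Gamma>" "src \<Gamma> g' = tgt \<Gamma> g" "cmp \<Gamma> g' g = src \<Gamma> g"
    using invertible[OF assms(1)] by blast
  have "cmp \<Gamma> g' (cmp \<Gamma> g x) = x" if "x \<in> arr \<Gamma>" "src \<Gamma> g = tgt \<Gamma> x" for x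
    using cmp_assoc[OF g'(1) assms(1) that(1) g'(2) that(2)] g'(3) tgt_cmp_self[OF that(1)] that(2)
    by simp
  then show ?thesis using assms by metis
qed

lemma cmp_left_solve:
  assumes "g \<in> arr \<Gamma>" "k \<in> arr \<Gamma>" "tgt \<Gamma> g = tgt \<Gamma> k"
  shows "\<exists>h\<in>arr \<Gamma>. src \<Gamma> g = tgt \<Gamma> h \<and> cmp \<Gamma> g h = k"
proof -
  obtain g' where g': "g' \<in> arr \<Gamma>" "src \<Gamma> g' = tgt \<Gamma> g" "tgt \<Gamma> g' = src \<Gamma> g"
    "cmp \<Gamma> g g' = tgt \<Gamma> g"
    using invertible[OF assms(1)] by blast
  then have "cmp \<Gamma> g (cmp \<Gamma> g' k) = k"
    using cmp_assoc[OF assms(1) g'(1) assms(2)] assms tgt_cmp_self[OF assms(2)] by simp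
  then show ?thesis
    using g' assms by (intro bexI[of _ "cmp \<Gamma> g' k"]) (auto simp: tgt_cmp cmp_closed)
qed

lemma src_ids: "g \<in> arr \<Gamma> \<Longrightarrow> src \<Gamma> g \<in> ids \<Gamma>"
  and tgt_ids: "g \<in> arr \<Gamma> \<Longrightarrow> tgt \<Gamma> g \<in> ids \<Gamma>"
  by (auto simp: ids_def src_closed tgt_closed src_src src_tgt)

end

section \<open>Object identities, null elements and transporters\<close>

sublocale graded_ring \<subseteq> rg: graded_group R "arr \<Gamma>" A
  by unfold_locales (rule ring_decomp)

context graded_ring
begin

lemma obj_one_in: "e \<in> ids \<Gamma> \<Longrightarrow> obj_one R A e \<in> A e"
proof -
  assume "e \<in> ids \<Gamma>"
  then obtain u where u: "is_identity_of R (A e) u" using obj_unital by blast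
  have "v = u" if v: "is_identity_of R (A e) v" for v
  proof -
    have "u \<otimes>\<^bsub>R\<^esub> v = v" "u \<otimes>\<^bsub>R\<^esub> v = u"
      using u v unfolding is_identity_of_def by blast+
    then show ?thesis by simp
  qed
  then have "obj_one R A e = u" unfolding obj_one_def using u by (rule the_equality[rotated])
  then show "obj_one R A e \<in> A e" using u by (simp add: is_identity_of_def)
qed

lemma obj_one_closed: "e \<in> ids \<Gamma> \<Longrightarrow> obj_one R A e \<in> carrier R"
  using obj_one_in rg.part_closed by (auto simp: ids_def)

lemma l_null_mult: "x \<in> carrier R \<Longrightarrow> \<zero>\<^bsub>R\<^esub> \<otimes>\<^bsub>R\<^esub> x = \<zero>\<^bsub>R\<^esub>"
  using distr_right[of "\<zero>\<^bsub>R\<^esub>" "\<zero>\<^bsub>R\<^esub>" x] mult_closed[of "\<zero>\<^bsub>R\<^esub>" x]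
  by (metis add.l_cancel_one' l_zero zero_closed)

lemma r_null_mult: "x \<in> carrier R \<Longrightarrow> x \<otimes>\<^bsub>R\<^esub> \<zero>\<^bsub>R\<^esub> = \<zero>\<^bsub>R\<^esub>"
  using distr_left[of x "\<zero>\<^bsub>R\<^esub>" "\<zero>\<^bsub>R\<^esub>"] mult_closed[of x "\<zero>\<^bsub>R\<^esub>"]
  by (metis add.l_cancel_one' l_zero zero_closed)

lemma r_minus_mult:
  assumes "x \<in> carrier R" "y \<in> carrier R"
  shows "x \<otimes>\<^bsub>R\<^esub> (\<ominus>\<^bsub>R\<^esub> y) = \<ominus>\<^bsub>R\<^esub> (x \<otimes>\<^bsub>R\<^esub> y)"
  using assms distr_left[of x "\<ominus>\<^bsub>R\<^esub> y" y]
  by (intro minus_equality[symmetric]) (auto simp: mult_closed l_neg r_null_mult)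

end

sublocale graded_module_base \<subseteq> mod: graded_action \<Gamma> R M B
  by unfold_locales (auto simp: module_decomp act_closed act_add_module)

context graded_module_base
begin

lemma act_zero_ring: "m \<in> carrier M \<Longrightarrow> \<zero>\<^bsub>R\<^esub> \<odot>\<^bsub>M\<^esub> m = \<zero>\<^bsub>M\<^esub>"
  using act_add_ring[of "\<zero>\<^bsub>R\<^esub>" "\<zero>\<^bsub>R\<^esub>" m] act_closed[of "\<zero>\<^bsub>R\<^esub>" m]
  by (metis M.add.l_cancel_one' l_zero zero_closed)

lemma act_minus_ring:
  assumes "a \<in> carrier R" "m \<in> carrier M"
  shows "(\<ominus>\<^bsub>R\<^esub> a) \<odot>\<^bsub>M\<^esub> m = \<ominus>\<^bsub>M\<^esub> (a \<odot>\<^bsub>M\<^esub> m)"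
  using assms act_add_ring[of "\<ominus>\<^bsub>R\<^esub> a" a m]
  by (intro M.minus_equality[symmetric]) (auto simp: act_closed l_neg act_zero_ring)

text \<open>Being an additive subgroup is what \<open>mem_subgroupI\<close> and
  \<open>minimal_generate\<close> ask for, so membership of \<open>a \<odot> m\<close> in
  \<open>N\<close> can be tested on homogeneous or on minimal scalars.\<close>

lemma transporter_subgroup:
  assumes N: "additive_subgroup N M" and m: "m \<in> carrier M"
  shows "additive_subgroup {a \<in> carrier R. a \<odot>\<^bsub>M\<^esub> m \<in> N} R"
  using M.additive_subgroupD[OF N] m
  by (auto simp: additive_subgroup_iff act_add_ring act_minus_ring act_zero_ring)

lemma cotransporter_subgroup:
  assumes N: "additive_subgroup N M" and S: "S \<subseteq> carrier R"
  shows "additive_subgroup {m \<in> carrier M. \<forall>a\<in>S. a \<odot>\<^bsub>M\<^esub> m \<in> N} M"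
proof -
  have "a \<odot>\<^bsub>M\<^esub> (\<ominus>\<^bsub>M\<^esub> m) = \<ominus>\<^bsub>M\<^esub> (a \<odot>\<^bsub>M\<^esub> m)" if "a \<in> S" "m \<in> carrier M" for a m
    using that S act_add_module[of a "\<ominus>\<^bsub>M\<^esub> m" m] mod.action_zero[of a]
    by (intro M.minus_equality[symmetric]) (auto simp: act_closed M.l_neg subset_iff)
  then show ?thesis
    using M.additive_subgroupD[OF N] S
    by (auto simp: M.additive_subgroup_iff act_add_module mod.action_zero subset_iff)
qed

end

section \<open>Homogeneous products and cyclic submodules\<close>

context graded_right_module
begin

lemma component_act_object:
  assumes a: "a \<in> carrier R" and s: "s \<in> arr \<Gamma>" "m \<in> B s" and g: "g \<in> arr \<Gamma>" "tgt \<Gamma> g \<noteq> tgt \<Gamma> s"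
  shows "mod.pr g (a \<odot>\<^bsub>M\<^esub> m) = \<zero>\<^bsub>M\<^esub>"
  using rg.graded_subgroup_carrier a
proof (induction rule: rg.graded_induct)
  case zero
  then show ?case using act_zero_ring mod.part_closed s mod.component_zero by simp
next
  case (part t a)
  show ?case
  proof (cases "src \<Gamma> s = tgt \<Gamma> t")
    case True
    then have "g \<noteq> cmp \<Gamma> s t" using g s part tgt_cmp by auto
    then show ?thesis
      using mod.component_part[of "cmp \<Gamma> s t" "a \<odot>\<^bsub>M\<^esub> m" g] True s part cmp_closed right_graded
      by simp
  next
    case False
    then show ?thesis
      using right_graded_zero[of s t m a] s part mod.component_zero by simp
  qed
next
  case (add x y)
  then show ?case
    using s mod.part_closed by (simp add: act_add_ring mod.component_add act_closed)
qed

text \<open>For \<open>a\<close> homogeneous of degree \<open>t'\<close> the product is zero or has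
  degree \<open>cmp \<Gamma> s t'\<close>, and cancellation makes this equal to
  \<open>cmp \<Gamma> s t\<close> only for \<open>t' = t\<close>. Additivity gives the general
  case.\<close>

lemma component_act:
  assumes a: "a \<in> carrier R" and s: "s \<in> arr \<Gamma>" "m \<in> B s"
    and t: "t \<in> arr \<Gamma>" "src \<Gamma> s = tgt \<Gamma> t"
  shows "mod.pr (cmp \<Gamma> s t) (a \<odot>\<^bsub>M\<^esub> m) = rg.pr t a \<odot>\<^bsub>M\<^esub> m"
  using rg.graded_subgroup_carrier a
proof (induction rule: rg.graded_induct)
  case zero
  then show ?case
    using act_zero_ring mod.part_closed s mod.component_zero rg.component_zero by simp
next
  case (part t' a)
  have m: "m \<in> carrier M" using s mod.part_closed by simp
  show ?case
  proof (cases "src \<Gamma> s = tgt \<Gamma> t'")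
    case True
    then have "t = t' \<longleftrightarrow> cmp \<Gamma> s t = cmp \<Gamma> s t'" using cmp_left_cancel s t part by metis
    then show ?thesis
      using mod.component_part[of "cmp \<Gamma> s t'" "a \<odot>\<^bsub>M\<^esub> m" "cmp \<Gamma> s t"] True s part cmp_closed
        right_graded rg.component_part[of t' a t] act_zero_ring[OF m]
      by simp
  next
    case False
    then have "t \<noteq> t'" using t by auto
    then show ?thesis
      using False right_graded_zero[of s t' m a] s part mod.component_zero
        rg.component_part[of t' a t] act_zero_ring[OF m] by simp
  qed
next
  case (add x y)
  then show ?case
    using s t mod.part_closed rg.component_closed
    by (simp add: act_add_ring mod.component_add rg.component_add act_closed)
qed

text \<open>A degree \<open>g\<close> with the target of \<open>s\<close> is solved for
  \<open>t\<close>. For any other \<open>g\<close> the component vanishes, and the zero element of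
  \<open>A g\<close> serves as \<open>x\<close>.\<close>

lemma component_act_ex:
  assumes a: "a \<in> carrier R" and s: "s \<in> arr \<Gamma>" "m \<in> B s" and g: "g \<in> arr \<Gamma>"
  shows "\<exists>t\<in>arr \<Gamma>. \<exists>x\<in>A t. mod.pr g (a \<odot>\<^bsub>M\<^esub> m) = x \<odot>\<^bsub>M\<^esub> m"
proof (cases "tgt \<Gamma> g = tgt \<Gamma> s")
  case True
  then obtain t where "t \<in> arr \<Gamma>" "src \<Gamma> s = tgt \<Gamma> t" "cmp \<Gamma> s t = g"
    using cmp_left_solve s(1) g by metis
  then show ?thesis using component_act[OF a s] rg.component_in a by metis
next
  case False
  have "mod.pr g (a \<odot>\<^bsub>M\<^esub> m) = \<zero>\<^bsub>R\<^esub> \<odot>\<^bsub>M\<^esub> m"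
    using component_act_object[OF a s g False] act_zero_ring mod.part_closed s by simp
  then show ?thesis using g rg.zero_in_part by metis
qed

definition cyclic where
  "cyclic m = (\<lambda>a. a \<odot>\<^bsub>M\<^esub> m) ` carrier R"

text \<open>Homogeneity of \<open>m\<close> makes this submodule graded: by
  \<open>component_act_ex\<close> the components of a multiple of \<open>m\<close> are multiples of
  \<open>m\<close>.\<close>

lemma gsub_cyclic:
  assumes s: "s \<in> arr \<Gamma>" "m \<in> B s"
  shows "mod.gsub (cyclic m)"
  unfolding mod.graded_submodule_iff graded_subgroup_def M.additive_subgroup_iff
proof (intro conjI ballI subsetI)
  have m: "m \<in> carrier M" using s mod.part_closed by simp
  show "x \<in> carrier M" if "x \<in> cyclic m" for x using that m act_closed by (auto simp: cyclic_def)
  show "\<zero>\<^bsub>M\<^esub> \<in> cyclic m" unfolding cyclic_def by (metis act_zero_ring imageI m zero_closed)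
  show "x \<oplus>\<^bsub>M\<^esub> y \<in> cyclic m" if xy: "x \<in> cyclic m" "y \<in> cyclic m" for x y
  proof -
    obtain a b where ab: "a \<in> carrier R" "b \<in> carrier R" "x = a \<odot>\<^bsub>M\<^esub> m" "y = b \<odot>\<^bsub>M\<^esub> m"
      using xy unfolding cyclic_def by blast
    then have "x \<oplus>\<^bsub>M\<^esub> y = (a \<oplus>\<^bsub>R\<^esub> b) \<odot>\<^bsub>M\<^esub> m" using m act_add_ring by simp
    then show ?thesis unfolding cyclic_def using ab by blast
  qed
  show "\<ominus>\<^bsub>M\<^esub> x \<in> cyclic m" if x: "x \<in> cyclic m" for x
  proof -
    obtain a where a: "a \<in> carrier R" "x = a \<odot>\<^bsub>M\<^esub> m" using x unfolding cyclic_def by blast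
    then have "\<ominus>\<^bsub>M\<^esub> x = (\<ominus>\<^bsub>R\<^esub> a) \<odot>\<^bsub>M\<^esub> m" using m act_minus_ring by simp
    then show ?thesis unfolding cyclic_def using a by blast
  qed
  show "mod.pr g x \<in> cyclic m" if x: "x \<in> cyclic m" and g: "g \<in> arr \<Gamma>" for x g
    using x component_act_ex[OF _ s g] rg.part_closed unfolding cyclic_def by blast
  show "a \<odot>\<^bsub>M\<^esub> x \<in> cyclic m" if a: "a \<in> carrier R" and x: "x \<in> cyclic m" for a x
  proof -
    obtain b where b: "b \<in> carrier R" "x = b \<odot>\<^bsub>M\<^esub> m" using x unfolding cyclic_def by blast
    then have "a \<odot>\<^bsub>M\<^esub> x = (b \<otimes>\<^bsub>R\<^esub> a) \<odot>\<^bsub>M\<^esub> m" using right_act_assoc a m by simp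
    then show ?thesis unfolding cyclic_def using a b mult_closed by blast
  qed
qed

lemma cyclic_self: "\<lbrakk>s \<in> arr \<Gamma>; m \<in> B s\<rbrakk> \<Longrightarrow> m \<in> cyclic m"
  unfolding cyclic_def using right_unital obj_one_closed src_ids by (metis imageI)

lemma cyclic_least: "\<lbrakk>mod.gsub N; m \<in> N\<rbrakk> \<Longrightarrow> cyclic m \<subseteq> N"
  unfolding cyclic_def using mod.gsubD(9) by blast

lemma homogeneous_witness:
  assumes "mod.gsub N" "mod.gsub D" "\<not> D \<subseteq> N"
  obtains s q where "s \<in> arr \<Gamma>" "q \<in> B s" "q \<in> D" "q \<notin> N"
proof -
  obtain x where x: "x \<in> D" "x \<notin> N" using assms(3) by blast
  then have xM: "x \<in> carrier M" using mod.gsubD(3)[OF assms(2)] by auto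
  then obtain g where "g \<in> arr \<Gamma>" "mod.pr g x \<notin> N"
    using mod.mem_subgroupI[OF mod.gsubD(2)[OF assms(1)] xM] x by blast
  then show thesis
    using that mod.component_in[OF _ xM] mod.gsubD(8)[OF assms(2) x(1)] by blast
qed

end

text \<open>\<open>right_ann R J n\<close> is the set of those \<open>x\<close> with \<open>x J\<^sup>n = 0\<close>. Unlike powers of \<open>J\<close>,
  this makes sense for \<open>n = 0\<close> without an identity, and passing to the opposite ring exchanges it with
  \<open>left_ann\<close> definitionally.\<close>

primrec right_ann :: "('a, 'y) ring_scheme \<Rightarrow> 'a set \<Rightarrow> nat \<Rightarrow> 'a set" where
  "right_ann R J 0 = {\<zero>\<^bsub>R\<^esub>}"
| "right_ann R J (Suc n) = {x \<in> carrier R. \<forall>j\<in>J. x \<otimes>\<^bsub>R\<^esub> j \<in> right_ann R J n}"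

primrec left_ann :: "('a, 'y) ring_scheme \<Rightarrow> 'a set \<Rightarrow> nat \<Rightarrow> 'a set" where
  "left_ann R J 0 = {\<zero>\<^bsub>R\<^esub>}"
| "left_ann R J (Suc n) = {x \<in> carrier R. \<forall>j\<in>J. j \<otimes>\<^bsub>R\<^esub> x \<in> left_ann R J n}"

text \<open>\<open>u\<close> generates a right ideal and a left ideal that are gr-simple or zero modulo \<open>J\<close>.\<close>

definition minimal_mod ::
    "('g, 'x) gpd_scheme \<Rightarrow> ('a, 'y) ring_scheme \<Rightarrow> ('g \<Rightarrow> 'a set) \<Rightarrow> 'a set \<Rightarrow> 'a \<Rightarrow> bool" where
  "minimal_mod \<Gamma> R A J u \<longleftrightarrow>
     (\<forall>t\<in>arr \<Gamma>. \<forall>x\<in>A t. u \<otimes>\<^bsub>R\<^esub> x \<notin> J \<longrightarrow>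
        (\<exists>y\<in>carrier R. (u \<otimes>\<^bsub>R\<^esub> x) \<otimes>\<^bsub>R\<^esub> y \<ominus>\<^bsub>R\<^esub> u \<in> J)) \<and>
     (\<forall>t\<in>arr \<Gamma>. \<forall>x\<in>A t. x \<otimes>\<^bsub>R\<^esub> u \<notin> J \<longrightarrow>
        (\<exists>y\<in>carrier R. y \<otimes>\<^bsub>R\<^esub> (x \<otimes>\<^bsub>R\<^esub> u) \<ominus>\<^bsub>R\<^esub> u \<in> J))"

text \<open>The assumption \<open>minimal_generate\<close> says, without finite sums, that \<open>1\<^sub>e\<close> is modulo \<open>J\<close> a sum of minimal
  elements. All assumptions together are invariant under passing to the opposite ring.\<close>

locale semiprimary_data = graded_ring +
  fixes J
  assumes J_graded: "rg.gr_subgroup J"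
    and J_left: "\<lbrakk>r \<in> carrier R; x \<in> J\<rbrakk> \<Longrightarrow> r \<otimes>\<^bsub>R\<^esub> x \<in> J"
    and J_right: "\<lbrakk>r \<in> carrier R; x \<in> J\<rbrakk> \<Longrightarrow> x \<otimes>\<^bsub>R\<^esub> r \<in> J"
    and minimal_generate:
      "\<lbrakk>e \<in> ids \<Gamma>; additive_subgroup H R; J \<subseteq> H; \<And>u. \<lbrakk>u \<in> A e; minimal_mod \<Gamma> R A J u\<rbrakk> \<Longrightarrow> u \<in> H\<rbrakk>
        \<Longrightarrow> obj_one R A e \<in> H"
    and right_nilpotent: "e \<in> ids \<Gamma> \<Longrightarrow> \<exists>n. obj_one R A e \<in> right_ann R J n"
    and left_nilpotent: "e \<in> ids \<Gamma> \<Longrightarrow> \<exists>n. obj_one R A e \<in> left_ann R J n"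
begin

lemma J_carrier: "J \<subseteq> carrier R"
  using additive_subgroupD(1)[OF rg.graded_subgroupD(1)[OF J_graded]] .

end

section \<open>Atoms above a graded submodule\<close>

locale semiprimary_right_module = graded_right_module \<Gamma> R A M B + semiprimary_data \<Gamma> R A J
  for \<Gamma> :: "('g, 'x) gpd_scheme" and R :: "('a, 'y) ring_scheme" and A :: "'g \<Rightarrow> 'a set"
    and M :: "('a, 'm, 'z) module_scheme" and B :: "'g \<Rightarrow> 'm set" and J :: "'a set"
begin

text \<open>The scalars carrying \<open>q\<close> into \<open>N\<close> form an additive subgroup
  containing \<open>J\<close>. If all minimal \<open>u\<close> of degree
  \<open>e = src \<Gamma> s\<close> belonged to it, so would \<open>1_e\<close>, and
  \<open>q = q 1_e\<close> would lie in \<open>N\<close>.\<close>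

lemma minimal_witness:
  assumes N: "mod.gsub N" and s: "s \<in> arr \<Gamma>" "q \<in> B s" and q: "q \<notin> N" "\<And>j. j \<in> J \<Longrightarrow> j \<odot>\<^bsub>M\<^esub> q \<in> N"
  obtains u where "u \<in> A (src \<Gamma> s)" "minimal_mod \<Gamma> R A J u" "u \<odot>\<^bsub>M\<^esub> q \<notin> N"
proof (rule ccontr)
  note obtained = that
  assume no: "\<not> thesis"
  let ?H = "{a \<in> carrier R. a \<odot>\<^bsub>M\<^esub> q \<in> N}"
  have e: "src \<Gamma> s \<in> ids \<Gamma>" "src \<Gamma> s \<in> arr \<Gamma>" using src_ids src_closed s by auto
  have "additive_subgroup ?H R"
    using transporter_subgroup mod.gsubD(2)[OF N] mod.part_closed s by blast
  moreover have "J \<subseteq> ?H" using J_carrier q(2) by auto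
  moreover have "u \<in> ?H" if "u \<in> A (src \<Gamma> s)" "minimal_mod \<Gamma> R A J u" for u
    using that no obtained[OF that] rg.part_closed[OF e(2)] by blast
  ultimately have "obj_one R A (src \<Gamma> s) \<in> ?H"
    using minimal_generate[OF e(1), of ?H] by blast
  then show False using q(1) right_unital[OF s] by simp
qed

text \<open>For \<open>N \<subset> Q \<subseteq> N + quR\<close>, a homogeneous \<open>z\<close> in
  \<open>Q\<close> outside \<open>N\<close> has the form \<open>n' + qux\<close>. Since
  \<open>qJ \<subseteq> N\<close>, this forces \<open>ux \<notin> J\<close>, so \<open>uxy\<close>
  agrees with \<open>u\<close> modulo \<open>J\<close> for some \<open>y\<close>, and
  \<open>qu\<close> is recovered in \<open>Q\<close> from \<open>zy\<close>.\<close>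

lemma minimal_cover:
  assumes N: "mod.gsub N" and s: "s \<in> arr \<Gamma>" "q \<in> B s" and q: "\<And>j. j \<in> J \<Longrightarrow> j \<odot>\<^bsub>M\<^esub> q \<in> N"
    and u: "u \<in> A (src \<Gamma> s)" "minimal_mod \<Gamma> R A J u" "u \<odot>\<^bsub>M\<^esub> q \<notin> N"
  shows "u \<odot>\<^bsub>M\<^esub> q \<in> B s" "mod.covers N (set_add M N (cyclic (u \<odot>\<^bsub>M\<^esub> q)))"
proof -
  let ?w = "u \<odot>\<^bsub>M\<^esub> q"
  have e: "src \<Gamma> s \<in> arr \<Gamma>" "tgt \<Gamma> (src \<Gamma> s) = src \<Gamma> s" "cmp \<Gamma> s (src \<Gamma> s) = s"
    using src_closed tgt_src cmp_src s by auto
  have uR: "u \<in> carrier R" and qM: "q \<in> carrier M"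
    using rg.part_closed[OF e(1) u(1)] mod.part_closed[OF s] .
  show w: "?w \<in> B s" using right_graded[OF s(1) e(1) _ s(2) u(1)] e by simp
  have wM: "?w \<in> carrier M" using act_closed uR qM by simp
  note cyc = gsub_cyclic[OF s(1) w]
  note sum = mod.gsub_sum[OF N cyc]
  have "?w \<in> set_add M N (cyclic ?w)" using sum(3) cyclic_self[OF s(1) w] by blast
  moreover have "Q = set_add M N (cyclic ?w)"
    if Q: "mod.gsub Q" "N \<subseteq> Q" "Q \<subseteq> set_add M N (cyclic ?w)" "Q \<noteq> N" for Q
  proof -
    obtain g z where z: "g \<in> arr \<Gamma>" "z \<in> B g" "z \<in> Q" "z \<notin> N"
      using homogeneous_witness[OF N Q(1)] Q(2,4) by blast
    obtain n a where na: "n \<in> N" "a \<in> carrier R" "z = n \<oplus>\<^bsub>M\<^esub> a \<odot>\<^bsub>M\<^esub> ?w"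
      using Q(3) z(3) unfolding subset_iff mod.set_add_iff cyclic_def by blast
    have nM: "n \<in> carrier M" using na mod.gsubD(3)[OF N] by auto
    \<comment> \<open>Passing to the component of degree \<open>g\<close> replaces \<open>a\<close>
      by a homogeneous \<open>x\<close>, the only kind of factor that \<open>minimal_mod\<close>
      speaks about.\<close>
    have "z = mod.pr g z" using mod.component_part z by simp
    also have "\<dots> = mod.pr g n \<oplus>\<^bsub>M\<^esub> mod.pr g (a \<odot>\<^bsub>M\<^esub> ?w)"
      using na nM act_closed wM mod.component_add by simp
    finally obtain t x where x: "t \<in> arr \<Gamma>" "x \<in> A t" "z = mod.pr g n \<oplus>\<^bsub>M\<^esub> x \<odot>\<^bsub>M\<^esub> ?w"
      using component_act_ex[OF na(2) s(1) w z(1)] by metis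
    define n' where "n' = mod.pr g n"
    have n': "n' \<in> N" "n' \<in> carrier M" "z = n' \<oplus>\<^bsub>M\<^esub> x \<odot>\<^bsub>M\<^esub> ?w"
      using mod.gsubD(8)[OF N na(1) z(1)] mod.component_closed[OF nM] x(3) n'_def by auto
    have xR: "x \<in> carrier R" using rg.part_closed x by blast
    have uxR: "u \<otimes>\<^bsub>R\<^esub> x \<in> carrier R" using mult_closed uR xR by simp
    have xw: "x \<odot>\<^bsub>M\<^esub> ?w = (u \<otimes>\<^bsub>R\<^esub> x) \<odot>\<^bsub>M\<^esub> q" using right_act_assoc uR xR qM by simp
    have "(u \<otimes>\<^bsub>R\<^esub> x) \<odot>\<^bsub>M\<^esub> q \<notin> N"
      using n' z(4) mod.gsubD(5)[OF N] xw by auto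
    then have "u \<otimes>\<^bsub>R\<^esub> x \<notin> J" using q by blast
    then obtain y where y: "y \<in> carrier R" "(u \<otimes>\<^bsub>R\<^esub> x) \<otimes>\<^bsub>R\<^esub> y \<ominus>\<^bsub>R\<^esub> u \<in> J"
      using u(2) x(1,2) unfolding minimal_mod_def by blast
    define b where "b = (u \<otimes>\<^bsub>R\<^esub> x) \<otimes>\<^bsub>R\<^esub> y"
    have bR: "b \<in> carrier R" unfolding b_def using mult_closed uxR y by simp
    have "(b \<ominus>\<^bsub>R\<^esub> u) \<odot>\<^bsub>M\<^esub> q \<in> Q" using y(2) q Q(2) unfolding b_def by blast
    moreover have "(b \<ominus>\<^bsub>R\<^esub> u) \<odot>\<^bsub>M\<^esub> q = b \<odot>\<^bsub>M\<^esub> q \<ominus>\<^bsub>M\<^esub> ?w"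
      using bR uR qM by (simp add: a_minus_def act_add_ring act_minus_ring)
    moreover have "b \<odot>\<^bsub>M\<^esub> q \<in> Q"
    proof -
      have "y \<odot>\<^bsub>M\<^esub> z = y \<odot>\<^bsub>M\<^esub> n' \<oplus>\<^bsub>M\<^esub> b \<odot>\<^bsub>M\<^esub> q"
        using n' xw y act_closed uxR qM right_act_assoc act_add_module by (simp add: b_def)
      then have "b \<odot>\<^bsub>M\<^esub> q = y \<odot>\<^bsub>M\<^esub> z \<ominus>\<^bsub>M\<^esub> y \<odot>\<^bsub>M\<^esub> n'"
        using n' y act_closed bR qM
        by (simp add: a_minus_def M.a_assoc M.r_neg M.a_comm[of "y \<odot>\<^bsub>M\<^esub> n'"])
      then show ?thesis
        using mod.gsubD(7,9)[OF Q(1)] z(3) n'(1) Q(2) y(1) by (metis subsetD)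
    qed
    ultimately have "b \<odot>\<^bsub>M\<^esub> q \<ominus>\<^bsub>M\<^esub> (b \<odot>\<^bsub>M\<^esub> q \<ominus>\<^bsub>M\<^esub> ?w) \<in> Q"
      using mod.gsubD(7)[OF Q(1)] by metis
    moreover have "b \<odot>\<^bsub>M\<^esub> q \<ominus>\<^bsub>M\<^esub> (b \<odot>\<^bsub>M\<^esub> q \<ominus>\<^bsub>M\<^esub> ?w) = ?w"
      using act_closed[OF bR qM] wM
      by (simp add: a_minus_def M.minus_add M.r_neg M.a_assoc[symmetric])
    ultimately have "?w \<in> Q" by simp
    then have "set_add M N (cyclic ?w) \<subseteq> Q"
      using mod.gsub_sum_least[OF Q(1,2)] cyclic_least[OF Q(1)] by blast
    then show ?thesis using Q(3) by blast
  qed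
  ultimately show "mod.covers N (set_add M N (cyclic ?w))"
    unfolding mod.covers_def using N sum(1,2) u(3) by blast
qed

text \<open>Multiply a homogeneous \<open>p\<close> in \<open>D\<close> outside \<open>N\<close> by
  homogeneous elements of \<open>J\<close> as long as the product stays outside \<open>N\<close>.
  The process ends because \<open>p = p 1_e\<close> and \<open>1_e J^n = 0\<close>.\<close>

lemma socle_witness:
  assumes N: "mod.gsub N" and D: "mod.gsub D" and ND: "N \<subset> D"
  obtains s q where "s \<in> arr \<Gamma>" "q \<in> B s" "q \<in> D" "q \<notin> N" "\<And>j. j \<in> J \<Longrightarrow> j \<odot>\<^bsub>M\<^esub> q \<in> N"
proof -
  obtain s p where p: "s \<in> arr \<Gamma>" "p \<in> B s" "p \<in> D" "p \<notin> N"
    using homogeneous_witness[OF N D] ND by blast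
  have pM: "p \<in> carrier M" using mod.part_closed p by blast
  \<comment> \<open>The induction follows the scalar \<open>x\<close> with \<open>x J^n = 0\<close>,
    starting from \<open>1_e\<close>, since nilpotence is a statement about scalars. Each factor
    from \<open>J\<close> lowers \<open>n\<close>, and \<open>n = 0\<close> is impossible because
    then \<open>x\<close> is zero and \<open>px\<close> lies in \<open>N\<close>.\<close>
  have *: "\<exists>s q. s \<in> arr \<Gamma> \<and> q \<in> B s \<and> q \<in> D \<and> q \<notin> N \<and> (\<forall>j\<in>J. j \<odot>\<^bsub>M\<^esub> q \<in> N)"
    if "x \<in> right_ann R J n" "t \<in> arr \<Gamma>" "x \<in> A t" "x \<odot>\<^bsub>M\<^esub> p \<notin> N" for n t x
    using that
  proof (induction n arbitrary: t x)
    case 0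
    then show ?case using act_zero_ring[OF pM] mod.gsubD(4)[OF N] by simp
  next
    case (Suc n)
    have xR: "x \<in> carrier R" using Suc.prems rg.part_closed by blast
    have st: "src \<Gamma> s = tgt \<Gamma> t"
      using right_graded_zero[OF p(1) Suc.prems(2) _ p(2) Suc.prems(3)] Suc.prems(4) mod.gsubD(4)[OF N]
      by metis
    have xp: "x \<odot>\<^bsub>M\<^esub> p \<in> B (cmp \<Gamma> s t)" "cmp \<Gamma> s t \<in> arr \<Gamma>"
      using right_graded[OF p(1) Suc.prems(2) st p(2) Suc.prems(3)] cmp_closed[OF p(1) Suc.prems(2) st]
      by auto
    show ?case
    proof (cases "\<forall>j\<in>J. j \<odot>\<^bsub>M\<^esub> (x \<odot>\<^bsub>M\<^esub> p) \<in> N")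
      case True
      then show ?thesis using xp Suc.prems(4) mod.gsubD(9)[OF D xR p(3)] by blast
    next
      case False
      then obtain j where j: "j \<in> J" "j \<odot>\<^bsub>M\<^esub> (x \<odot>\<^bsub>M\<^esub> p) \<notin> N" by blast
      have jR: "j \<in> carrier R" using j J_carrier by auto
      have "additive_subgroup {a \<in> carrier R. a \<odot>\<^bsub>M\<^esub> (x \<odot>\<^bsub>M\<^esub> p) \<in> N} R"
        using transporter_subgroup mod.gsubD(2)[OF N] act_closed[OF xR pM] by blast
      from rg.mem_subgroupI[OF this jR] obtain t' where t': "t' \<in> arr \<Gamma>"
          "rg.pr t' j \<odot>\<^bsub>M\<^esub> (x \<odot>\<^bsub>M\<^esub> p) \<notin> N"
        using j(2) rg.component_closed[OF jR] by blast
      let ?j = "rg.pr t' j"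
      have j': "?j \<in> J" "?j \<in> A t'" "?j \<in> carrier R"
        using rg.graded_subgroupD(2)[OF J_graded j(1) t'(1)] rg.component_in[OF t'(1) jR]
          rg.component_closed[OF jR] by auto
      have xjp: "(x \<otimes>\<^bsub>R\<^esub> ?j) \<odot>\<^bsub>M\<^esub> p \<notin> N"
        using t'(2) right_act_assoc[OF xR j'(3) pM] by simp
      have tt': "src \<Gamma> t = tgt \<Gamma> t'"
        using ring_graded_zero[OF Suc.prems(2) t'(1) _ Suc.prems(3) j'(2)] xjp act_zero_ring[OF pM]
          mod.gsubD(4)[OF N] by metis
      show ?thesis
      proof (rule Suc.IH[OF _ _ _ xjp])
        show "x \<otimes>\<^bsub>R\<^esub> ?j \<in> right_ann R J n" using Suc.prems(1) j'(1) by simp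
        show "cmp \<Gamma> t t' \<in> arr \<Gamma>" using cmp_closed Suc.prems(2) t'(1) tt' by simp
        show "x \<otimes>\<^bsub>R\<^esub> ?j \<in> A (cmp \<Gamma> t t')" using ring_graded Suc.prems(2,3) t'(1) tt' j'(2) by simp
      qed
    qed
  qed
  have e: "src \<Gamma> s \<in> ids \<Gamma>" "src \<Gamma> s \<in> arr \<Gamma>" using src_ids src_closed p by auto
  obtain n where "obj_one R A (src \<Gamma> s) \<in> right_ann R J n" using right_nilpotent[OF e(1)] by blast
  from *[OF this e(2) obj_one_in[OF e(1)]] show thesis
    using that right_unital[OF p(1,2)] p(4) by auto
qed

lemma atom_exists:
  assumes "mod.gsub N" "mod.gsub D" "N \<subset> D"
  shows "\<exists>Q. mod.covers N Q \<and> Q \<subseteq> D"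
proof -
  obtain s q where q: "s \<in> arr \<Gamma>" "q \<in> B s" "q \<in> D" "q \<notin> N" "\<And>j. j \<in> J \<Longrightarrow> j \<odot>\<^bsub>M\<^esub> q \<in> N"
    using socle_witness[OF assms] by metis
  obtain u where u: "u \<in> A (src \<Gamma> s)" "minimal_mod \<Gamma> R A J u" "u \<odot>\<^bsub>M\<^esub> q \<notin> N"
    using minimal_witness[OF assms(1) q(1,2,4,5)] by metis
  have "u \<in> carrier R" using u rg.part_closed src_closed q by blast
  then have "set_add M N (cyclic (u \<odot>\<^bsub>M\<^esub> q)) \<subseteq> D"
    using mod.gsub_sum_least[OF assms(2)] cyclic_least[OF assms(2)] mod.gsubD(9)[OF assms(2)] q(3)
      assms(3) by blast
  with minimal_cover(2)[OF assms(1) q(1,2,5) u] show ?thesis by blast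
qed

section \<open>The submodule \<open>QJ\<close> and coatoms\<close>

definition times_J :: "'m set \<Rightarrow> 'm set" where
  "times_J Q = \<Inter>{H. additive_subgroup H M \<and> (\<forall>j\<in>J. \<forall>q\<in>Q. j \<odot>\<^bsub>M\<^esub> q \<in> H)}"

lemma times_J_mem: "\<lbrakk>j \<in> J; q \<in> Q\<rbrakk> \<Longrightarrow> j \<odot>\<^bsub>M\<^esub> q \<in> times_J Q"
  unfolding times_J_def by blast

text \<open>With \<open>QJ\<close> taken as an intersection, this is its induction principle: an
  additive condition is checked on the products alone, without finite sums.\<close>

lemma times_J_least:
  "\<lbrakk>additive_subgroup H M; \<And>j q. \<lbrakk>j \<in> J; q \<in> Q\<rbrakk> \<Longrightarrow> j \<odot>\<^bsub>M\<^esub> q \<in> H\<rbrakk> \<Longrightarrow> times_J Q \<subseteq> H"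
  unfolding times_J_def by blast

lemma times_J_subgroup:
  assumes "mod.gsub Q"
  shows "additive_subgroup (times_J Q) M" "times_J Q \<subseteq> Q"
proof -
  have JQ: "j \<odot>\<^bsub>M\<^esub> q \<in> Q" if "j \<in> J" "q \<in> Q" for j q
    using that mod.gsubD(9)[OF assms] J_carrier by blast
  show "times_J Q \<subseteq> Q"
    by (rule times_J_least[OF mod.gsubD(2)[OF assms]]) (rule JQ)
  then show "additive_subgroup (times_J Q) M"
    using mod.gsubD(3)[OF assms] unfolding M.additive_subgroup_iff times_J_def by blast
qed

text \<open>A component of a product of homogeneous elements is that product or zero; expanding both
  factors gives gradedness. Stability under scalars is \<open>(qj)a = q(ja)\<close> with
  \<open>ja \<in> J\<close>.\<close>

lemma gsub_times_J:
  assumes Q: "mod.gsub Q"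
  shows "mod.gsub (times_J Q)"
proof -
  note sg = times_J_subgroup(1)[OF Q]
  note sgD = M.additive_subgroupD[OF sg]
  have comp: "mod.pr g (j \<odot>\<^bsub>M\<^esub> q) \<in> times_J Q" if g: "g \<in> arr \<Gamma>" and j: "j \<in> J" and q: "q \<in> Q" for g j q
    using J_graded j
  proof (induction rule: rg.graded_induct)
    case zero
    then show ?case
      using q mod.gsubD(3)[OF Q] act_zero_ring mod.component_zero sgD(2) by auto
  next
    case (part t j)
    show ?case
      using mod.gsubD(1)[OF Q] q
    proof (induction rule: mod.graded_induct)
      case zero
      then show ?case
        using part J_carrier mod.action_zero mod.component_zero sgD(2) by auto
    next
      case (part s q)
      show ?case
      proof (cases "src \<Gamma> s = tgt \<Gamma> t")
        case True
        then show ?thesis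
          using mod.component_part[of "cmp \<Gamma> s t" "j \<odot>\<^bsub>M\<^esub> q" g] right_graded[of s t q j] cmp_closed[of s t]
            part \<open>t \<in> arr \<Gamma>\<close> \<open>j \<in> A t\<close> sgD(2) times_J_mem[OF \<open>j \<in> J\<close> part(3)] by auto
      next
        case False
        then show ?thesis
          using right_graded_zero[of s t q j] part \<open>t \<in> arr \<Gamma>\<close> \<open>j \<in> A t\<close> mod.component_zero sgD(2) by simp
      qed
    next
      case (add x y)
      then have "x \<in> carrier M" "y \<in> carrier M" "j \<in> carrier R"
        using mod.gsubD(3)[OF Q] part J_carrier by auto
      then show ?case
        using add sgD(3) by (simp add: act_add_module mod.component_add act_closed)
    qed
  next
    case (add x y)
    then have "x \<in> carrier R" "y \<in> carrier R" "q \<in> carrier M"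
      using mod.gsubD(3)[OF Q] q J_carrier by auto
    then show ?case
      using add sgD(3) by (simp add: act_add_ring mod.component_add act_closed)
  qed
  have "times_J Q \<subseteq> {m \<in> carrier M. \<forall>g\<in>arr \<Gamma>. mod.pr g m \<in> times_J Q}"
  proof (rule times_J_least)
    show "additive_subgroup {m \<in> carrier M. \<forall>g\<in>arr \<Gamma>. mod.pr g m \<in> times_J Q} M"
      using sgD by (auto simp: M.additive_subgroup_iff mod.component_add mod.component_minus
          mod.component_zero)
    show "j \<odot>\<^bsub>M\<^esub> q \<in> {m \<in> carrier M. \<forall>g\<in>arr \<Gamma>. mod.pr g m \<in> times_J Q}"
      if "j \<in> J" "q \<in> Q" for j q
      using comp that act_closed J_carrier mod.gsubD(3)[OF Q] by blast
  qed
  moreover have "times_J Q \<subseteq> {m \<in> carrier M. \<forall>a\<in>carrier R. a \<odot>\<^bsub>M\<^esub> m \<in> times_J Q}"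
  proof (rule times_J_least)
    show "additive_subgroup {m \<in> carrier M. \<forall>a\<in>carrier R. a \<odot>\<^bsub>M\<^esub> m \<in> times_J Q} M"
      by (rule cotransporter_subgroup[OF sg order_refl])
    show "j \<odot>\<^bsub>M\<^esub> q \<in> {m \<in> carrier M. \<forall>a\<in>carrier R. a \<odot>\<^bsub>M\<^esub> m \<in> times_J Q}"
      if jq: "j \<in> J" "q \<in> Q" for j q
    proof -
      have c: "j \<in> carrier R" "q \<in> carrier M" using jq J_carrier mod.gsubD(3)[OF Q] by auto
      have "a \<odot>\<^bsub>M\<^esub> (j \<odot>\<^bsub>M\<^esub> q) \<in> times_J Q" if "a \<in> carrier R" for a
        using right_act_assoc[OF c(1) that c(2)] times_J_mem[OF J_right[OF that jq(1)] jq(2)] by simp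
      then show ?thesis using act_closed c by blast
    qed
  qed
  ultimately show ?thesis
    unfolding mod.graded_submodule_iff graded_subgroup_def using sg by blast
qed

text \<open>If \<open>QJ = Q\<close>, then \<open>Qx\<close> vanishes as soon as all
  \<open>Q(jx)\<close> with \<open>j \<in> J\<close> do, so by induction \<open>Q\<close> is killed
  by every \<open>x\<close> with \<open>J^n x = 0\<close>. For \<open>x = 1_e\<close> this kills a
  nonzero homogeneous \<open>q = q 1_e\<close>.\<close>

lemma times_J_proper:
  assumes Q: "mod.gsub Q" "Q \<noteq> {\<zero>\<^bsub>M\<^esub>}"
  shows "times_J Q \<subset> Q"
proof (rule psubsetI[OF times_J_subgroup(2)[OF Q(1)]], rule notI)
  assume eq: "times_J Q = Q"
  have ann: "x \<odot>\<^bsub>M\<^esub> q = \<zero>\<^bsub>M\<^esub>" if "x \<in> left_ann R J n" "q \<in> Q" for x n q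
    using that
  proof (induction n arbitrary: x q)
    case 0
    then show ?case using act_zero_ring mod.gsubD(3)[OF Q(1)] by auto
  next
    case (Suc n)
    then have x: "x \<in> carrier R" "\<forall>j\<in>J. j \<otimes>\<^bsub>R\<^esub> x \<in> left_ann R J n" by auto
    have "times_J Q \<subseteq> {m \<in> carrier M. \<forall>a\<in>{x}. a \<odot>\<^bsub>M\<^esub> m \<in> {\<zero>\<^bsub>M\<^esub>}}"
    proof (rule times_J_least)
      show "additive_subgroup {m \<in> carrier M. \<forall>a\<in>{x}. a \<odot>\<^bsub>M\<^esub> m \<in> {\<zero>\<^bsub>M\<^esub>}} M"
        using cotransporter_subgroup[OF mod.gsubD(2)[OF mod.gsub_zero]] x by blast
      show "j \<odot>\<^bsub>M\<^esub> q \<in> {m \<in> carrier M. \<forall>a\<in>{x}. a \<odot>\<^bsub>M\<^esub> m \<in> {\<zero>\<^bsub>M\<^esub>}}" if jq: "j \<in> J" "q \<in> Q" for j q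
      proof -
        have c: "j \<in> carrier R" "q \<in> carrier M" using jq J_carrier mod.gsubD(3)[OF Q(1)] by auto
        have "x \<odot>\<^bsub>M\<^esub> (j \<odot>\<^bsub>M\<^esub> q) = \<zero>\<^bsub>M\<^esub>"
          using right_act_assoc[OF c(1) x(1) c(2)] Suc.IH x(2) jq by simp
        then show ?thesis using act_closed c by simp
      qed
    qed
    then show ?case using Suc.prems(2) eq by auto
  qed
  obtain s q where q: "s \<in> arr \<Gamma>" "q \<in> B s" "q \<in> Q" "q \<notin> {\<zero>\<^bsub>M\<^esub>}"
    using homogeneous_witness[OF mod.gsub_zero Q(1)] Q(2) mod.gsubD(4)[OF Q(1)] by blast
  obtain n where "obj_one R A (src \<Gamma> s) \<in> left_ann R J n"
    using left_nilpotent src_ids q(1) by blast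
  from ann[OF this q(3)] show False using q right_unital by simp
qed

lemma gsub_chain_Union:
  assumes ne: "\<C> \<noteq> {}" and ch: "\<And>X Y. \<lbrakk>X \<in> \<C>; Y \<in> \<C>\<rbrakk> \<Longrightarrow> X \<subseteq> Y \<or> Y \<subseteq> X"
    and sub: "\<And>X. X \<in> \<C> \<Longrightarrow> mod.gsub X"
  shows "mod.gsub (\<Union>\<C>)"
proof -
  have add: "x \<oplus>\<^bsub>M\<^esub> y \<in> \<Union>\<C>" if xy: "x \<in> \<Union>\<C>" "y \<in> \<Union>\<C>" for x y
  proof -
    obtain X Y where XY: "X \<in> \<C>" "Y \<in> \<C>" "x \<in> X" "y \<in> Y" using xy by blast
    then have "\<exists>Z\<in>\<C>. x \<in> Z \<and> y \<in> Z" using ch[OF XY(1,2)] by blast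
    then show ?thesis using mod.gsubD(5)[OF sub] by blast
  qed
  have "\<zero>\<^bsub>M\<^esub> \<in> \<Union>\<C>" using ne mod.gsubD(4)[OF sub] by blast
  moreover have "\<Union>\<C> \<subseteq> carrier M" using mod.gsubD(3)[OF sub] by blast
  moreover have "\<ominus>\<^bsub>M\<^esub> x \<in> \<Union>\<C>" if "x \<in> \<Union>\<C>" for x using that mod.gsubD(6)[OF sub] by blast
  moreover have "mod.pr g x \<in> \<Union>\<C>" if "x \<in> \<Union>\<C>" "g \<in> arr \<Gamma>" for x g
    using that mod.gsubD(8)[OF sub] by blast
  moreover have "a \<odot>\<^bsub>M\<^esub> x \<in> \<Union>\<C>" if "x \<in> \<Union>\<C>" "a \<in> carrier R" for x a
    using that mod.gsubD(9)[OF sub] by blast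
  ultimately show ?thesis
    unfolding mod.graded_submodule_iff graded_subgroup_def M.additive_subgroup_iff using add by simp
qed

text \<open>Since \<open>Q/QJ\<close> is a nonzero gr-semisimple module, a submodule that is maximal among those avoiding a
  generator of a simple submodule is a maximal submodule.\<close>

lemma coatom_exists:
  assumes Q: "mod.gsub Q" "Q \<noteq> {\<zero>\<^bsub>M\<^esub>}"
  shows "\<exists>Y. mod.covers Y Q"
proof -
  let ?Y0 = "times_J Q"
  have Y0: "mod.gsub ?Y0" "?Y0 \<subset> Q" using gsub_times_J[OF Q(1)] times_J_proper[OF Q] .
  \<comment> \<open>Every \<open>q\<close> in \<open>Q\<close> satisfies
    \<open>qJ \<subseteq> QJ\<close>, so an \<open>N\<close> above \<open>QJ\<close> that does not
    contain \<open>Q\<close> misses some product \<open>qu\<close> with \<open>u\<close>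
    minimal.\<close>
  have minimal_elt: "\<exists>s q u. s \<in> arr \<Gamma> \<and> q \<in> B s \<and> q \<in> Q \<and> (\<forall>j\<in>J. j \<odot>\<^bsub>M\<^esub> q \<in> ?Y0) \<and>
      u \<in> A (src \<Gamma> s) \<and> minimal_mod \<Gamma> R A J u \<and> u \<odot>\<^bsub>M\<^esub> q \<in> Q \<and> u \<odot>\<^bsub>M\<^esub> q \<in> B s \<and> u \<odot>\<^bsub>M\<^esub> q \<notin> N"
    if N: "mod.gsub N" "?Y0 \<subseteq> N" "\<not> Q \<subseteq> N" for N
  proof -
    obtain s q where q: "s \<in> arr \<Gamma>" "q \<in> B s" "q \<in> Q" "q \<notin> N"
      using homogeneous_witness[OF N(1) Q(1) N(3)] by metis
    have qJ: "j \<odot>\<^bsub>M\<^esub> q \<in> ?Y0" if "j \<in> J" for j using times_J_mem[OF that q(3)] .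
    then obtain u where u: "u \<in> A (src \<Gamma> s)" "minimal_mod \<Gamma> R A J u" "u \<odot>\<^bsub>M\<^esub> q \<notin> N"
      using minimal_witness[OF N(1) q(1,2,4)] N(2) by blast
    have "u \<in> carrier R" using u rg.part_closed src_closed q by blast
    then have "u \<odot>\<^bsub>M\<^esub> q \<in> Q" using mod.gsubD(9)[OF Q(1)] q(3) by blast
    moreover have "u \<odot>\<^bsub>M\<^esub> q \<in> B s" using minimal_cover(1)[OF N(1) q(1,2) _ u] qJ N(2) by blast
    ultimately show ?thesis using q qJ u by blast
  qed
  obtain s w where w: "s \<in> arr \<Gamma>" "w \<in> B s" "w \<in> Q" "w \<notin> ?Y0"
    using minimal_elt[OF Y0(1)] Y0(2) by blast
  define S where "S = {Y. mod.gsub Y \<and> ?Y0 \<subseteq> Y \<and> Y \<subseteq> Q \<and> w \<notin> Y}"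
  have "\<exists>Y\<in>S. \<forall>X\<in>S. Y \<subseteq> X \<longrightarrow> X = Y"
  proof (rule subset_Zorn_nonempty)
    show "S \<noteq> {}" using Y0 w(4) unfolding S_def by blast
    fix \<C> assume ne: "\<C> \<noteq> {}" and ch: "subset.chain S \<C>"
    have "X \<subseteq> Y \<or> Y \<subseteq> X" if "X \<in> \<C>" "Y \<in> \<C>" for X Y
      using ch that unfolding subset_chain_def by blast
    moreover have CS: "\<C> \<subseteq> S" using ch unfolding subset_chain_def by blast
    ultimately have "mod.gsub (\<Union>\<C>)" using gsub_chain_Union[OF ne] unfolding S_def by blast
    then show "\<Union>\<C> \<in> S" using CS ne unfolding S_def by blast
  qed
  then obtain Y where "Y \<in> S" and max: "\<And>X. \<lbrakk>X \<in> S; Y \<subseteq> X\<rbrakk> \<Longrightarrow> X = Y" by blast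
  then have Y: "mod.gsub Y" "?Y0 \<subseteq> Y" "Y \<subseteq> Q" "w \<notin> Y" unfolding S_def by auto
  have above: "w \<in> X" if "mod.gsub X" "Y \<subset> X" "X \<subseteq> Q" for X
    using max[of X] that Y(2) unfolding S_def by blast
  let ?Yw = "set_add M Y (cyclic w)"
  note Yw = mod.gsub_sum[OF Y(1) gsub_cyclic[OF w(1,2)]]
  have "w \<in> ?Yw" using Yw(3) cyclic_self[OF w(1,2)] by blast
  have Yw_least: "?Yw \<subseteq> X" if "mod.gsub X" "Y \<subseteq> X" "w \<in> X" for X
    using mod.gsub_sum_least[OF that(1,2)] cyclic_least[OF that(1,3)] by blast
  have "Q \<subseteq> ?Yw"
  proof (rule ccontr)
    assume nQ: "\<not> Q \<subseteq> ?Yw"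
    have "?Y0 \<subseteq> ?Yw" using Y(2) Yw(2) by blast
    from minimal_elt[OF Yw(1) this nQ] obtain s' q u where q: "s' \<in> arr \<Gamma>" "q \<in> B s'" "q \<in> Q"
        "\<forall>j\<in>J. j \<odot>\<^bsub>M\<^esub> q \<in> ?Y0" and u: "u \<in> A (src \<Gamma> s')" "minimal_mod \<Gamma> R A J u"
        and uq: "u \<odot>\<^bsub>M\<^esub> q \<in> Q" "u \<odot>\<^bsub>M\<^esub> q \<in> B s'" "u \<odot>\<^bsub>M\<^esub> q \<notin> ?Yw"
      by blast
    \<comment> \<open>The product \<open>qu\<close> outside \<open>Y + wR\<close> yields a cover
      \<open>?Z\<close> of \<open>Y\<close> inside \<open>Q\<close>. Maximality of \<open>Y\<close>
      forces \<open>w\<close> into \<open>?Z\<close>, so \<open>?Z\<close> equals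
      \<open>Y + wR\<close>, which would then contain \<open>qu\<close>.\<close>
    let ?Z = "set_add M Y (cyclic (u \<odot>\<^bsub>M\<^esub> q))"
    have "u \<odot>\<^bsub>M\<^esub> q \<notin> Y" using uq(3) Yw(2) by blast
    moreover have "j \<odot>\<^bsub>M\<^esub> q \<in> Y" if "j \<in> J" for j using q(4) that Y(2) by blast
    ultimately have cov: "mod.covers Y ?Z"
      using minimal_cover(2)[OF Y(1) q(1,2) _ u] by blast
    have "?Z \<subseteq> Q"
      using mod.gsub_sum_least[OF Q(1) Y(3)] cyclic_least[OF Q(1) uq(1)] by blast
    then have "w \<in> ?Z" using above[of ?Z] cov unfolding mod.covers_def by blast
    then have "?Yw \<subseteq> ?Z" using Yw_least cov unfolding mod.covers_def by blast
    then have "?Yw = ?Z"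
      using cov Yw(1,2) \<open>w \<in> ?Yw\<close> Y(4) unfolding mod.covers_def by blast
    moreover have "u \<odot>\<^bsub>M\<^esub> q \<in> ?Z"
      using mod.gsub_sum(3)[OF Y(1) gsub_cyclic[OF q(1) uq(2)]] cyclic_self[OF q(1) uq(2)] by blast
    ultimately show False using uq(3) by simp
  qed
  then have "X = Q" if "mod.gsub X" "Y \<subset> X" "X \<subseteq> Q" for X
    using Yw_least[of X] above[OF that] that by blast
  then show ?thesis
    unfolding mod.covers_def using Y Q(1) w(3) by blast
qed

lemma semiartinian: "semiartinian_object_action \<Gamma> R M B (tgt \<Gamma>)"
  by unfold_locales (use coatom_exists atom_exists tgt_ids component_act_object in auto)

end

section \<open>Change of records\<close>

text \<open>Finite sums, components and cosets depend on carrier, addition and zero only. This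
  transfers them between \<open>R\<close>, its regular module, its opposite ring and the two forms
  of the quotient by the radical.\<close>

lemma same_additive_structure:
  fixes G :: "('m, 'x) ring_scheme" and G' :: "('m, 'y) ring_scheme"
  assumes c: "carrier G = carrier G'" "add G = add G'" "zero G = zero G'"
  shows "finsum G = finsum G'" "a_inv G = a_inv G'" "a_minus G = a_minus G'"
    "additive_subgroup H G = additive_subgroup H G'"
    "internal_sum G I B = internal_sum G' I B"
    "internal_direct_sum G I B N = internal_direct_sum G' I B N"
    "component G I B = component G' I B"
    "graded_subgroup G I B N = graded_subgroup G' I B N"
    "a_r_coset G = a_r_coset G'"
proof -
  show 1: "finsum G = finsum G'"
    by (intro ext) (simp add: finsum_def finprod_def c)
  show 2: "a_inv G = a_inv G'"
    by (intro ext) (simp add: a_inv_def m_inv_def c)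
  show "a_minus G = a_minus G'"
    by (intro ext) (simp add: a_minus_def c 2)
  have 3: "additive_subgroup H G = additive_subgroup H G'" for H
    unfolding additive_subgroup_def subgroup_def a_inv_def[symmetric] by (simp add: c 2)
  show "additive_subgroup H G = additive_subgroup H G'" by (rule 3)
  show 4: "internal_sum G I B = internal_sum G' I B"
    by (simp add: internal_sum_def 1)
  show "internal_direct_sum G I B N = internal_direct_sum G' I B N"
    by (simp add: internal_direct_sum_def 1 3 4 c)
  show 5: "component G I B = component G' I B"
    by (intro ext) (simp add: component_def 1 c)
  show "graded_subgroup G I B N = graded_subgroup G' I B N"
    by (simp add: graded_subgroup_def 3 5)
  show "a_r_coset G = a_r_coset G'"
    by (intro ext) (simp add: a_r_coset_def r_coset_def c)
qed

lemma (in abelian_group) abelian_group_same: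
  assumes "carrier G' = carrier G" "add G' = add G" "zero G' = zero G"
  shows "abelian_group G'"
proof (rule abelian_groupI)
  fix x assume "x \<in> carrier G'"
  then show "\<exists>y\<in>carrier G'. y \<oplus>\<^bsub>G'\<^esub> x = \<zero>\<^bsub>G'\<^esub>"
    by (intro bexI[of _ "\<ominus> x"]) (simp_all add: assms l_neg)
qed (simp_all add: assms a_ac)

lemma right_regular_simps:
  "carrier (right_regular R) = carrier R" "add (right_regular R) = add R"
  "zero (right_regular R) = zero R" "a \<odot>\<^bsub>right_regular R\<^esub> x = x \<otimes>\<^bsub>R\<^esub> a"
  by (simp_all add: right_regular_def)

lemmas right_regular_same = same_additive_structure[OF right_regular_simps(1-3)]

section \<open>The graded Jacobson radical\<close>

text \<open>Graded right ideals become graded submodules, to which the preceding theory applies: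
  here \<open>a\<close> acts on \<open>x\<close> as \<open>x \<otimes> a\<close>, and
  \<open>reg.cyclic m\<close> is the right ideal \<open>mR\<close>.\<close>

sublocale graded_ring \<subseteq> reg: graded_right_module \<Gamma> R A "right_regular R" A
proof -
  have "abelian_group (right_regular R)"
    by (rule abelian_group_same) (simp_all add: right_regular_simps)
  then interpret rr: abelian_group "right_regular R" .
  show "graded_right_module \<Gamma> R A (right_regular R) A"
    by unfold_locales
      (auto simp: right_regular_simps right_regular_same mult_closed mult_assoc distr_left distr_right
        ring_decomp ring_graded ring_graded_zero obj_one_right)
qed

context graded_ring
begin

lemma reg_pr: "reg.mod.pr = rg.pr"
  by (rule right_regular_same(7))

lemma reg_gr_subgroup: "reg.mod.gr_subgroup N = rg.gr_subgroup N"
  by (rule right_regular_same(8))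

lemma right_idealD:
  assumes "reg.mod.gsub N"
  shows "rg.gr_subgroup N" "additive_subgroup N R" "N \<subseteq> carrier R" "\<zero>\<^bsub>R\<^esub> \<in> N"
    "\<And>x y. \<lbrakk>x \<in> N; y \<in> N\<rbrakk> \<Longrightarrow> x \<oplus>\<^bsub>R\<^esub> y \<in> N" "\<And>x. x \<in> N \<Longrightarrow> \<ominus>\<^bsub>R\<^esub> x \<in> N"
    "\<And>x y. \<lbrakk>x \<in> N; y \<in> N\<rbrakk> \<Longrightarrow> x \<ominus>\<^bsub>R\<^esub> y \<in> N"
    "\<And>x g. \<lbrakk>x \<in> N; g \<in> arr \<Gamma>\<rbrakk> \<Longrightarrow> rg.pr g x \<in> N"
    "\<And>a x. \<lbrakk>a \<in> carrier R; x \<in> N\<rbrakk> \<Longrightarrow> x \<otimes>\<^bsub>R\<^esub> a \<in> N"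
  using reg.mod.gsubD[OF assms] by (simp_all add: right_regular_simps right_regular_same)

text \<open>This right ideal is usually written \<open>(I : r)\<close>. It is graded because
  \<open>r\<close> is homogeneous: for \<open>t\<close> composable with \<open>g\<close>, the
  product of \<open>r\<close> with the component of \<open>x\<close> in degree \<open>t\<close> is
  the component of \<open>rx\<close> in degree \<open>gt\<close>; otherwise it is zero.\<close>

lemma gsub_transporter:
  assumes I: "reg.mod.gsub I" and r: "g \<in> arr \<Gamma>" "r \<in> A g"
  shows "reg.mod.gsub {x \<in> carrier R. r \<otimes>\<^bsub>R\<^esub> x \<in> I}"
proof -
  let ?K = "{x \<in> carrier R. r \<otimes>\<^bsub>R\<^esub> x \<in> I}"
  note I' = right_idealD[OF I]
  have rR: "r \<in> carrier R" using rg.part_closed r by blast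
  have "additive_subgroup ?K R"
    using reg.transporter_subgroup[OF reg.mod.gsubD(2)[OF I], of r] rR
    by (simp add: right_regular_simps)
  moreover have "rg.pr t x \<in> ?K" if x: "x \<in> ?K" and t: "t \<in> arr \<Gamma>" for x t
  proof -
    have xt: "rg.pr t x \<in> A t" "rg.pr t x \<in> carrier R"
      using x t rg.component_in rg.component_closed by auto
    have "r \<otimes>\<^bsub>R\<^esub> rg.pr t x \<in> I"
    proof (cases "src \<Gamma> g = tgt \<Gamma> t")
      case True
      have "rg.pr (cmp \<Gamma> g t) (r \<otimes>\<^bsub>R\<^esub> x) = r \<otimes>\<^bsub>R\<^esub> rg.pr t x"
        using reg.component_act[of x g r t] x r t True by (simp add: right_regular_simps reg_pr)
      moreover have "rg.pr (cmp \<Gamma> g t) (r \<otimes>\<^bsub>R\<^esub> x) \<in> I"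
        using I'(8) x cmp_closed[OF r(1) t True] by blast
      ultimately show ?thesis by simp
    next
      case False
      then show ?thesis using ring_graded_zero[OF r(1) t False r(2) xt(1)] I'(4) by simp
    qed
    then show ?thesis using xt by simp
  qed
  moreover have "x \<otimes>\<^bsub>R\<^esub> a \<in> ?K" if "x \<in> ?K" "a \<in> carrier R" for x a
    using that mult_assoc[of r x a] rR I'(9)[of a "r \<otimes>\<^bsub>R\<^esub> x"] mult_closed by auto
  ultimately show ?thesis
    unfolding reg.mod.graded_submodule_iff reg_gr_subgroup
    by (simp add: graded_subgroup_def right_regular_simps)
qed

lemma reg_sum_cyclic_mem:
  "z \<in> set_add (right_regular R) N (reg.cyclic m) \<longleftrightarrow>
    (\<exists>n\<in>N. \<exists>a\<in>carrier R. z = n \<oplus>\<^bsub>R\<^esub> m \<otimes>\<^bsub>R\<^esub> a)"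
  unfolding reg.mod.set_add_iff reg.cyclic_def by (simp add: right_regular_simps)

abbreviation "maximal_right_ideal \<equiv> gr_maximal_right_ideal \<Gamma> R A"

lemma maximal_right_ideal_sum:
  assumes I: "maximal_right_ideal I" and m: "g \<in> arr \<Gamma>" "m \<in> A g" "m \<notin> I" and z: "z \<in> carrier R"
  shows "\<exists>i\<in>I. \<exists>a\<in>carrier R. z = i \<oplus>\<^bsub>R\<^esub> m \<otimes>\<^bsub>R\<^esub> a"
proof -
  have Is: "reg.mod.gsub I" and Imax: "\<And>K. \<lbrakk>reg.mod.gsub K; I \<subseteq> K; K \<noteq> carrier R\<rbrakk> \<Longrightarrow> K = I"
    using I unfolding gr_maximal_right_ideal_def graded_right_ideal_def by auto
  note sum = reg.mod.gsub_sum[OF Is reg.gsub_cyclic[OF m(1,2)]]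
  have "set_add (right_regular R) I (reg.cyclic m) = carrier R"
    using Imax[OF sum(1,2)] sum(3) reg.cyclic_self[OF m(1,2)] m(3) by blast
  then show ?thesis using z reg_sum_cyclic_mem by blast
qed

text \<open>Left multiplication by a homogeneous \<open>r\<close> embeds \<open>R/(I : r)\<close> into the simple module \<open>R/I\<close>, so
  \<open>(I : r)\<close> is again maximal unless it is \<open>R\<close>.\<close>

lemma maximal_transporter:
  assumes I: "maximal_right_ideal I" and r: "g \<in> arr \<Gamma>" "r \<in> A g"
    and x: "x \<in> carrier R" "r \<otimes>\<^bsub>R\<^esub> x \<notin> I"
  shows "maximal_right_ideal {x \<in> carrier R. r \<otimes>\<^bsub>R\<^esub> x \<in> I}"
proof -
  let ?K = "{x \<in> carrier R. r \<otimes>\<^bsub>R\<^esub> x \<in> I}"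
  have Is: "reg.mod.gsub I"
    using I unfolding gr_maximal_right_ideal_def graded_right_ideal_def by auto
  note I' = right_idealD[OF Is]
  have rR: "r \<in> carrier R" using rg.part_closed r by blast
  have K: "reg.mod.gsub ?K" by (rule gsub_transporter[OF Is r])
  have "K' = ?K" if K': "reg.mod.gsub K'" "?K \<subseteq> K'" "K' \<noteq> carrier R" for K'
  proof (rule ccontr)
    assume "K' \<noteq> ?K"
    then obtain t y where y: "t \<in> arr \<Gamma>" "y \<in> A t" "y \<in> K'" "y \<notin> ?K"
      using reg.homogeneous_witness[OF K K'(1)] K'(2) by blast
    note K'' = right_idealD[OF K'(1)]
    have yR: "y \<in> carrier R" using rg.part_closed y by blast
    then have ry: "r \<otimes>\<^bsub>R\<^esub> y \<notin> I" using y by blast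
    have "src \<Gamma> g = tgt \<Gamma> t"
      using ring_graded_zero[OF r(1) y(1) _ r(2) y(2)] ry I'(4) by metis
    then have ry': "r \<otimes>\<^bsub>R\<^esub> y \<in> A (cmp \<Gamma> g t)" "cmp \<Gamma> g t \<in> arr \<Gamma>"
      using ring_graded[OF r(1) y(1) _ r(2) y(2)] cmp_closed[OF r(1) y(1)] by auto
    have "z \<in> K'" if z: "z \<in> carrier R" for z
    proof -
      \<comment> \<open>Maximality of \<open>I\<close> gives \<open>I + ryR = R\<close>, so
        \<open>rz\<close> is matched by \<open>rya\<close> modulo \<open>I\<close>. Then
        \<open>z - ya\<close> lies in \<open>(I : r)\<close> and \<open>ya\<close> in
        \<open>K'\<close>.\<close>
      obtain i a where ia: "i \<in> I" "a \<in> carrier R" "r \<otimes>\<^bsub>R\<^esub> z = i \<oplus>\<^bsub>R\<^esub> (r \<otimes>\<^bsub>R\<^esub> y) \<otimes>\<^bsub>R\<^esub> a"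
        using maximal_right_ideal_sum[OF I ry'(2,1) ry mult_closed[OF rR z]] by blast
      have iR: "i \<in> carrier R" and yaR: "y \<otimes>\<^bsub>R\<^esub> a \<in> carrier R"
        using ia I'(3) mult_closed yR by auto
      have "r \<otimes>\<^bsub>R\<^esub> (z \<ominus>\<^bsub>R\<^esub> y \<otimes>\<^bsub>R\<^esub> a) = r \<otimes>\<^bsub>R\<^esub> z \<ominus>\<^bsub>R\<^esub> r \<otimes>\<^bsub>R\<^esub> (y \<otimes>\<^bsub>R\<^esub> a)"
        using rR z yaR by (simp add: a_minus_def distr_left r_minus_mult)
      also have "\<dots> = i"
        unfolding ia(3) using iR rR yR ia(2) mult_closed[OF rR yaR]
        by (simp add: a_minus_def mult_assoc a_assoc r_neg)
      finally have "z \<ominus>\<^bsub>R\<^esub> y \<otimes>\<^bsub>R\<^esub> a \<in> ?K" using ia(1) z yaR by simp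
      then have "(z \<ominus>\<^bsub>R\<^esub> y \<otimes>\<^bsub>R\<^esub> a) \<oplus>\<^bsub>R\<^esub> y \<otimes>\<^bsub>R\<^esub> a \<in> K'"
        using K''(5,9) K'(2) y(3) ia(2) by blast
      then show ?thesis using z yaR by (simp add: a_minus_def a_assoc l_neg)
    qed
    then show False using K'(3) K''(3) by blast
  qed
  then show ?thesis
    unfolding gr_maximal_right_ideal_def graded_right_ideal_def using K x by blast
qed

section \<open>The radical as a two-sided ideal, and minimal elements modulo it\<close>

abbreviation "J \<equiv> gr_rad \<Gamma> R A"

lemma rad_gsub: "reg.mod.gsub J"
proof -
  have max: "reg.mod.gsub I" if "maximal_right_ideal I" for I
    using that unfolding gr_maximal_right_ideal_def graded_right_ideal_def by auto
  have "additive_subgroup J R"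
    unfolding additive_subgroup_iff gr_rad_def using right_idealD(4-6)[OF max] by auto
  moreover have "rg.pr g x \<in> J" if "x \<in> J" "g \<in> arr \<Gamma>" for x g
    using that right_idealD(8)[OF max] rg.component_closed unfolding gr_rad_def by blast
  moreover have "x \<otimes>\<^bsub>R\<^esub> a \<in> J" if "x \<in> J" "a \<in> carrier R" for x a
    using that right_idealD(9)[OF max] mult_closed unfolding gr_rad_def by blast
  ultimately show ?thesis
    unfolding reg.mod.graded_submodule_iff reg_gr_subgroup
    by (simp add: graded_subgroup_def right_regular_simps)
qed

lemmas radD = right_idealD[OF rad_gsub]

text \<open>If \<open>rx\<close> missed a maximal \<open>I\<close> for a homogeneous
  \<open>r\<close>, then \<open>(I : r)\<close> would be a maximal right ideal missing
  \<open>x\<close>. Additivity in \<open>r\<close> does the rest.\<close>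

lemma rad_left_ideal:
  assumes "r \<in> carrier R" "x \<in> J"
  shows "r \<otimes>\<^bsub>R\<^esub> x \<in> J"
  using rg.graded_subgroup_carrier assms(1)
proof (induction rule: rg.graded_induct)
  case zero
  then show ?case using l_null_mult radD(3,4) assms(2) by auto
next
  case (part g r)
  have xR: "x \<in> carrier R" using radD(3) assms(2) by auto
  have "r \<otimes>\<^bsub>R\<^esub> x \<in> I" if I: "maximal_right_ideal I" for I
  proof (rule ccontr)
    assume "r \<otimes>\<^bsub>R\<^esub> x \<notin> I"
    with maximal_transporter[OF I part(1,2) xR] have "x \<in> {x \<in> carrier R. r \<otimes>\<^bsub>R\<^esub> x \<in> I}"
      using assms(2) unfolding gr_rad_def by blast
    then show False using \<open>r \<otimes>\<^bsub>R\<^esub> x \<notin> I\<close> by simp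
  qed
  then show ?case using mult_closed part(3) xR unfolding gr_rad_def by blast
next
  case (add r s)
  then show ?case using distr_right radD(3,5) assms(2) by auto
qed

text \<open>For left minimality, \<open>x u \<notin> J\<close> lies outside some gr-maximal \<open>I\<close>, so \<open>1 = i + x u r\<close> with \<open>i \<in> I\<close>.
  Then \<open>u - u r x u\<close> lies in \<open>T \<inter> (I : x)\<close>, which is \<open>J\<close> because \<open>T\<close> covers \<open>J\<close>.\<close>

lemma minimal_if_cover:
  assumes cov: "reg.mod.covers J T" and u: "e \<in> arr \<Gamma>" "u \<in> A e" "u \<in> T"
  shows "minimal_mod \<Gamma> R A J u"
  unfolding minimal_mod_def
proof (intro conjI ballI impI)
  have T: "reg.mod.gsub T" "J \<subseteq> T" and Tmin: "\<And>X. \<lbrakk>reg.mod.gsub X; J \<subseteq> X; X \<subseteq> T\<rbrakk> \<Longrightarrow> X = J \<or> X = T"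
    using cov unfolding reg.mod.covers_def by auto
  note T' = right_idealD[OF T(1)]
  have uR: "u \<in> carrier R" using u(3) T'(3) by auto
  {
    fix t x assume x: "t \<in> arr \<Gamma>" "x \<in> A t" "u \<otimes>\<^bsub>R\<^esub> x \<notin> J"
    have xR: "x \<in> carrier R" using rg.part_closed x by blast
    have "src \<Gamma> e = tgt \<Gamma> t"
      using ring_graded_zero[OF u(1) x(1) _ u(2) x(2)] x(3) radD(4) by metis
    then have ux: "cmp \<Gamma> e t \<in> arr \<Gamma>" "u \<otimes>\<^bsub>R\<^esub> x \<in> A (cmp \<Gamma> e t)"
      using ring_graded[OF u(1) x(1) _ u(2) x(2)] cmp_closed[OF u(1) x(1)] by auto
    \<comment> \<open>Since \<open>T\<close> covers \<open>J\<close> and \<open>ux\<close> lies in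
      \<open>T\<close> outside \<open>J\<close>, the sum \<open>J + uxR\<close> is all of
      \<open>T\<close> and contains \<open>u\<close>.\<close>
    note sum = reg.mod.gsub_sum[OF rad_gsub reg.gsub_cyclic[OF ux]]
    have "u \<otimes>\<^bsub>R\<^esub> x \<in> T" using T'(9) u(3) xR by blast
    then have "set_add (right_regular R) J (reg.cyclic (u \<otimes>\<^bsub>R\<^esub> x)) \<subseteq> T"
      using reg.mod.gsub_sum_least[OF T] reg.cyclic_least[OF T(1)] by blast
    then have "set_add (right_regular R) J (reg.cyclic (u \<otimes>\<^bsub>R\<^esub> x)) = T"
      using Tmin[OF sum(1,2)] sum(3) reg.cyclic_self[OF ux] x(3) by blast
    then obtain j y where y: "j \<in> J" "y \<in> carrier R" "u = j \<oplus>\<^bsub>R\<^esub> (u \<otimes>\<^bsub>R\<^esub> x) \<otimes>\<^bsub>R\<^esub> y"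
      using u(3) reg_sum_cyclic_mem by blast
    define b where "b = (u \<otimes>\<^bsub>R\<^esub> x) \<otimes>\<^bsub>R\<^esub> y"
    have jR: "j \<in> carrier R" and bR: "b \<in> carrier R"
      using y radD(3) mult_closed uR xR unfolding b_def by auto
    have "u = j \<oplus>\<^bsub>R\<^esub> b" using y(3) by (simp only: b_def)
    then have "b \<ominus>\<^bsub>R\<^esub> u = b \<ominus>\<^bsub>R\<^esub> (j \<oplus>\<^bsub>R\<^esub> b)" by (rule arg_cong)
    also have "\<dots> = \<ominus>\<^bsub>R\<^esub> j"
      using jR bR by (simp add: a_minus_def minus_add a_lcomm[of b] r_neg)
    finally have "b \<ominus>\<^bsub>R\<^esub> u \<in> J" using radD(6)[OF y(1)] by simp
    then show "\<exists>y\<in>carrier R. (u \<otimes>\<^bsub>R\<^esub> x) \<otimes>\<^bsub>R\<^esub> y \<ominus>\<^bsub>R\<^esub> u \<in> J"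
      using y(2) unfolding b_def by blast
  next
    fix t x assume x: "t \<in> arr \<Gamma>" "x \<in> A t" "x \<otimes>\<^bsub>R\<^esub> u \<notin> J"
    have xR: "x \<in> carrier R" using rg.part_closed x by blast
    have xuR: "x \<otimes>\<^bsub>R\<^esub> u \<in> carrier R" using mult_closed xR uR by simp
    have te: "src \<Gamma> t = tgt \<Gamma> e"
      using ring_graded_zero[OF x(1) u(1) _ x(2) u(2)] x(3) radD(4) by metis
    then have xu: "cmp \<Gamma> t e \<in> arr \<Gamma>" "x \<otimes>\<^bsub>R\<^esub> u \<in> A (cmp \<Gamma> t e)" "tgt \<Gamma> (cmp \<Gamma> t e) = tgt \<Gamma> t"
      using ring_graded[OF x(1) u(1) _ x(2) u(2)] cmp_closed[OF x(1) u(1)] tgt_cmp[OF x(1) u(1)]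
      by auto
    obtain I where I: "maximal_right_ideal I" "x \<otimes>\<^bsub>R\<^esub> u \<notin> I"
      using x(3) xuR unfolding gr_rad_def by blast
    have Is: "reg.mod.gsub I"
      using I unfolding gr_maximal_right_ideal_def graded_right_ideal_def by auto
    note I' = right_idealD[OF Is]
    \<comment> \<open>The object is the target of the degree of \<open>x\<close>, which is also that
      of \<open>xu\<close>, so this identity fixes \<open>xu\<close> from the left.\<close>
    have one: "obj_one R A (tgt \<Gamma> t) \<in> carrier R" using obj_one_closed tgt_ids x(1) by simp
    obtain i r where r: "i \<in> I" "r \<in> carrier R"
        "obj_one R A (tgt \<Gamma> t) = i \<oplus>\<^bsub>R\<^esub> (x \<otimes>\<^bsub>R\<^esub> u) \<otimes>\<^bsub>R\<^esub> r"
      using maximal_right_ideal_sum[OF I(1) xu(1,2) I(2) one] by blast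
    define y where "y = u \<otimes>\<^bsub>R\<^esub> r"
    define z where "z = y \<otimes>\<^bsub>R\<^esub> (x \<otimes>\<^bsub>R\<^esub> u)"
    have yR: "y \<in> carrier R" "y \<in> T" and iR: "i \<in> carrier R"
      using r uR mult_closed I'(3) T'(9) u(3) unfolding y_def by auto
    have zR: "z \<in> carrier R" "z \<in> T"
      using yR xuR mult_closed T'(9) unfolding z_def by auto
    have "x \<otimes>\<^bsub>R\<^esub> u = obj_one R A (tgt \<Gamma> t) \<otimes>\<^bsub>R\<^esub> (x \<otimes>\<^bsub>R\<^esub> u)"
      using obj_one_left[OF xu(1,2)] xu(3) by simp
    also have "\<dots> = i \<otimes>\<^bsub>R\<^esub> (x \<otimes>\<^bsub>R\<^esub> u) \<oplus>\<^bsub>R\<^esub> x \<otimes>\<^bsub>R\<^esub> z"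
      unfolding r(3) y_def z_def using iR xR uR xuR r(2) mult_closed
      by (simp add: distr_right mult_assoc)
    finally have eq: "x \<otimes>\<^bsub>R\<^esub> u = i \<otimes>\<^bsub>R\<^esub> (x \<otimes>\<^bsub>R\<^esub> u) \<oplus>\<^bsub>R\<^esub> x \<otimes>\<^bsub>R\<^esub> z" .
    have ixu: "i \<otimes>\<^bsub>R\<^esub> (x \<otimes>\<^bsub>R\<^esub> u) \<in> I" using I'(9) r(1) xuR by blast
    have "x \<otimes>\<^bsub>R\<^esub> (u \<ominus>\<^bsub>R\<^esub> z) = x \<otimes>\<^bsub>R\<^esub> u \<ominus>\<^bsub>R\<^esub> x \<otimes>\<^bsub>R\<^esub> z"
      using xR uR zR by (simp add: a_minus_def distr_left r_minus_mult)
    also have "\<dots> = (i \<otimes>\<^bsub>R\<^esub> (x \<otimes>\<^bsub>R\<^esub> u) \<oplus>\<^bsub>R\<^esub> x \<otimes>\<^bsub>R\<^esub> z) \<ominus>\<^bsub>R\<^esub> x \<otimes>\<^bsub>R\<^esub> z"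
      using eq by (rule arg_cong)
    also have "\<dots> = i \<otimes>\<^bsub>R\<^esub> (x \<otimes>\<^bsub>R\<^esub> u)"
      using mult_closed[OF iR xuR] mult_closed[OF xR zR(1)] by (simp add: a_minus_def a_assoc r_neg)
    finally have xv: "x \<otimes>\<^bsub>R\<^esub> (u \<ominus>\<^bsub>R\<^esub> z) \<in> I" using ixu by simp
    let ?K = "T \<inter> {s \<in> carrier R. x \<otimes>\<^bsub>R\<^esub> s \<in> I}"
    have K: "reg.mod.gsub ?K"
      by (rule reg.mod.gsub_inter[OF T(1) gsub_transporter[OF Is x(1,2)]])
    have "J \<subseteq> I" using I(1) unfolding gr_rad_def by blast
    then have "J \<subseteq> ?K" using T(2) rad_left_ideal[OF xR] radD(3) by blast
    then have "?K = J \<or> ?K = T" using Tmin K by blast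
    moreover have "?K \<noteq> T" using u(3) I(2) by blast
    moreover have "u \<ominus>\<^bsub>R\<^esub> z \<in> ?K" using xv T'(7) u(3) zR uR by auto
    ultimately have "\<ominus>\<^bsub>R\<^esub> (u \<ominus>\<^bsub>R\<^esub> z) \<in> J" using radD(6) by blast
    moreover have "\<ominus>\<^bsub>R\<^esub> (u \<ominus>\<^bsub>R\<^esub> z) = z \<ominus>\<^bsub>R\<^esub> u"
      using uR zR by (simp add: a_minus_def minus_add a_comm)
    ultimately show "\<exists>y\<in>carrier R. y \<otimes>\<^bsub>R\<^esub> (x \<otimes>\<^bsub>R\<^esub> u) \<ominus>\<^bsub>R\<^esub> u \<in> J"
      using yR(1) z_def by auto
  }
qed

end

section \<open>Gr-semiprimary rings\<close>

context graded_ring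
begin

section \<open>Powers of an ideal and iterated annihilators\<close>

lemma ideal_pow_closed:
  assumes "U \<subseteq> carrier R"
  shows "ideal_pow R U n \<subseteq> carrier R"
proof (induction n)
  case (Suc n)
  have "x \<in> carrier R" if "x \<in> ideal_prod R (ideal_pow R U n) U" for x
    using that by (induction rule: ideal_prod.induct) (use Suc assms mult_closed in auto)
  then show ?case using assms by auto
qed simp

text \<open>\<open>ideal_pow\<close> adds factors on the right, so a new factor on the left has to
  be carried through the generated sums by associativity and induction.\<close>

lemma ideal_pow_left:
  assumes U: "U \<subseteq> carrier R" and j: "j \<in> U"
  shows "\<lbrakk>0 < n; w \<in> ideal_pow R U n\<rbrakk> \<Longrightarrow> j \<otimes>\<^bsub>R\<^esub> w \<in> ideal_pow R U (Suc n)"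
proof (induction n arbitrary: w)
  case (Suc n)
  have jR: "j \<in> carrier R" using U j by auto
  show ?case
  proof (cases "n = 0")
    case True
    then show ?thesis using Suc.prems j by (auto intro: ideal_prod.prod)
  next
    case False
    then have "w \<in> ideal_prod R (ideal_pow R U n) U" using Suc.prems by simp
    then have "w \<in> carrier R \<and> j \<otimes>\<^bsub>R\<^esub> w \<in> ideal_prod R (ideal_pow R U (Suc n)) U"
    proof (induction rule: ideal_prod.induct)
      case (prod v k)
      have c: "v \<in> carrier R" "k \<in> carrier R"
        using prod U ideal_pow_closed[OF U] by auto
      have "j \<otimes>\<^bsub>R\<^esub> v \<in> ideal_pow R U (Suc n)" using Suc.IH False prod by blast
      then have "(j \<otimes>\<^bsub>R\<^esub> v) \<otimes>\<^bsub>R\<^esub> k \<in> ideal_prod R (ideal_pow R U (Suc n)) U"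
        using prod by (intro ideal_prod.prod)
      then show ?case using c jR mult_assoc mult_closed by simp
    next
      case (sum v w)
      then show ?case
        by (auto simp: distr_left jR simp del: ideal_pow.simps intro: ideal_prod.sum)
    qed
    then show ?thesis by simp
  qed
qed simp

text \<open>Factors of \<open>U\<close> are moved over to \<open>x\<close> one by one:
  \<open>xj\<close> kills \<open>U^n\<close> because \<open>jU^n\<close> lies in
  \<open>U^(n+1)\<close>. At exponent one, \<open>xj = 0\<close> already lies in the zeroth
  annihilator.\<close>

lemma right_ann_if_pow:
  assumes U: "U \<subseteq> carrier R" and x: "x \<in> carrier R"
  shows "\<lbrakk>0 < n; \<forall>w\<in>ideal_pow R U n. x \<otimes>\<^bsub>R\<^esub> w = \<zero>\<^bsub>R\<^esub>\<rbrakk> \<Longrightarrow> x \<in> right_ann R U n"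
  using x
proof (induction n arbitrary: x)
  case (Suc n)
  have "x \<otimes>\<^bsub>R\<^esub> j \<in> right_ann R U n" if j: "j \<in> U" for j
  proof (cases "n = 0")
    case True
    then show ?thesis using Suc.prems j by simp
  next
    case False
    have jR: "j \<in> carrier R" using U j by auto
    have "(x \<otimes>\<^bsub>R\<^esub> j) \<otimes>\<^bsub>R\<^esub> w = \<zero>\<^bsub>R\<^esub>" if "w \<in> ideal_pow R U n" for w
      using ideal_pow_left[OF U j _ that] False Suc.prems mult_assoc[of x j w] jR
        ideal_pow_closed[OF U, of n] that by auto
    then show ?thesis using Suc.IH[of "x \<otimes>\<^bsub>R\<^esub> j"] False mult_closed Suc.prems jR by simp
  qed
  then show ?case using Suc.prems by simp
qed simp

lemma left_ann_if_pow:
  assumes U: "U \<subseteq> carrier R" and x: "x \<in> carrier R"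
  shows "\<lbrakk>0 < n; \<forall>w\<in>ideal_pow R U n. w \<otimes>\<^bsub>R\<^esub> x = \<zero>\<^bsub>R\<^esub>\<rbrakk> \<Longrightarrow> x \<in> left_ann R U n"
  using x
proof (induction n arbitrary: x)
  case (Suc n)
  have "j \<otimes>\<^bsub>R\<^esub> x \<in> left_ann R U n" if j: "j \<in> U" for j
  proof (cases "n = 0")
    case True
    then show ?thesis using Suc.prems j by simp
  next
    case False
    have jR: "j \<in> carrier R" using U j by auto
    have "w \<otimes>\<^bsub>R\<^esub> (j \<otimes>\<^bsub>R\<^esub> x) = \<zero>\<^bsub>R\<^esub>" if w: "w \<in> ideal_pow R U n" for w
    proof -
      have "w \<otimes>\<^bsub>R\<^esub> j \<in> ideal_pow R U (Suc n)" using False w j by (simp add: ideal_prod.prod)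
      then show ?thesis
        using Suc.prems mult_assoc[of w j x] jR ideal_pow_closed[OF U, of n] w by auto
    qed
    then show ?thesis using Suc.IH[of "j \<otimes>\<^bsub>R\<^esub> x"] False mult_closed Suc.prems jR by simp
  qed
  then show ?case using Suc.prems by simp
qed simp

section \<open>The quotient by the radical, as a ring and as a module\<close>

lemma cosets_rad: "a_r_coset (right_regular R) = a_r_coset R"
  by (rule right_regular_same(9))

text \<open>Semisimplicity is stated in \<open>RJ\<close>, the regular module of the quotient ring.
  The correspondence with right ideals containing \<open>J\<close> lives in \<open>QJ\<close>, a
  module over \<open>R\<close>. Both have the same additive group and, as shown below, the same
  graded submodules.\<close>

abbreviation "RJ \<equiv> right_regular (R Quot J)"
abbreviation "QJ \<equiv> quot_module (right_regular R) J"
abbreviation "AJ \<equiv> quot_grading R J A"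

lemma RJ_additive: "carrier RJ = carrier QJ" "add RJ = add QJ" "zero RJ = zero QJ"
proof -
  show "carrier RJ = carrier QJ"
    by (simp add: right_regular_def FactRing_def quot_module_def A_RCOSETS_def RCOSETS_def r_coset_def)
  show "add RJ = add QJ"
    by (intro ext) (simp add: right_regular_def FactRing_def quot_module_def set_add_def set_mult_def)
  show "zero RJ = zero QJ"
    by (simp add: right_regular_def FactRing_def quot_module_def)
qed

lemma AJ_eq: "AJ = quot_grading (right_regular R) J A"
  by (simp add: quot_grading_def cosets_rad)

lemma rad_quotient: "graded_quotient (right_regular R) (arr \<Gamma>) A J QJ"
  by (rule reg.mod.quotient_graded[OF rad_gsub])

lemma carrier_Quot: "carrier (R Quot J) = (\<lambda>a. J +>\<^bsub>R\<^esub> a) ` carrier R"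
  by (auto simp: FactRing_def A_RCOSETS_def')

text \<open>For representatives \<open>x' = j + x\<close> and \<open>a' = k + a\<close> the
  difference \<open>x'a' - xa\<close> is \<open>ja' + xk\<close>, which lies in \<open>J\<close>
  because \<open>J\<close> is a two-sided ideal.\<close>

lemma RJ_action:
  assumes a: "a \<in> carrier R" and x: "x \<in> carrier R"
  shows "(J +>\<^bsub>R\<^esub> a) \<odot>\<^bsub>RJ\<^esub> (J +>\<^bsub>R\<^esub> x) = a \<odot>\<^bsub>QJ\<^esub> (J +>\<^bsub>R\<^esub> x)"
proof -
  interpret q: graded_quotient "right_regular R" "arr \<Gamma>" A J QJ by (rule rad_quotient)
  have self: "y \<in> J +>\<^bsub>R\<^esub> y" if "y \<in> carrier R" for y
    using q.C.a_rcos_self[of y] that by (simp add: right_regular_simps cosets_rad)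
  have prod: "J +>\<^bsub>R\<^esub> (x' \<otimes>\<^bsub>R\<^esub> a') = J +>\<^bsub>R\<^esub> (x \<otimes>\<^bsub>R\<^esub> a)"
    if x': "x' \<in> J +>\<^bsub>R\<^esub> x" and a': "a' \<in> J +>\<^bsub>R\<^esub> a" for x' a'
  proof -
    have "x' \<in> (\<Union>j\<in>J. {j \<oplus>\<^bsub>R\<^esub> x})" "a' \<in> (\<Union>j\<in>J. {j \<oplus>\<^bsub>R\<^esub> a})"
      using x' a' unfolding a_r_coset_def' .
    then obtain j k where jk: "j \<in> J" "x' = j \<oplus>\<^bsub>R\<^esub> x" "k \<in> J" "a' = k \<oplus>\<^bsub>R\<^esub> a"
      by (elim UN_E singletonE)
    have c: "j \<in> carrier R" "k \<in> carrier R" "x' \<in> carrier R" "a' \<in> carrier R"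
      using jk radD(3) x a by auto
    have "x' \<otimes>\<^bsub>R\<^esub> a' = (j \<otimes>\<^bsub>R\<^esub> a' \<oplus>\<^bsub>R\<^esub> x \<otimes>\<^bsub>R\<^esub> k) \<oplus>\<^bsub>R\<^esub> x \<otimes>\<^bsub>R\<^esub> a"
    proof -
      have "x' \<otimes>\<^bsub>R\<^esub> a' = j \<otimes>\<^bsub>R\<^esub> a' \<oplus>\<^bsub>R\<^esub> x \<otimes>\<^bsub>R\<^esub> a'" unfolding jk(2) using c x by (simp add: distr_right)
      also have "x \<otimes>\<^bsub>R\<^esub> a' = x \<otimes>\<^bsub>R\<^esub> k \<oplus>\<^bsub>R\<^esub> x \<otimes>\<^bsub>R\<^esub> a" unfolding jk(4) using c x a by (simp add: distr_left)
      finally show ?thesis using c x a mult_closed by (simp add: a_assoc)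
    qed
    moreover have "j \<otimes>\<^bsub>R\<^esub> a' \<oplus>\<^bsub>R\<^esub> x \<otimes>\<^bsub>R\<^esub> k \<in> J"
      using radD(5,9) rad_left_ideal jk c x by simp
    ultimately have "x' \<otimes>\<^bsub>R\<^esub> a' \<ominus>\<^bsub>R\<^esub> x \<otimes>\<^bsub>R\<^esub> a \<in> J"
      using c x a mult_closed radD(3) by (simp add: a_minus_def a_assoc r_neg)
    then show ?thesis
      using q.coset_eq_iff[of "x' \<otimes>\<^bsub>R\<^esub> a'" "x \<otimes>\<^bsub>R\<^esub> a"] c x a mult_closed
      by (simp add: right_regular_simps right_regular_same cosets_rad)
  qed
  have "(J +>\<^bsub>R\<^esub> a) \<odot>\<^bsub>RJ\<^esub> (J +>\<^bsub>R\<^esub> x)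
      = (\<Union>x'\<in>J +>\<^bsub>R\<^esub> x. \<Union>a'\<in>J +>\<^bsub>R\<^esub> a. J +>\<^bsub>R\<^esub> (x' \<otimes>\<^bsub>R\<^esub> a'))"
    by (simp add: right_regular_def FactRing_def rcoset_mult_def)
  also have "\<dots> = (\<Union>x'\<in>J +>\<^bsub>R\<^esub> x. \<Union>a'\<in>J +>\<^bsub>R\<^esub> a. J +>\<^bsub>R\<^esub> (x \<otimes>\<^bsub>R\<^esub> a))"
    using prod by (intro SUP_cong refl)
  also have "\<dots> = (\<Union>x'\<in>J +>\<^bsub>R\<^esub> x. J +>\<^bsub>R\<^esub> (x \<otimes>\<^bsub>R\<^esub> a))"
    using self[OF a] by (intro SUP_cong refl cSUP_const) blast
  also have "\<dots> = J +>\<^bsub>R\<^esub> (x \<otimes>\<^bsub>R\<^esub> a)"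
    using self[OF x] by (intro cSUP_const) blast
  finally show ?thesis
    using reg.mod.quotient_action[OF rad_gsub a, of x] x by (simp add: right_regular_simps cosets_rad)
qed

lemma QJ_carrier: "carrier QJ = (\<lambda>a. J +>\<^bsub>R\<^esub> a) ` carrier R"
  using carrier_Quot RJ_additive(1) by (simp add: right_regular_simps)

text \<open>A coset acts on \<open>RJ\<close> as any of its representatives acts on
  \<open>QJ\<close>, and the laws are transferred along this.\<close>

lemma RJ_graded_action: "graded_action \<Gamma> (R Quot J) RJ AJ"
proof -
  interpret Q: graded_action \<Gamma> R QJ AJ
    unfolding AJ_eq by (rule reg.mod.quotient_graded_action[OF rad_gsub])
  have "abelian_group RJ" using Q.abelian_group_same RJ_additive by blast
  then interpret RJ: abelian_group RJ .
  show ?thesis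
  proof unfold_locales
    show "internal_direct_sum RJ (arr \<Gamma>) AJ (carrier RJ)"
      using Q.decomposition same_additive_structure(6)[OF RJ_additive] RJ_additive(1) by metis
  next
    fix a m assume "a \<in> carrier (R Quot J)" "m \<in> carrier RJ"
    then obtain b x where "a = J +>\<^bsub>R\<^esub> b" "m = J +>\<^bsub>R\<^esub> x" "b \<in> carrier R" "x \<in> carrier R"
      unfolding carrier_Quot RJ_additive(1) QJ_carrier by blast
    then show "a \<odot>\<^bsub>RJ\<^esub> m \<in> carrier RJ"
      using RJ_action Q.action_closed[of b m] QJ_carrier RJ_additive(1) by auto
  next
    fix a m n assume "a \<in> carrier (R Quot J)" and mn: "m \<in> carrier RJ" "n \<in> carrier RJ"
    then obtain b where b: "a = J +>\<^bsub>R\<^esub> b" "b \<in> carrier R" unfolding carrier_Quot by blast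
    have *: "a \<odot>\<^bsub>RJ\<^esub> k = b \<odot>\<^bsub>QJ\<^esub> k" if "k \<in> carrier RJ" for k
      using that b RJ_action unfolding RJ_additive(1) QJ_carrier by auto
    have "a \<odot>\<^bsub>RJ\<^esub> (m \<oplus>\<^bsub>RJ\<^esub> n) = b \<odot>\<^bsub>QJ\<^esub> (m \<oplus>\<^bsub>RJ\<^esub> n)"
      using * mn RJ.a_closed by blast
    also have "\<dots> = b \<odot>\<^bsub>QJ\<^esub> m \<oplus>\<^bsub>RJ\<^esub> b \<odot>\<^bsub>QJ\<^esub> n"
      using Q.action_add[OF b(2)] mn by (simp add: RJ_additive)
    finally show "a \<odot>\<^bsub>RJ\<^esub> (m \<oplus>\<^bsub>RJ\<^esub> n) = a \<odot>\<^bsub>RJ\<^esub> m \<oplus>\<^bsub>RJ\<^esub> a \<odot>\<^bsub>RJ\<^esub> n"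
      using * mn by simp
  qed
qed

lemma RJ_submodule_iff:
  "graded_submodule \<Gamma> (R Quot J) RJ AJ N \<longleftrightarrow> graded_submodule \<Gamma> R QJ AJ N"
proof -
  interpret Q: graded_action \<Gamma> R QJ AJ
    unfolding AJ_eq by (rule reg.mod.quotient_graded_action[OF rad_gsub])
  interpret RJ: graded_action \<Gamma> "R Quot J" RJ AJ by (rule RJ_graded_action)
  have "(\<forall>a\<in>carrier (R Quot J). \<forall>k\<in>N. a \<odot>\<^bsub>RJ\<^esub> k \<in> N) \<longleftrightarrow> (\<forall>b\<in>carrier R. \<forall>k\<in>N. b \<odot>\<^bsub>QJ\<^esub> k \<in> N)"
    if N: "N \<subseteq> carrier QJ"
  proof -
    have "(J +>\<^bsub>R\<^esub> b) \<odot>\<^bsub>RJ\<^esub> k = b \<odot>\<^bsub>QJ\<^esub> k" if "k \<in> N" "b \<in> carrier R" for k b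
      using that N RJ_action unfolding QJ_carrier by auto
    then show ?thesis unfolding carrier_Quot by auto
  qed
  moreover have "Q.gr_subgroup N \<Longrightarrow> N \<subseteq> carrier QJ"
    using Q.graded_subgroupD(1) Q.additive_subgroupD(1) by blast
  ultimately show ?thesis
    unfolding Q.graded_submodule_iff RJ.graded_submodule_iff
      same_additive_structure(8)[OF RJ_additive] by blast
qed

lemma cover_if_simple:
  assumes N: "graded_submodule \<Gamma> (R Quot J) RJ AJ N"
    and simple: "gr_simple \<Gamma> (R Quot J) (RJ\<lparr>carrier := N\<rparr>) (sub_grading N AJ)"
  shows "reg.mod.covers J (\<Union>N)" "N = (\<lambda>x. J +>\<^bsub>R\<^esub> x) ` \<Union>N"
proof -
  interpret RJ: graded_action \<Gamma> "R Quot J" RJ AJ by (rule RJ_graded_action)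
  let ?im = "\<lambda>X. (\<lambda>x. J +>\<^bsub>R\<^esub> x) ` X"
  have NQ: "graded_submodule \<Gamma> R QJ (quot_grading (right_regular R) J A) N"
    using N RJ_submodule_iff AJ_eq by simp
  note T = reg.mod.quotient_submodule_Union[OF rad_gsub NQ, unfolded cosets_rad]
  note im_zero = reg.mod.quotient_image_zero[OF rad_gsub, unfolded cosets_rad]
  note im_inj = reg.mod.quotient_image_inj[OF rad_gsub, unfolded cosets_rad]
  show im_T: "N = ?im (\<Union>N)" using T(3) by simp
  have N0: "N \<noteq> {\<zero>\<^bsub>QJ\<^esub>}"
    using simple by (simp add: gr_simple_def RJ_additive(3))
  have "\<Union>N \<noteq> J"
  proof
    assume "\<Union>N = J"
    then have "?im (\<Union>N) = {\<zero>\<^bsub>QJ\<^esub>}" using im_zero by simp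
    then show False using N0 im_T by simp
  qed
  moreover have "X = J \<or> X = \<Union>N" if X: "reg.mod.gsub X" "J \<subseteq> X" "X \<subseteq> \<Union>N" for X
  proof -
    have "graded_submodule \<Gamma> (R Quot J) RJ AJ (?im X)"
      using reg.mod.quotient_submodule_image[OF rad_gsub X(1), unfolded cosets_rad] RJ_submodule_iff AJ_eq
      by simp
    moreover have "?im X \<subseteq> N" using X(3) im_T by blast
    ultimately have "graded_submodule \<Gamma> (R Quot J) (RJ\<lparr>carrier := N\<rparr>) (sub_grading N AJ) (?im X)"
      using RJ.graded_submodule_restrict[OF N] by blast
    then have "?im X = {\<zero>\<^bsub>QJ\<^esub>} \<or> ?im X = N"
      using simple by (simp add: gr_simple_def RJ_additive(3))
    then have "?im X = ?im J \<or> ?im X = ?im (\<Union>N)" using im_zero im_T by simp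
    then show ?thesis
      using im_inj[OF X(1,2) rad_gsub order_refl] im_inj[OF X(1,2) T(1,2)] by blast
  qed
  ultimately show "reg.mod.covers J (\<Union>N)"
    unfolding reg.mod.covers_def using rad_gsub T(1,2) by blast
qed

text \<open>Each simple summand lifts to a cover \<open>T\<close> of \<open>J\<close>. The component
  of degree \<open>e\<close> of an element of \<open>T\<close> is again in \<open>T\<close>, hence
  minimal by \<open>minimal_if_cover\<close>, hence in \<open>H\<close>. The coset of
  \<open>1_e\<close> is a finite sum of elements of simple summands.\<close>

lemma semisimple_generate:
  assumes ss: "gr_semisimple_ring \<Gamma> (R Quot J) AJ"
    and e: "e \<in> ids \<Gamma>" and H: "additive_subgroup H R" "J \<subseteq> H"
      "\<And>u. \<lbrakk>u \<in> A e; minimal_mod \<Gamma> R A J u\<rbrakk> \<Longrightarrow> u \<in> H"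
  shows "obj_one R A e \<in> H"
proof -
  interpret RJ: graded_action \<Gamma> "R Quot J" RJ AJ by (rule RJ_graded_action)
  interpret q: graded_quotient "right_regular R" "arr \<Gamma>" A J QJ by (rule rad_quotient)
  have e': "e \<in> arr \<Gamma>" using e by (simp add: ids_def)
  obtain \<S> where S: "\<And>N. N \<in> \<S> \<Longrightarrow> graded_submodule \<Gamma> (R Quot J) RJ AJ N"
      "\<And>N. N \<in> \<S> \<Longrightarrow> gr_simple \<Gamma> (R Quot J) (RJ\<lparr>carrier := N\<rparr>) (sub_grading N AJ)"
      and sum: "carrier RJ = internal_sum RJ \<S> (\<lambda>N. N)"
    using ss unfolding gr_semisimple_ring_def gr_semisimple_def by blast
  note H' = additive_subgroupD[OF H(1)]
  \<comment> \<open>The summands of \<open>1_e\<close> need not be homogeneous, so only their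
    components of degree \<open>e\<close> are tested against \<open>H\<close>; for
    \<open>1_e\<close> that component is \<open>1_e\<close> itself.\<close>
  define K where "K = {x \<in> carrier R. rg.pr e x \<in> H}"
  have K: "additive_subgroup K R"
    unfolding K_def using H' by (auto simp: additive_subgroup_iff rg.component_add rg.component_minus
      rg.component_zero)
  have "additive_subgroup K (right_regular R)" using K by (simp add: right_regular_same)
  then have imK: "additive_subgroup ((\<lambda>x. J +>\<^bsub>R\<^esub> x) ` K) RJ"
    using q.additive_subgroup_image same_additive_structure(4)[OF RJ_additive]
    by (simp add: cosets_rad)
  have N_sub: "N \<subseteq> (\<lambda>x. J +>\<^bsub>R\<^esub> x) ` K" if "N \<in> \<S>" for N
  proof -
    note cov = cover_if_simple[OF S(1)[OF that] S(2)[OF that]]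
    have T: "reg.mod.gsub (\<Union>N)" using cov(1) unfolding reg.mod.covers_def by blast
    have "rg.pr e x \<in> H" if x: "x \<in> \<Union>N" for x
    proof (rule H(3))
      have xR: "x \<in> carrier R" using right_idealD(3)[OF T] x by blast
      show "rg.pr e x \<in> A e" by (rule rg.component_in[OF e' xR])
      then show "minimal_mod \<Gamma> R A J (rg.pr e x)"
        using minimal_if_cover[OF cov(1) e'] right_idealD(8)[OF T x e'] by blast
    qed
    then have "\<Union>N \<subseteq> K" unfolding K_def using right_idealD(3)[OF T] by blast
    then have "(\<lambda>x. J +>\<^bsub>R\<^esub> x) ` \<Union>N \<subseteq> (\<lambda>x. J +>\<^bsub>R\<^esub> x) ` K" by (rule image_mono)
    then show ?thesis unfolding cov(2)[symmetric] .
  qed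
  have one: "obj_one R A e \<in> carrier R" by (rule obj_one_closed[OF e])
  have "J +>\<^bsub>R\<^esub> obj_one R A e \<in> carrier RJ"
    unfolding RJ_additive(1) QJ_carrier using one by blast
  then obtain F f where F: "finite F" "F \<subseteq> \<S>" "\<forall>N\<in>F. f N \<in> N"
      "J +>\<^bsub>R\<^esub> obj_one R A e = finsum RJ f F"
    unfolding sum internal_sum_def by blast
  have "\<forall>N\<in>F. f N \<in> (\<lambda>x. J +>\<^bsub>R\<^esub> x) ` K" using F(2,3) N_sub by blast
  then have "J +>\<^bsub>R\<^esub> obj_one R A e \<in> (\<lambda>x. J +>\<^bsub>R\<^esub> x) ` K"
    unfolding F(4) by (rule RJ.finsum_in_subgroup[OF imK F(1)])
  then obtain x where x: "x \<in> K" "J +>\<^bsub>R\<^esub> obj_one R A e = J +>\<^bsub>R\<^esub> x" by (elim imageE)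
  have xR: "x \<in> carrier R" using x unfolding K_def by simp
  have "obj_one R A e \<ominus>\<^bsub>R\<^esub> x \<in> J"
    using q.coset_eq_iff[of "obj_one R A e" x] one xR x(2)
    by (simp add: right_regular_simps right_regular_same cosets_rad)
  moreover have "J \<subseteq> K" unfolding K_def using radD(3) radD(8)[OF _ e'] H(2) by blast
  ultimately have "(obj_one R A e \<ominus>\<^bsub>R\<^esub> x) \<oplus>\<^bsub>R\<^esub> x \<in> K"
    using additive_subgroupD(3)[OF K] x(1) by blast
  then have "obj_one R A e \<in> K" using one xR by (simp add: a_minus_def a_assoc l_neg)
  then show ?thesis
    unfolding K_def using rg.component_part[OF e' obj_one_in[OF e], of e] by simp
qed

lemma semiprimary_data:
  assumes "gr_semiprimary \<Gamma> R A"
  shows "semiprimary_data \<Gamma> R A J"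
proof unfold_locales
  have ss: "gr_semisimple_ring \<Gamma> (R Quot J) AJ" and nil: "objectwise_nilpotent \<Gamma> R A J"
    using assms by (auto simp: gr_semiprimary_def)
  show "rg.gr_subgroup J" by (rule radD(1))
  show "r \<otimes>\<^bsub>R\<^esub> x \<in> J" if "r \<in> carrier R" "x \<in> J" for r x by (rule rad_left_ideal[OF that])
  show "x \<otimes>\<^bsub>R\<^esub> r \<in> J" if "r \<in> carrier R" "x \<in> J" for r x by (rule radD(9)[OF that])
  show "obj_one R A e \<in> H"
    if "e \<in> ids \<Gamma>" "additive_subgroup H R" "J \<subseteq> H" "\<And>u. \<lbrakk>u \<in> A e; minimal_mod \<Gamma> R A J u\<rbrakk> \<Longrightarrow> u \<in> H"
    for e H by (rule semisimple_generate[OF ss that])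
  fix e assume e: "e \<in> ids \<Gamma>"
  show "\<exists>n. obj_one R A e \<in> right_ann R J n" "\<exists>n. obj_one R A e \<in> left_ann R J n"
    using nil e right_ann_if_pow[OF radD(3) obj_one_closed[OF e]]
      left_ann_if_pow[OF radD(3) obj_one_closed[OF e]]
    unfolding objectwise_nilpotent_def by blast+
qed

end

section \<open>The opposite ring\<close>

text \<open>Composition is reversed while every degree keeps its name, so the gradings
  \<open>A\<close> and \<open>B\<close> serve unchanged on the opposite side.\<close>

definition op_gpd :: "('g, 'x) gpd_scheme \<Rightarrow> 'g gpd" where
  "op_gpd \<Gamma> = \<lparr>arr = arr \<Gamma>, cmp = (\<lambda>g h. cmp \<Gamma> h g), src = tgt \<Gamma>, tgt = src \<Gamma>\<rparr>"

definition op_ring :: "('a, 'y) ring_scheme \<Rightarrow> ('a, 'y) ring_scheme" where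
  "op_ring R = R\<lparr>mult := \<lambda>a b. b \<otimes>\<^bsub>R\<^esub> a\<rparr>"

lemma op_gpd_simps [simp]:
  "arr (op_gpd \<Gamma>) = arr \<Gamma>" "cmp (op_gpd \<Gamma>) g h = cmp \<Gamma> h g"
  "src (op_gpd \<Gamma>) = tgt \<Gamma>" "tgt (op_gpd \<Gamma>) = src \<Gamma>"
  by (simp_all add: op_gpd_def)

lemma op_ring_simps [simp]:
  "carrier (op_ring R) = carrier R" "add (op_ring R) = add R" "zero (op_ring R) = zero R"
  "a \<otimes>\<^bsub>op_ring R\<^esub> b = b \<otimes>\<^bsub>R\<^esub> a"
  by (simp_all add: op_ring_def)

lemmas op_ring_same = same_additive_structure[OF op_ring_simps(1-3)]

lemma (in groupoid) op_groupoid: "groupoid (op_gpd \<Gamma>)"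
proof unfold_locales
  fix g h k
  assume "g \<in> arr (op_gpd \<Gamma>)" "h \<in> arr (op_gpd \<Gamma>)" "k \<in> arr (op_gpd \<Gamma>)"
    "src (op_gpd \<Gamma>) g = tgt (op_gpd \<Gamma>) h" "src (op_gpd \<Gamma>) h = tgt (op_gpd \<Gamma>) k"
  then show "cmp (op_gpd \<Gamma>) (cmp (op_gpd \<Gamma>) g h) k = cmp (op_gpd \<Gamma>) g (cmp (op_gpd \<Gamma>) h k)"
    using cmp_assoc[of k h g] by simp
next
  fix g assume "g \<in> arr (op_gpd \<Gamma>)"
  then show "\<exists>h\<in>arr (op_gpd \<Gamma>). src (op_gpd \<Gamma>) h = tgt (op_gpd \<Gamma>) g \<and> tgt (op_gpd \<Gamma>) h = src (op_gpd \<Gamma>) g \<and>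
      cmp (op_gpd \<Gamma>) h g = src (op_gpd \<Gamma>) g \<and> cmp (op_gpd \<Gamma>) g h = tgt (op_gpd \<Gamma>) g"
    using invertible[of g] by auto
qed (simp_all add: src_closed tgt_closed src_src tgt_src src_tgt tgt_tgt cmp_closed src_cmp tgt_cmp
    cmp_src tgt_cmp_self)

lemma (in groupoid) op_ids: "ids (op_gpd \<Gamma>) = ids \<Gamma>"
  unfolding ids_def using src_tgt tgt_src by (auto, metis, metis)

lemma obj_one_op: "obj_one (op_ring R) A = obj_one R A"
  by (intro ext) (simp add: obj_one_def is_identity_of_def conj_commute)

lemma (in graded_ring) op_graded_ring: "graded_ring (op_gpd \<Gamma>) (op_ring R) A"
proof -
  interpret op: groupoid "op_gpd \<Gamma>" by (rule op_groupoid)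
  have "abelian_group (op_ring R)" by (rule abelian_group_same) simp_all
  then interpret op: abelian_group "op_ring R" .
  show ?thesis
  proof unfold_locales
    show "\<exists>u. is_identity_of (op_ring R) (A e) u" if "e \<in> ids (op_gpd \<Gamma>)" for e
      using that obj_unital[of e] by (simp add: op_ids is_identity_of_def conj_commute)
  qed (use ring_decomp in \<open>simp_all add: mult_closed mult_assoc distr_left distr_right op_ring_same
      ring_graded ring_graded_zero obj_one_op obj_one_left obj_one_right\<close>)
qed

lemma ann_op:
  "right_ann (op_ring R) J n = left_ann R J n" "left_ann (op_ring R) J n = right_ann R J n"
  by (induction n) simp_all

text \<open>Reversing products exchanges the two conjuncts, which is why \<open>minimal_mod\<close>
  asks for both sides.\<close>

lemma minimal_mod_op: "minimal_mod (op_gpd \<Gamma>) (op_ring R) A J u \<longleftrightarrow> minimal_mod \<Gamma> R A J u"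
  unfolding minimal_mod_def by (simp add: op_ring_same conj_commute)

text \<open>\<open>J\<close> remains the same set. The properties of \<open>J\<close> are
  transported, with the two nilpotence conditions trading places, instead of comparing left and
  right radicals.\<close>

lemma (in semiprimary_data) op_semiprimary_data: "semiprimary_data (op_gpd \<Gamma>) (op_ring R) A J"
proof -
  interpret op: graded_ring "op_gpd \<Gamma>" "op_ring R" A by (rule op_graded_ring)
  show ?thesis
    by unfold_locales
      (use J_graded J_left J_right minimal_generate right_nilpotent left_nilpotent in
        \<open>simp_all add: op_ring_same op_ids obj_one_op ann_op minimal_mod_op\<close>)
qed

text \<open>The law \<open>(ba)m = b(am)\<close> of a left module is the law of a right module for
  the reversed product, so the record \<open>M\<close> is kept as it is.\<close>

lemma (in graded_left_module) op_right_module: "graded_right_module (op_gpd \<Gamma>) (op_ring R) A M B"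
proof -
  interpret op: graded_ring "op_gpd \<Gamma>" "op_ring R" A by (rule op_graded_ring)
  show ?thesis
    by unfold_locales
      (use module_decomp in \<open>simp_all add: act_closed act_add_ring act_add_module left_act_assoc
        left_graded left_graded_zero left_unital obj_one_op\<close>)
qed

text \<open>A graded submodule refers to the ring only through its carrier and to the groupoid only
  through its degrees. Both are kept, so chain conditions and lengths are the same on either
  side.\<close>

lemma graded_submodule_op:
  "graded_submodule (op_gpd \<Gamma>) (op_ring R) M B = graded_submodule \<Gamma> R M B"
  by (intro ext) (simp add: graded_submodule_def submodule_def submodule_axioms_def)

lemma chain_notions_op:
  "gr_simple (op_gpd \<Gamma>) (op_ring R) M B = gr_simple \<Gamma> R M B"
  "gr_artinian (op_gpd \<Gamma>) (op_ring R) M B = gr_artinian \<Gamma> R M B"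
  "gr_noetherian (op_gpd \<Gamma>) (op_ring R) M B = gr_noetherian \<Gamma> R M B"
  "obj_part (op_gpd \<Gamma>) p M B = obj_part \<Gamma> p M B"
  by (simp_all add: fun_eq_iff gr_simple_def gr_artinian_def gr_noetherian_def obj_part_def
      graded_submodule_op)

lemma length_op:
  "has_gr_length (op_gpd \<Gamma>) (op_ring R) M B n = has_gr_length \<Gamma> R M B n"
  "finite_gr_length (op_gpd \<Gamma>) (op_ring R) M B = finite_gr_length \<Gamma> R M B"
  by (simp_all add: finite_gr_length_def has_gr_length_def graded_submodule_op chain_notions_op)

lemma (in groupoid) object_notions_op:
  "Gamma0_artinian (op_gpd \<Gamma>) p (op_ring R) M B = Gamma0_artinian \<Gamma> p R M B"
  "Gamma0_noetherian (op_gpd \<Gamma>) p (op_ring R) M B = Gamma0_noetherian \<Gamma> p R M B"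
  "Gamma0_finite_gr_length (op_gpd \<Gamma>) p (op_ring R) M B = Gamma0_finite_gr_length \<Gamma> p R M B"
  "strongly_Gamma0_artinian (op_gpd \<Gamma>) p (op_ring R) M B = strongly_Gamma0_artinian \<Gamma> p R M B"
  "strongly_Gamma0_noetherian (op_gpd \<Gamma>) p (op_ring R) M B = strongly_Gamma0_noetherian \<Gamma> p R M B"
  "strongly_Gamma0_finite_gr_length (op_gpd \<Gamma>) p (op_ring R) M B
    = strongly_Gamma0_finite_gr_length \<Gamma> p R M B"
  by (simp_all add: Gamma0_artinian_def Gamma0_noetherian_def Gamma0_finite_gr_length_def
      strongly_Gamma0_artinian_def strongly_Gamma0_noetherian_def strongly_Gamma0_finite_gr_length_def
      obj_stable_def chain_notions_op length_op graded_submodule_op op_ids)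

theorem theorem5p9:
  fixes \<Gamma> :: "'g gpd" and R :: "'a ring" and A :: "'g \<Rightarrow> 'a set"
    and M :: "('a, 'm) module" and B :: "'g \<Rightarrow> 'm set"
  assumes "groupoid \<Gamma>" and "graded_ring \<Gamma> R A" and "gr_semiprimary \<Gamma> R A"
  shows
   "(graded_right_module \<Gamma> R A M B \<longrightarrow>
      ((gr_noetherian \<Gamma> R M B \<longleftrightarrow> gr_artinian \<Gamma> R M B) \<and>
       (gr_artinian \<Gamma> R M B \<longleftrightarrow> finite_gr_length \<Gamma> R M B)) \<and>
      ((Gamma0_noetherian \<Gamma> (tgt \<Gamma>) R M B \<longleftrightarrow> Gamma0_artinian \<Gamma> (tgt \<Gamma>) R M B) \<and>
       (Gamma0_artinian \<Gamma> (tgt \<Gamma>) R M B \<longleftrightarrow> Gamma0_finite_gr_length \<Gamma> (tgt \<Gamma>) R M B)) \<and>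
      ((strongly_Gamma0_noetherian \<Gamma> (tgt \<Gamma>) R M B \<longleftrightarrow>
          strongly_Gamma0_artinian \<Gamma> (tgt \<Gamma>) R M B) \<and>
       (strongly_Gamma0_artinian \<Gamma> (tgt \<Gamma>) R M B \<longleftrightarrow>
          strongly_Gamma0_finite_gr_length \<Gamma> (tgt \<Gamma>) R M B)))
    \<and>
    (graded_left_module \<Gamma> R A M B \<longrightarrow>
      ((gr_noetherian \<Gamma> R M B \<longleftrightarrow> gr_artinian \<Gamma> R M B) \<and>
       (gr_artinian \<Gamma> R M B \<longleftrightarrow> finite_gr_length \<Gamma> R M B)) \<and>
      ((Gamma0_noetherian \<Gamma> (src \<Gamma>) R M B \<longleftrightarrow> Gamma0_artinian \<Gamma> (src \<Gamma>) R M B) \<and>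
       (Gamma0_artinian \<Gamma> (src \<Gamma>) R M B \<longleftrightarrow> Gamma0_finite_gr_length \<Gamma> (src \<Gamma>) R M B)) \<and>
      ((strongly_Gamma0_noetherian \<Gamma> (src \<Gamma>) R M B \<longleftrightarrow>
          strongly_Gamma0_artinian \<Gamma> (src \<Gamma>) R M B) \<and>
       (strongly_Gamma0_artinian \<Gamma> (src \<Gamma>) R M B \<longleftrightarrow>
          strongly_Gamma0_finite_gr_length \<Gamma> (src \<Gamma>) R M B)))"
proof (intro conjI impI)
  interpret graded_ring \<Gamma> R A by (rule assms(2))
  interpret S: semiprimary_data \<Gamma> R A "gr_rad \<Gamma> R A" by (rule semiprimary_data[OF assms(3)])
  {
    assume "graded_right_module \<Gamma> R A M B"
    then interpret N: semiprimary_right_module \<Gamma> R A M B "gr_rad \<Gamma> R A"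
      using S.semiprimary_data_axioms by (rule semiprimary_right_module.intro)
    interpret N: semiartinian_object_action \<Gamma> R M B "tgt \<Gamma>" by (rule N.semiartinian)
    note equivs = N.chain_conditions_equivalent N.object_chain_conditions_equivalent
      N.strong_chain_conditions_equivalent
    show "gr_noetherian \<Gamma> R M B \<longleftrightarrow> gr_artinian \<Gamma> R M B"
      "gr_artinian \<Gamma> R M B \<longleftrightarrow> finite_gr_length \<Gamma> R M B"
      "Gamma0_noetherian \<Gamma> (tgt \<Gamma>) R M B \<longleftrightarrow> Gamma0_artinian \<Gamma> (tgt \<Gamma>) R M B"
      "Gamma0_artinian \<Gamma> (tgt \<Gamma>) R M B \<longleftrightarrow> Gamma0_finite_gr_length \<Gamma> (tgt \<Gamma>) R M B"
      "strongly_Gamma0_noetherian \<Gamma> (tgt \<Gamma>) R M B \<longleftrightarrow> strongly_Gamma0_artinian \<Gamma> (tgt \<Gamma>) R M B"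
      "strongly_Gamma0_artinian \<Gamma> (tgt \<Gamma>) R M B \<longleftrightarrow>
        strongly_Gamma0_finite_gr_length \<Gamma> (tgt \<Gamma>) R M B"
      by (rule equivs)+
  next
    assume "graded_left_module \<Gamma> R A M B"
    then have "graded_right_module (op_gpd \<Gamma>) (op_ring R) A M B"
      by (rule graded_left_module.op_right_module)
    then interpret N: semiprimary_right_module "op_gpd \<Gamma>" "op_ring R" A M B "gr_rad \<Gamma> R A"
      using S.op_semiprimary_data by (rule semiprimary_right_module.intro)
    \<comment> \<open>The target map of the opposite groupoid is \<open>src \<Gamma>\<close>, so the
      object parts obtained here are those of the left module.\<close>
    interpret N: semiartinian_object_action "op_gpd \<Gamma>" "op_ring R" M B "tgt (op_gpd \<Gamma>)"
      by (rule N.semiartinian)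
    note equivs = N.chain_conditions_equivalent N.object_chain_conditions_equivalent
      N.strong_chain_conditions_equivalent
    show "gr_noetherian \<Gamma> R M B \<longleftrightarrow> gr_artinian \<Gamma> R M B"
      "gr_artinian \<Gamma> R M B \<longleftrightarrow> finite_gr_length \<Gamma> R M B"
      "Gamma0_noetherian \<Gamma> (src \<Gamma>) R M B \<longleftrightarrow> Gamma0_artinian \<Gamma> (src \<Gamma>) R M B"
      "Gamma0_artinian \<Gamma> (src \<Gamma>) R M B \<longleftrightarrow> Gamma0_finite_gr_length \<Gamma> (src \<Gamma>) R M B"
      "strongly_Gamma0_noetherian \<Gamma> (src \<Gamma>) R M B \<longleftrightarrow> strongly_Gamma0_artinian \<Gamma> (src \<Gamma>) R M B"
      "strongly_Gamma0_artinian \<Gamma> (src \<Gamma>) R M B \<longleftrightarrow>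
        strongly_Gamma0_finite_gr_length \<Gamma> (src \<Gamma>) R M B"
      using equivs unfolding op_gpd_simps chain_notions_op length_op object_notions_op .
  }
qed

end
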